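(* Let $B$ be a ring of algebraic integers, let $a,b,c\in B$, and let $A=B[X,Y]/(aX^2+bXY+cY^2-1)$. Let $\Gamma$ be the (finite) set of prime ideals $P$ of $B$ such that $P\supseteq (2,b)B$ and $P\not\supseteq (a,c)B$, and for $P\in\Gamma$ let $F_P$ be the polynomial defined in the context. Then the singular locus of $A$ is $V(H)$, where $$H=\prod_{P\in\Gamma}(P,F_PP^{-1})A.$$
   Context: A ring of algebraic integers is the integral closure of $\mathbb{Z}$ in a finite field extension of $\mathbb{Q}$; it is a Dedekind domain. The singular locus of $A$ is the set of $M\in\mathrm{Spec}(A)$ such that the local ring $A_M$ is not regular. $V(H)$ is the set of prime ideals of $A$ containing $H$; an empty product of ideals is $A$. For $P\in\Gamma$, $B/P$ is a finite field of characteristic $2$, hence perfect. Choose $d,e\in B$ (depending on $P$, and uniquely determined modulo $P$) such that $d^2\equiv a$ and $e^2\equiv c$ modulo $P$. Define $F_P$ as follows. If $a\notin P$: $$F_P=(ae^2-bde+cd^2)Y^2+(2ae-bd)Y+(a-d^2).$$ If $a\in P$ (so $c\notin P$): $$F_P=ae^2X^2-beX+(c-e^2).$$ The coefficients of $F_P$ lie in $P$. With $P^{-1}=\{t\in \mathrm{Frac}(B): tP\subseteq B\}$, the set $F_PP^{-1}=\{tF_P : t\in P^{-1}\}$ is therefore contained in $B[X,Y]$. $(P,F_PP^{-1})A$ denotes the ideal of $A$ generated by the images in $A$ of $P$ and of $F_PP^{-1}$. *)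

theory Defs
  imports
    "HOL-Computational_Algebra.Computational_Algebra"
    "HOL-Library.Extended_Nat"
    "HOL-Algebra.Algebra"
    "HOL-Algebra.Algebraic_Closure_Type"
begin

section \<open>Regular local rings and the singular locus\<close>

definition loc_rel :: "('a, 'm) ring_scheme \<Rightarrow> 'a set \<Rightarrow> (('a \<times> 'a) \<times> ('a \<times> 'a)) set" where
  "loc_rel R S = {((r, s), (r', s')). r \<in> carrier R \<and> s \<in> S \<and> r' \<in> carrier R \<and> s' \<in> S \<and>
     (\<exists>u\<in>S. u \<otimes>\<^bsub>R\<^esub> (r \<otimes>\<^bsub>R\<^esub> s') = u \<otimes>\<^bsub>R\<^esub> (r' \<otimes>\<^bsub>R\<^esub> s))}"

definition loc_frac :: "('a, 'm) ring_scheme \<Rightarrow> 'a set \<Rightarrow> 'a \<Rightarrow> 'a \<Rightarrow> ('a \<times> 'a) set" where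
  "loc_frac R S r s = loc_rel R S `` {(r, s)}"

text \<open>
  The ring of fractions \<open>S\<^sup>-\<^sup>1 R\<close> for a multiplicative set \<open>S\<close>. As for quotient rings, the
  operations take the union over all representatives, all of which yield the same class.
\<close>

definition localization :: "('a, 'm) ring_scheme \<Rightarrow> 'a set \<Rightarrow> ('a \<times> 'a) set ring" where
  "localization R S =
    \<lparr> carrier = (carrier R \<times> S) // loc_rel R S,
      monoid.mult = (\<lambda>x y. \<Union>(r, s)\<in>x. \<Union>(r', s')\<in>y. loc_frac R S (r \<otimes>\<^bsub>R\<^esub> r') (s \<otimes>\<^bsub>R\<^esub> s')),
      one = loc_frac R S \<one>\<^bsub>R\<^esub> \<one>\<^bsub>R\<^esub>,
      ring.zero = loc_frac R S \<zero>\<^bsub>R\<^esub> \<one>\<^bsub>R\<^esub>,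
      add = (\<lambda>x y. \<Union>(r, s)\<in>x. \<Union>(r', s')\<in>y.
               loc_frac R S (r \<otimes>\<^bsub>R\<^esub> s' \<oplus>\<^bsub>R\<^esub> r' \<otimes>\<^bsub>R\<^esub> s) (s \<otimes>\<^bsub>R\<^esub> s')) \<rparr>"

abbreviation localization_at :: "('a, 'm) ring_scheme \<Rightarrow> 'a set \<Rightarrow> ('a \<times> 'a) set ring" where
  "localization_at R M \<equiv> localization R (carrier R - M)"

text \<open>Supremum of the lengths \<open>n\<close> of chains of prime ideals \<open>p 0 \<subset> p 1 \<subset> \<dots> \<subset> p n\<close>.\<close>

definition krull_dim :: "('a, 'm) ring_scheme \<Rightarrow> enat" where
  "krull_dim R = (SUP n \<in> {n. \<exists>p :: nat \<Rightarrow> 'a set.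
      (\<forall>i\<le>n. primeideal (p i) R) \<and> (\<forall>i<n. p i \<subset> p (Suc i))}. enat n)"

definition regular_local_ring :: "('a, 'm) ring_scheme \<Rightarrow> bool" where
  "regular_local_ring R \<longleftrightarrow> cring R \<and> noetherian_ring R \<and> (\<exists>!m. maximalideal m R) \<and>
     (\<forall>m. maximalideal m R \<longrightarrow>
        (\<exists>S. finite S \<and> S \<subseteq> carrier R \<and> Idl\<^bsub>R\<^esub> S = m \<and> enat (card S) = krull_dim R))"

definition Spec :: "('a, 'm) ring_scheme \<Rightarrow> 'a set set" where
  "Spec R = {M. primeideal M R}"

definition singular_locus :: "('a, 'm) ring_scheme \<Rightarrow> 'a set set" where
  "singular_locus R = {M \<in> Spec R. \<not> regular_local_ring (localization_at R M)}"

definition zero_locus :: "('a, 'm) ring_scheme \<Rightarrow> 'a set \<Rightarrow> 'a set set" where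
  "zero_locus R H = {M \<in> Spec R. H \<subseteq> M}"

section \<open>Rings of algebraic integers\<close>

text \<open>
  Number fields are subfields of an arbitrary ambient field of characteristic 0. (Every number
  field embeds, for example, into the complex numbers.)
\<close>

definition number_field :: "'k::field_char_0 set \<Rightarrow> bool" where
  "number_field K \<longleftrightarrow> subfield K (ring_of_type_algebra :: 'k ring) \<and>
     ring.finite_dimension (ring_of_type_algebra :: 'k ring) \<rat> K"

definition ring_of_algebraic_integers :: "'k::field_char_0 set \<Rightarrow> bool" where
  "ring_of_algebraic_integers B \<longleftrightarrow> (\<exists>K. number_field K \<and> B = {x \<in> K. algebraic_int x})"

abbreviation ring_on :: "'r::comm_ring_1 set \<Rightarrow> 'r ring" where
  "ring_on B \<equiv> ring_of_type_algebra\<lparr>carrier := B\<rparr>"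

definition inverse_ideal :: "'k::field set \<Rightarrow> 'k set \<Rightarrow> 'k set" where
  "inverse_ideal B P =
     {t. (\<exists>x\<in>B. \<exists>y\<in>B. y \<noteq> 0 \<and> t = x / y) \<and> (\<forall>p\<in>P. t * p \<in> B)}"

section \<open>The coordinate ring of the conic\<close>

text \<open>
  \<open>B[X,Y]\<close> is realised as \<open>B[X][Y]\<close>, inside the polynomials over the ambient field of \<open>B\<close>:
  the outer variable is \<open>Y\<close>, the inner one \<open>X\<close>.
\<close>

abbreviation const2 :: "'k::comm_ring_1 \<Rightarrow> 'k poly poly" where
  "const2 r \<equiv> [:[:r:]:]"

abbreviation varX :: "'k::comm_ring_1 poly poly" where
  "varX \<equiv> [:[:0, 1:]:]"

abbreviation varY :: "'k::comm_ring_1 poly poly" where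
  "varY \<equiv> [:0, 1:]"

definition poly_ring2 :: "'k::comm_ring_1 set \<Rightarrow> 'k poly poly ring" where
  "poly_ring2 B = ring_on {p. \<forall>i j. Polynomial.coeff (Polynomial.coeff p i) j \<in> B}"

definition conic_ideal :: "'k::comm_ring_1 set \<Rightarrow> 'k \<Rightarrow> 'k \<Rightarrow> 'k \<Rightarrow> 'k poly poly set" where
  "conic_ideal B a b c = Idl\<^bsub>poly_ring2 B\<^esub>
     {const2 a * varX ^ 2 + const2 b * varX * varY + const2 c * varY ^ 2 - 1}"

definition conic_ring :: "'k::comm_ring_1 set \<Rightarrow> 'k \<Rightarrow> 'k \<Rightarrow> 'k \<Rightarrow> 'k poly poly set ring" where
  "conic_ring B a b c = poly_ring2 B Quot conic_ideal B a b c"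

definition to_conic_ring ::
  "'k::comm_ring_1 set \<Rightarrow> 'k \<Rightarrow> 'k \<Rightarrow> 'k \<Rightarrow> 'k poly poly \<Rightarrow> 'k poly poly set" where
  "to_conic_ring B a b c p = conic_ideal B a b c +>\<^bsub>poly_ring2 B\<^esub> p"

section \<open>The ideal \<open>H\<close>\<close>

definition Gamma :: "'k::comm_ring_1 set \<Rightarrow> 'k \<Rightarrow> 'k \<Rightarrow> 'k \<Rightarrow> 'k set set" where
  "Gamma B a b c = {P \<in> Spec (ring_on B).
     Idl\<^bsub>ring_on B\<^esub> {2, b} \<subseteq> P \<and> \<not> Idl\<^bsub>ring_on B\<^esub> {a, c} \<subseteq> P}"

text \<open>
  \<open>d P\<close> and \<open>e P\<close> are square roots of \<open>a\<close> and \<open>c\<close> modulo \<open>P\<close>.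
\<close>

definition sqrt_choice ::
  "'k::comm_ring_1 set \<Rightarrow> 'k \<Rightarrow> 'k \<Rightarrow> 'k \<Rightarrow> ('k set \<Rightarrow> 'k) \<Rightarrow> ('k set \<Rightarrow> 'k) \<Rightarrow> bool" where
  "sqrt_choice B a b c d e \<longleftrightarrow> (\<forall>P\<in>Gamma B a b c.
     d P \<in> B \<and> e P \<in> B \<and> (d P)\<^sup>2 - a \<in> P \<and> (e P)\<^sup>2 - c \<in> P)"

definition F_poly :: "'k::comm_ring_1 \<Rightarrow> 'k \<Rightarrow> 'k \<Rightarrow> 'k \<Rightarrow> 'k \<Rightarrow> 'k set \<Rightarrow> 'k poly poly" where
  "F_poly a b c d e P =
     (if a \<notin> P then
        const2 (a * e\<^sup>2 - b * d * e + c * d\<^sup>2) * varY ^ 2 + const2 (2 * a * e - b * d) * varY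
          + const2 (a - d\<^sup>2)
      else const2 (a * e\<^sup>2) * varX ^ 2 - const2 (b * e) * varX + const2 (c - e\<^sup>2))"

text \<open>
  The multiples \<open>t F\<close> with \<open>t \<in> P\<^sup>-\<^sup>1\<close> are formed over the ambient field; they lie in \<open>B[X,Y]\<close>
  since the coefficients of \<open>F\<close> lie in \<open>P\<close>.
\<close>

definition P_ideal ::
  "'k::field set \<Rightarrow> 'k \<Rightarrow> 'k \<Rightarrow> 'k \<Rightarrow> 'k \<Rightarrow> 'k \<Rightarrow> 'k set \<Rightarrow> 'k poly poly set set" where
  "P_ideal B a b c d e P = Idl\<^bsub>conic_ring B a b c\<^esub>
     (to_conic_ring B a b c ` const2 ` P \<union>
      to_conic_ring B a b c ` {const2 t * F_poly a b c d e P |t. t \<in> inverse_ideal B P})"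

definition H_ideal ::
  "'k::field set \<Rightarrow> 'k \<Rightarrow> 'k \<Rightarrow> 'k \<Rightarrow> ('k set \<Rightarrow> 'k) \<Rightarrow> ('k set \<Rightarrow> 'k) \<Rightarrow> 'k poly poly set set" where
  "H_ideal B a b c d e =
     finprod (ideals_set (conic_ring B a b c)) (\<lambda>P. P_ideal B a b c (d P) (e P) P) (Gamma B a b c)"

end

(*
  A prime M of B[X,Y] over p = M \<inter> B is locally generated by a uniformizer of p (if p is nonzero) together
  with one polynomial for each of the two steps of the tower B \<subseteq> B[X] \<subseteq> B[X,Y] at which M is not extended
  from below, and these generators are independent modulo M^2 in the localization. For M containing
  f = aX^2 + bXY + cY^2 - 1, the local ring of A at M/f has dimension one less than their number: chains of primes
  containing f are bounded and constructed by following the tower. Hence A is singular at M/f if and only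
  if f lies in M^2 locally.

  If it does, both partial derivatives of f lie in M, and Euler's relation gives 2, b \<in> M, so that p = P is
  in Gamma. Modulo P, f is the square of a linear form L, and f - L^2 lies in M^2 locally if and only if
  P^-1 (f - L^2) \<subseteq> M. Eliminating one variable by means of L turns f - L^2 into F_P, up to a factor outside P
  and up to elements of P.
*)
theory Submission
  imports Defs "Jordan_Normal_Form.Char_Poly"
begin

section \<open>Algebraic integers\<close>

text \<open>Everything hinges on \<open>ht2\<close> growing along a chain of primes. When the
  contraction grows as well, this is proved by descent: if the larger prime is extended from a prime
  that is locally generated by one element g, the members of a smaller prime contracting to 0 can be
  divided by g forever, so that prime is 0. The descent has nothing to work with at the extension of
  a height-two prime of B[X], the primes called \<open>bad\<close>. Exchanging X and Y puts such a
  prime over P[Y], the extension of a locally principal prime, and the descent then excludes it from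
  the top of a chain of three primes through f. The local square is detected by a uniformizer p: it
  stays a member of the local basis of M through both steps of the tower, so a multiple p h lies in
  M^2 locally only if h lies in M. As P^-1 is locally generated by 1/p, membership of f - L^2 in M^2
  becomes a condition on P^-1 (f - L^2). Arithmetic happens in subsets of polynomial types, with
  denominators outside a prime in place of fractions. The records of the statement are reached at
  the end, through a list of properties of the map from B[X,Y] to the local ring of A.\<close>

inductive_set zspan :: "'k::comm_ring_1 set \<Rightarrow> 'k set" for V where
  zspan_0: "0 \<in> zspan V"
| zspan_base: "v \<in> V \<Longrightarrow> v \<in> zspan V"
| zspan_add: "x \<in> zspan V \<Longrightarrow> y \<in> zspan V \<Longrightarrow> x + y \<in> zspan V"
| zspan_minus: "x \<in> zspan V \<Longrightarrow> - x \<in> zspan V"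

lemma zspan_sum: "(\<And>i. i \<in> I \<Longrightarrow> g i \<in> zspan V) \<Longrightarrow> sum g I \<in> zspan V"
  by (induction I rule: infinite_finite_induct) (auto intro: zspan.intros)

lemma zspan_of_nat: "x \<in> zspan V \<Longrightarrow> of_nat n * x \<in> zspan V"
  by (induction n) (auto intro: zspan.intros simp: ring_distribs)

lemma zspan_of_int: "x \<in> zspan V \<Longrightarrow> of_int n * x \<in> zspan V"
  by (cases n) (auto intro: zspan_minus zspan_of_nat simp del: of_nat_Suc)

lemma zspan_mult:
  assumes "x \<in> zspan V" "y \<in> zspan W"
  shows "x * y \<in> zspan ((\<lambda>(v, w). v * w) ` (V \<times> W))"
  using assms(1)
proof induction
  case (zspan_base v)
  show ?case using assms(2)
    by induction (use zspan_base in \<open>auto intro: zspan.intros simp: ring_distribs\<close>)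
qed (auto intro: zspan.intros simp: ring_distribs)

lemma zspan_explicit:
  assumes "finite V" "x \<in> zspan V"
  shows "\<exists>c. x = (\<Sum>v\<in>V. of_int (c v) * v)"
  using assms(2)
proof induction
  case zspan_0
  show ?case by (intro exI[of _ "\<lambda>_. 0"]) auto
next
  case (zspan_base v)
  have "v = (\<Sum>w\<in>V. if w = v then w else 0)"
    using zspan_base assms(1) by simp
  also have "\<dots> = (\<Sum>w\<in>V. of_int (if w = v then 1 else 0) * w)"
    by (intro sum.cong) auto
  finally show ?case by (intro exI[of _ "\<lambda>w. if w = v then 1 else 0"])
next
  case (zspan_add x y)
  then obtain c c' where "x = (\<Sum>v\<in>V. of_int (c v) * v)" "y = (\<Sum>v\<in>V. of_int (c' v) * v)"
    by blast
  then have "x + y = (\<Sum>v\<in>V. of_int (c v + c' v) * v)"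
    by (simp add: ring_distribs sum.distrib)
  then show ?case by (intro exI[of _ "\<lambda>v. c v + c' v"])
next
  case (zspan_minus x)
  then obtain c where "x = (\<Sum>v\<in>V. of_int (c v) * v)" by blast
  then have "- x = (\<Sum>v\<in>V. of_int (- c v) * v)"
    by (simp add: sum_negf)
  then show ?case by (intro exI[of _ "\<lambda>v. - c v"])
qed

text \<open>The stabilizers of one module form a ring. Integrality of sums and products therefore
  reduces to finding a finitely generated nonzero module that both elements stabilize.\<close>

definition zstable :: "'k::comm_ring_1 set \<Rightarrow> 'k \<Rightarrow> bool" where
  "zstable V x \<longleftrightarrow> (\<forall>v\<in>V. x * v \<in> zspan V)"

lemma zstable_mult_mem: 
  assumes "zstable V x" "y \<in> zspan V"
  shows "x * y \<in> zspan V"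
  using assms(2)
  by induction (use assms(1) in \<open>auto intro: zspan.intros simp: ring_distribs zstable_def\<close>)

lemma zstable_add: "zstable V x \<Longrightarrow> zstable V y \<Longrightarrow> zstable V (x + y)"
  by (auto simp: zstable_def ring_distribs intro: zspan_add)

lemma zstable_mult: "zstable V x \<Longrightarrow> zstable V y \<Longrightarrow> zstable V (x * y)"
  using zstable_mult_mem[of V x] by (auto simp: zstable_def mult.assoc)

text \<open>The Cayley--Hamilton argument: \<open>x\<close> is an eigenvalue of an integer matrix.\<close>

lemma algebraic_int_zstable:
  fixes x :: "'k::field_char_0"
  assumes "finite V" "zstable V x" "v0 \<in> V" "v0 \<noteq> 0"
  shows "algebraic_int x"
proof -
  obtain vs where vs: "set vs = V" "distinct vs"
    using finite_distinct_list[OF assms(1)] by blast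
  define n where "n = length vs"
  have "\<forall>v\<in>V. \<exists>c. x * v = (\<Sum>w\<in>V. of_int (c w) * w)"
    using zspan_explicit[OF assms(1)] assms(2) by (auto simp: zstable_def)
  then obtain c where c: "\<And>v. v \<in> V \<Longrightarrow> x * v = (\<Sum>w\<in>V. of_int (c v w) * w)"
    by metis
  define A0 :: "int mat" where "A0 = mat n n (\<lambda>(i, j). c (vs ! i) (vs ! j))"
  define A :: "'k mat" where "A = map_mat of_int A0"
  have A0: "A0 \<in> carrier_mat n n" by (simp add: A0_def)
  then have A: "A \<in> carrier_mat n n" by (simp add: A_def)
  define u where "u = vec n (\<lambda>i. vs ! i)"
  have "A *\<^sub>v u = x \<cdot>\<^sub>v u"
  proof (rule eq_vecI)
    fix i assume "i < dim_vec (x \<cdot>\<^sub>v u)"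
    then have i: "i < n" by (simp add: u_def)
    have "(A *\<^sub>v u) $ i = (\<Sum>j<n. of_int (c (vs ! i) (vs ! j)) * vs ! j)"
      using i A by (simp add: A_def A0_def u_def scalar_prod_def lessThan_atLeast0)
    also have "\<dots> = (\<Sum>w\<in>V. of_int (c (vs ! i) w) * w)"
      using sum.reindex_bij_betw[OF bij_betw_nth[OF vs(2), of "{..<n}" V]] vs(1)
      by (simp add: n_def)
    also have "\<dots> = x * vs ! i"
      using c[of "vs ! i"] i vs(1) by (auto simp: n_def)
    finally show "(A *\<^sub>v u) $ i = (x \<cdot>\<^sub>v u) $ i"
      using i by (simp add: u_def)
  qed (use A in \<open>simp add: u_def\<close>)
  moreover have "u \<noteq> 0\<^sub>v n"
  proof
    assume u0: "u = 0\<^sub>v n"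
    obtain i where "i < n" "vs ! i = v0"
      using assms(3) vs(1) by (metis in_set_conv_nth n_def)
    moreover have "u $ i = 0" using u0 \<open>i < n\<close> by simp
    ultimately show False using assms(4) by (simp add: u_def)
  qed
  ultimately have "eigenvalue A x"
    using A unfolding eigenvalue_def eigenvector_def by (intro exI[of _ u]) (simp add: u_def)
  then have "poly (char_poly A) x = 0"
    using eigenvalue_root_char_poly[OF A] by simp
  then have "poly (map_poly of_int (char_poly A0)) x = 0"
    by (simp only: A_def of_int_hom.char_poly_hom[OF A0])
  then show ?thesis
    using degree_monic_char_poly[OF A0] by (auto simp: algebraic_int_altdef_ipoly)
qed

text \<open>The module spanned by 1, x, ..., x^(n-1) is stable, because a monic relation of degree n
  rewrites x^n in lower powers.\<close>

lemma algebraic_int_zstable_powers: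
  fixes x :: "'k::field_char_0"
  assumes "algebraic_int x"
  shows "\<exists>W. finite W \<and> 1 \<in> W \<and> zstable W x"
proof -
  obtain p :: "int poly" where p: "poly (map_poly of_int p) x = 0" "lead_coeff p = 1"
    using assms by (auto simp: algebraic_int_altdef_ipoly)
  define n where "n = degree p"
  define W where "W = (\<lambda>i. x ^ i) ` {..<n}"
  \<comment> \<open>Degree 0 would make the monic p equal to 1, which has no root. Positivity is
    what puts 1 = x^0 into W.\<close>
  have "n > 0"
  proof (rule ccontr)
    assume "\<not> n > 0"
    then have "p = 1" using p(2) by (metis degree_eq_zeroE lead_coeff_pCons(2) n_def neq0_conv one_pCons)
    then show False using p(1) by simp
  qed
  have "0 = (\<Sum>i\<le>n. of_int (Polynomial.coeff p i) * x ^ i)"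
    using p(1) by (simp add: poly_altdef n_def)
  also have "\<dots> = x ^ n + (\<Sum>i<n. of_int (Polynomial.coeff p i) * x ^ i)"
    using p(2) by (simp add: lessThan_Suc_atMost[symmetric] n_def)
  finally have "x ^ n = - (\<Sum>i<n. of_int (Polynomial.coeff p i) * x ^ i)"
    by (simp add: eq_neg_iff_add_eq_0)
  also have "\<dots> \<in> zspan W"
    by (intro zspan_minus zspan_sum zspan_of_int zspan_base) (auto simp: W_def)
  finally have "x ^ n \<in> zspan W" .
  moreover have "x * x ^ i \<in> zspan W" if "Suc i < n" for i
    using that by (intro zspan_base) (auto simp: W_def intro!: image_eqI[of _ _ "Suc i"])
  ultimately have "x * x ^ i \<in> zspan W" if "i < n" for i
    using that by (cases "Suc i = n") (auto simp: W_def)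
  then have "zstable W x" by (auto simp: zstable_def W_def)
  moreover have "1 \<in> W" using \<open>n > 0\<close> by (auto simp: W_def intro!: image_eqI[of _ _ 0])
  ultimately show ?thesis by (intro exI[of _ W]) (auto simp: W_def)
qed

text \<open>Induction over S: the products of generators of a module stable under S and of one
  stable under c span a module stable under all of \<open>insert c S\<close>. Keeping 1 in every
  module makes it nonzero.\<close>

lemma zstable_algebraic_ints:
  fixes S :: "'k::field_char_0 set"
  assumes "finite S" "\<forall>b\<in>S. algebraic_int b"
  shows "\<exists>V. finite V \<and> 1 \<in> V \<and> (\<forall>b\<in>S. zstable V b)"
  using assms
proof (induction S)
  case empty
  show ?case by (intro exI[of _ "{1}"]) auto
next
  case (insert c S)
  then obtain V where V: "finite V" "1 \<in> V" "\<forall>b\<in>S. zstable V b" by auto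
  obtain W where W: "finite W" "1 \<in> W" "zstable W c"
    using algebraic_int_zstable_powers[of c] insert by auto
  define U where "U = (\<lambda>(v, w). v * w) ` (V \<times> W)"
  have "b * (v * w) \<in> zspan U" if "b \<in> S" "v \<in> V" "w \<in> W" for b v w
    using zspan_mult[of "b * v" V w W] that V(3) zspan_base[of w W]
    by (auto simp: zstable_def U_def mult.assoc)
  moreover have "c * (v * w) \<in> zspan U" if "v \<in> V" "w \<in> W" for v w
    using zspan_mult[of v V "c * w" W] that W(3) zspan_base[of v V]
    by (auto simp: zstable_def U_def algebra_simps)
  ultimately have "\<forall>b\<in>insert c S. zstable U b"
    by (auto simp: zstable_def U_def)
  moreover have "1 \<in> U" using V(2) W(2) by (auto simp: U_def intro!: image_eqI[of _ _ "(1, 1)"])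
  ultimately show ?case using V(1) W(1) by (intro exI[of _ U]) (auto simp: U_def)
qed

lemma algebraic_int_add:
  fixes x y :: "'k::field_char_0"
  assumes "algebraic_int x" "algebraic_int y"
  shows "algebraic_int (x + y)"
  using zstable_algebraic_ints[of "{x, y}"] assms algebraic_int_zstable zstable_add
  by (metis finite.emptyI finite.insertI insert_iff singletonD zero_neq_one)

lemma algebraic_int_mult:
  fixes x y :: "'k::field_char_0"
  assumes "algebraic_int x" "algebraic_int y"
  shows "algebraic_int (x * y)"
  using zstable_algebraic_ints[of "{x, y}"] assms algebraic_int_zstable zstable_mult
  by (metis finite.emptyI finite.insertI insert_iff singletonD zero_neq_one)

text \<open>Transitivity of integrality: the finitely many coefficients act on a common module V
  over the integers, and the products of V and W then span a module over the integers that x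
  stabilizes.\<close>

lemma algebraic_int_module:
  fixes x :: "'k::field_char_0"
  assumes "finite W" "w0 \<in> W" "w0 \<noteq> 0"
    and "\<And>w. w \<in> W \<Longrightarrow> \<exists>b. (\<forall>w'\<in>W. algebraic_int (b w')) \<and> x * w = (\<Sum>w'\<in>W. b w' * w')"
  shows "algebraic_int x"
proof -
  obtain b where b: "\<And>w w'. w \<in> W \<Longrightarrow> w' \<in> W \<Longrightarrow> algebraic_int (b w w')"
    "\<And>w. w \<in> W \<Longrightarrow> x * w = (\<Sum>w'\<in>W. b w w' * w')"
    using assms(4) by metis
  obtain V where V: "finite V" "1 \<in> V" "\<And>w w'. w \<in> W \<Longrightarrow> w' \<in> W \<Longrightarrow> zstable V (b w w')"
    using zstable_algebraic_ints[of "(\<lambda>(w, w'). b w w') ` (W \<times> W)"] assms(1) b(1) by force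
  define U where "U = (\<lambda>(v, w). v * w) ` (V \<times> W)"
  have "x * (v * w) \<in> zspan U" if "v \<in> V" "w \<in> W" for v w
  proof -
    have "x * (v * w) = v * (x * w)" by (simp add: algebra_simps)
    also have "\<dots> = (\<Sum>w'\<in>W. (b w w' * v) * w')"
      using b(2)[OF that(2)] by (simp add: sum_distrib_left algebra_simps)
    also have "\<dots> \<in> zspan U"
      unfolding U_def using V(3)[OF that(2)] that(1)
      by (intro zspan_sum zspan_mult) (auto simp: zstable_def intro: zspan_base)
    finally show ?thesis .
  qed
  then have "zstable U x" by (auto simp: zstable_def U_def)
  moreover have "w0 \<in> U" using V(2) assms(2) by (auto simp: U_def intro!: image_eqI[of _ _ "(1, w0)"])
  ultimately show ?thesis
    using algebraic_int_zstable[of U x w0] V(1) assms(1,3) by (simp add: U_def)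
qed

section \<open>Subrings of a commutative ring\<close>

text \<open>Rings and ideals are sets inside an ambient commutative ring type, so that polynomial
  arithmetic is that of the type \<open>poly\<close> and the passage from C to C[X] yields a set of
  the same kind.\<close>

definition subring_on :: "'c::comm_ring_1 set \<Rightarrow> bool" where
  "subring_on C \<longleftrightarrow> 0 \<in> C \<and> 1 \<in> C \<and> (\<forall>x\<in>C. \<forall>y\<in>C. x + y \<in> C) \<and> (\<forall>x\<in>C. - x \<in> C) \<and>
     (\<forall>x\<in>C. \<forall>y\<in>C. x * y \<in> C)"

definition ideal_on :: "'c::comm_ring_1 set \<Rightarrow> 'c set \<Rightarrow> bool" where
  "ideal_on C I \<longleftrightarrow> I \<subseteq> C \<and> 0 \<in> I \<and> (\<forall>x\<in>I. \<forall>y\<in>I. x + y \<in> I) \<and> (\<forall>r\<in>C. \<forall>x\<in>I. r * x \<in> I)"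

definition prime_on :: "'c::comm_ring_1 set \<Rightarrow> 'c set \<Rightarrow> bool" where
  "prime_on C Q \<longleftrightarrow> ideal_on C Q \<and> 1 \<notin> Q \<and> (\<forall>x\<in>C. \<forall>y\<in>C. x * y \<in> Q \<longrightarrow> x \<in> Q \<or> y \<in> Q)"

definition gen :: "'c::comm_ring_1 set \<Rightarrow> 'c set \<Rightarrow> 'c set" where
  "gen C T = \<Inter>{I. ideal_on C I \<and> T \<subseteq> I}"

definition noeth :: "'c::comm_ring_1 set \<Rightarrow> bool" where
  "noeth C \<longleftrightarrow> (\<forall>I. ideal_on C I \<longrightarrow> (\<exists>T. finite T \<and> T \<subseteq> I \<and> I = gen C T))"

lemma subring_onD:
  assumes "subring_on C"
  shows "0 \<in> C" "1 \<in> C" "x \<in> C \<Longrightarrow> y \<in> C \<Longrightarrow> x + y \<in> C" "x \<in> C \<Longrightarrow> - x \<in> C"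
    "x \<in> C \<Longrightarrow> y \<in> C \<Longrightarrow> x * y \<in> C" "x \<in> C \<Longrightarrow> y \<in> C \<Longrightarrow> x - y \<in> C"
    "x \<in> C \<Longrightarrow> x ^ n \<in> C"
proof -
  show *: "0 \<in> C" "1 \<in> C" "x \<in> C \<Longrightarrow> y \<in> C \<Longrightarrow> x + y \<in> C" "x \<in> C \<Longrightarrow> - x \<in> C"
    "x \<in> C \<Longrightarrow> y \<in> C \<Longrightarrow> x * y \<in> C" for x y
    using assms unfolding subring_on_def by auto
  show "x \<in> C \<Longrightarrow> y \<in> C \<Longrightarrow> x - y \<in> C"
    using *(3)[of x "- y"] *(4)[of y] by simp
  show "x \<in> C \<Longrightarrow> x ^ n \<in> C"
    by (induction n) (auto intro: *)
qed

lemma subring_on_sum: "subring_on C \<Longrightarrow> (\<And>i. i \<in> I \<Longrightarrow> g i \<in> C) \<Longrightarrow> sum g I \<in> C"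
  by (induction I rule: infinite_finite_induct) (auto intro: subring_onD)

lemma subring_on_of_nat: "subring_on C \<Longrightarrow> of_nat n \<in> C"
  by (induction n) (auto intro: subring_onD)

lemma subring_on_of_int: "subring_on C \<Longrightarrow> of_int n \<in> C"
  by (cases n) (auto intro: subring_onD subring_on_of_nat simp del: of_nat_Suc)

lemma subring_on_numeral: "subring_on C \<Longrightarrow> numeral n \<in> C"
  using subring_on_of_nat[of C "numeral n"] by simp

lemma ideal_onD:
  assumes "ideal_on C I"
  shows "I \<subseteq> C" "0 \<in> I" "x \<in> I \<Longrightarrow> y \<in> I \<Longrightarrow> x + y \<in> I" "r \<in> C \<Longrightarrow> x \<in> I \<Longrightarrow> r * x \<in> I"
    "r \<in> C \<Longrightarrow> x \<in> I \<Longrightarrow> x * r \<in> I"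
  using assms unfolding ideal_on_def by (auto simp: mult.commute)

lemma ideal_on_minus:
  assumes "subring_on C" "ideal_on C I" "x \<in> I"
  shows "- x \<in> I"
  using ideal_onD(4)[OF assms(2), of "- 1" x] subring_onD[OF assms(1)] assms(3) by auto

lemma ideal_on_diff:
  assumes "subring_on C" "ideal_on C I" "x \<in> I" "y \<in> I"
  shows "x - y \<in> I"
  using ideal_onD(3)[OF assms(2,3) ideal_on_minus[OF assms(1,2,4)]] by simp

lemma ideal_on_minus_iff:
  "subring_on C \<Longrightarrow> ideal_on C I \<Longrightarrow> - x \<in> I \<longleftrightarrow> x \<in> I"
  using ideal_on_minus[of C I x] ideal_on_minus[of C I "- x"] by auto

lemma ideal_on_add_iff:
  assumes "subring_on C" "ideal_on C I" "x \<in> I"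
  shows "x + y \<in> I \<longleftrightarrow> y \<in> I" "y + x \<in> I \<longleftrightarrow> y \<in> I" "y - x \<in> I \<longleftrightarrow> y \<in> I" "x - y \<in> I \<longleftrightarrow> y \<in> I"
proof -
  show 1: "x + y \<in> I \<longleftrightarrow> y \<in> I" for y
    using ideal_onD(3)[OF assms(2,3), of y] ideal_on_diff[OF assms(1,2) _ assms(3), of "x + y"] by auto
  show "y + x \<in> I \<longleftrightarrow> y \<in> I" using 1[of y] by (simp add: add.commute)
  show "x - y \<in> I \<longleftrightarrow> y \<in> I" using 1[of "- y"] ideal_on_minus_iff[OF assms(1,2)] by simp
  then show "y - x \<in> I \<longleftrightarrow> y \<in> I" using ideal_on_minus_iff[OF assms(1,2), of "x - y"] by simp
qed

lemma ideal_on_sum: "ideal_on C I \<Longrightarrow> (\<And>i. i \<in> S \<Longrightarrow> g i \<in> I) \<Longrightarrow> sum g S \<in> I"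
  by (induction S rule: infinite_finite_induct) (auto intro: ideal_onD)

lemma prime_onD:
  assumes "prime_on C Q"
  shows "ideal_on C Q" "1 \<notin> Q" "Q \<subseteq> C" "0 \<in> Q" "x \<in> Q \<Longrightarrow> y \<in> Q \<Longrightarrow> x + y \<in> Q"
    "r \<in> C \<Longrightarrow> x \<in> Q \<Longrightarrow> r * x \<in> Q" "r \<in> C \<Longrightarrow> x \<in> Q \<Longrightarrow> x * r \<in> Q"
    "x * y \<in> Q \<Longrightarrow> x \<in> C \<Longrightarrow> y \<in> C \<Longrightarrow> x \<in> Q \<or> y \<in> Q"
  using assms ideal_onD[of C Q] unfolding prime_on_def by auto

lemma prime_on_mult_iff:
  "prime_on C Q \<Longrightarrow> x \<in> C \<Longrightarrow> y \<in> C \<Longrightarrow> x * y \<in> Q \<longleftrightarrow> x \<in> Q \<or> y \<in> Q"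
  using prime_onD(8)[of C Q x y] prime_onD(6)[of C Q x y] prime_onD(7)[of C Q y x] by blast

lemma prime_on_power:
  assumes "subring_on C" "prime_on C Q" "x \<in> C" "x \<notin> Q"
  shows "x ^ n \<notin> Q"
  using assms by (induction n) (auto simp: prime_on_mult_iff prime_onD subring_onD)

lemma prime_on_power_iff:
  assumes "subring_on C" "prime_on C Q" "x \<in> C" "n > 0"
  shows "x ^ n \<in> Q \<longleftrightarrow> x \<in> Q"
proof
  assume "x \<in> Q"
  moreover obtain m where "n = Suc m" using assms(4) gr0_conv_Suc by blast
  ultimately show "x ^ n \<in> Q"
    using prime_onD(7)[OF assms(2), of "x ^ m" x] subring_onD(7)[OF assms(1,3)] by simp
qed (use prime_on_power[OF assms(1-3)] in blast)

lemma gen_ideal: "subring_on C \<Longrightarrow> T \<subseteq> C \<Longrightarrow> ideal_on C (gen C T)"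
proof -
  assume C: "subring_on C" "T \<subseteq> C"
  have "ideal_on C C" using C(1) unfolding ideal_on_def subring_on_def by auto
  then have "gen C T \<subseteq> C" using C(2) by (auto simp: gen_def)
  then show ?thesis unfolding ideal_on_def gen_def by auto
qed

lemma gen_superset: "T \<subseteq> gen C T"
  by (auto simp: gen_def)

lemma gen_minimal: "ideal_on C I \<Longrightarrow> T \<subseteq> I \<Longrightarrow> gen C T \<subseteq> I"
  by (auto simp: gen_def)

lemma gen_finite:
  assumes C: "subring_on C" and "finite T" "T \<subseteq> C"
  shows "gen C T = {x. \<exists>r. (\<forall>t\<in>T. r t \<in> C) \<and> x = (\<Sum>t\<in>T. r t * t)}" (is "_ = ?J")
proof
  have "ideal_on C ?J"
    unfolding ideal_on_def
  proof (intro conjI ballI)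
    show "?J \<subseteq> C" using assms by (auto intro!: subring_on_sum subring_onD)
    show "0 \<in> ?J" using C by (auto intro!: exI[of _ "\<lambda>_. 0"] subring_onD)
  next
    fix x y assume "x \<in> ?J" "y \<in> ?J"
    then obtain r s where rs: "\<forall>t\<in>T. r t \<in> C" "x = (\<Sum>t\<in>T. r t * t)"
      "\<forall>t\<in>T. s t \<in> C" "y = (\<Sum>t\<in>T. s t * t)" by auto
    then show "x + y \<in> ?J" using C
      by (auto intro!: exI[of _ "\<lambda>t. r t + s t"] subring_onD simp: sum.distrib ring_distribs)
  next
    fix c x assume "c \<in> C" "x \<in> ?J"
    then obtain r where "\<forall>t\<in>T. r t \<in> C" "x = (\<Sum>t\<in>T. r t * t)" by auto
    then show "c * x \<in> ?J" using C \<open>c \<in> C\<close>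
      by (auto intro!: exI[of _ "\<lambda>t. c * r t"] subring_onD simp: sum_distrib_left mult.assoc)
  qed
  moreover have "T \<subseteq> ?J"
  proof
    fix v assume v: "v \<in> T"
    have "(\<Sum>t\<in>T. (if t = v then 1 else 0) * t) = (\<Sum>t\<in>T. if t = v then v else 0)"
      by (intro sum.cong) auto
    then have "v = (\<Sum>t\<in>T. (if t = v then 1 else 0) * t)"
      using v assms(2) by simp
    then show "v \<in> ?J" using C
      by (auto intro!: exI[of _ "\<lambda>t. if t = v then 1 else 0"] subring_onD)
  qed
  ultimately show "gen C T \<subseteq> ?J" by (rule gen_minimal)
  show "?J \<subseteq> gen C T"
  proof
    fix x assume "x \<in> ?J"
    then obtain r where r: "\<forall>t\<in>T. r t \<in> C" "x = (\<Sum>t\<in>T. r t * t)" by auto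
    have "(\<Sum>t\<in>T. r t * t) \<in> gen C T"
      using r(1) gen_superset[of T C]
      by (intro ideal_on_sum[OF gen_ideal[OF C assms(3)]] ideal_onD(4)[OF gen_ideal[OF C assms(3)]]) auto
    then show "x \<in> gen C T" using r(2) by simp
  qed
qed

lemma gen_singleton: 
  assumes "subring_on C" "t \<in> C"
  shows "gen C {t} = {r * t |r. r \<in> C}"
proof -
  have "\<exists>r'. r' t \<in> C \<and> r * t = r' t * t" if "r \<in> C" for r
    using that by (intro exI[of _ "\<lambda>_. r"]) auto
  then show ?thesis using assms by (subst gen_finite) auto
qed

lemma gen_Un:
  assumes C: "subring_on C" and "S \<subseteq> C" "T \<subseteq> C"
  shows "gen C (S \<union> T) = {x + y |x y. x \<in> gen C S \<and> y \<in> gen C T}" (is "_ = ?J")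
proof
  have S: "ideal_on C (gen C S)" and T: "ideal_on C (gen C T)"
    using gen_ideal C assms by auto
  have "ideal_on C ?J"
    unfolding ideal_on_def
  proof (intro conjI ballI)
    show "?J \<subseteq> C" using S T C ideal_onD(1) by (auto intro!: subring_onD)
    show "0 \<in> ?J" using S T by (force dest: ideal_onD(2))
  next
    fix x y assume "x \<in> ?J" "y \<in> ?J"
    then obtain a b c d where "x = a + b" "y = c + d" "a \<in> gen C S" "b \<in> gen C T" "c \<in> gen C S" "d \<in> gen C T"
      by auto
    moreover from this have "x + y = (a + c) + (b + d)" by (simp add: algebra_simps)
    ultimately show "x + y \<in> ?J" using S T ideal_onD(3) by blast
  next
    fix c x assume "c \<in> C" "x \<in> ?J"
    then obtain a b where "x = a + b" "a \<in> gen C S" "b \<in> gen C T" by auto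
    moreover from this have "c * x = c * a + c * b" by (simp add: algebra_simps)
    ultimately show "c * x \<in> ?J" using S T \<open>c \<in> C\<close> ideal_onD(4) by blast
  qed
  moreover have "S \<union> T \<subseteq> ?J"
    using gen_superset[of S C] gen_superset[of T C] ideal_onD(2)[OF S] ideal_onD(2)[OF T]
    by force
  ultimately show "gen C (S \<union> T) \<subseteq> ?J" by (rule gen_minimal)
  have "gen C S \<subseteq> gen C (S \<union> T)" "gen C T \<subseteq> gen C (S \<union> T)"
    using gen_superset[of "S \<union> T" C] by (auto simp: gen_def)
  then show "?J \<subseteq> gen C (S \<union> T)"
    using ideal_onD(3)[OF gen_ideal[of C "S \<union> T"]] C assms by blast
qed

section \<open>Maximal members of families of ideals, and primes missing a multiplicative
  set\<close>

text \<open>The union of a chain of ideals is an ideal with finitely many generators, all of which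
  lie in one member of the chain. That member is the union, so Zorn's lemma applies within
  F.\<close>

lemma noeth_maximal:
  assumes C: "subring_on C" "noeth C" and F: "F \<noteq> {}" "\<And>I. I \<in> F \<Longrightarrow> ideal_on C I"
  shows "\<exists>M\<in>F. \<forall>Z1\<in>F. M \<subseteq> Z1 \<longrightarrow> Z1 = M"
proof (rule subset_Zorn_nonempty[OF F(1)])
  fix c assume c: "c \<noteq> {}" "subset.chain F c"
  then have cF: "c \<subseteq> F" and tot: "\<And>Z1 Y. Z1 \<in> c \<Longrightarrow> Y \<in> c \<Longrightarrow> Z1 \<subseteq> Y \<or> Y \<subseteq> Z1"
    by (auto simp: subset_chain_def)
  have cI: "ideal_on C Z" if "Z \<in> c" for Z using that cF F(2) by auto
  have "ideal_on C (\<Union>c)"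
    unfolding ideal_on_def
  proof (intro conjI ballI)
    show "\<Union>c \<subseteq> C" using ideal_onD(1)[OF cI] by (rule Union_least)
    obtain Z where "Z \<in> c" using c(1) by blast
    then show "0 \<in> \<Union>c" using ideal_onD(2)[OF cI] by (intro UnionI)
  next
    fix x y assume "x \<in> \<Union>c" "y \<in> \<Union>c"
    then obtain Z1 Z2 where Z: "Z1 \<in> c" "Z2 \<in> c" "x \<in> Z1" "y \<in> Z2" by (elim UnionE)
    have "\<exists>Z\<in>c. x \<in> Z \<and> y \<in> Z"
      using tot[OF Z(1,2)] Z by (metis subsetD)
    then show "x + y \<in> \<Union>c" using cI ideal_onD(3) by (metis UnionI)
  next
    fix r x assume r: "r \<in> C" and "x \<in> \<Union>c"
    then obtain Z where Z: "Z \<in> c" "x \<in> Z" by (elim UnionE)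
    then show "r * x \<in> \<Union>c" using ideal_onD(4)[OF cI r] by (intro UnionI)
  qed
  from C(2)[unfolded noeth_def, rule_format, OF this]
  obtain T where T: "finite T" "T \<subseteq> \<Union>c" "\<Union>c = gen C T"
    by (elim exE conjE)
  have "\<exists>Z1\<in>c. T \<subseteq> Z1"
    using T(1,2)
  proof (induction T)
    case empty
    show ?case using c(1) by auto
  next
    case (insert t T)
    then obtain Z1 Y where "Z1 \<in> c" "T \<subseteq> Z1" "Y \<in> c" "t \<in> Y" by auto
    then show ?case using tot[of Z1 Y] by (metis insert_subset subset_iff)
  qed
  then obtain Z1 where Z1: "Z1 \<in> c" "T \<subseteq> Z1" by (elim bexE)
  then have "\<Union>c \<subseteq> Z1" using gen_minimal[OF cI, of Z1 T] T(3) by simp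
  then have "\<Union>c = Z1" using Z1(1) by (intro equalityI Union_upper)
  then show "\<Union>c \<in> F" using Z1 cF by auto
qed

text \<open>Take Q maximal among the ideals over I that miss S. If x and y lie outside Q, both Q +
  (x) and Q + (y) meet S; the product of the two elements found lies in S, and it would lie in Q if
  x * y did.\<close>

lemma prime_avoiding:
  assumes C: "subring_on C" "noeth C" and I: "ideal_on C I"
    and S: "S \<subseteq> C" "1 \<in> S" "\<And>x y. x \<in> S \<Longrightarrow> y \<in> S \<Longrightarrow> x * y \<in> S" "I \<inter> S = {}"
  shows "\<exists>Q. prime_on C Q \<and> I \<subseteq> Q \<and> Q \<inter> S = {}"
proof -
  define F where "F = {J. ideal_on C J \<and> I \<subseteq> J \<and> J \<inter> S = {}}"
  have "I \<in> F" using I S(4) by (simp add: F_def)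
  then have "F \<noteq> {}" by blast
  from noeth_maximal[OF C this] obtain Q where Q: "Q \<in> F" "\<And>J. J \<in> F \<Longrightarrow> Q \<subseteq> J \<Longrightarrow> J = Q"
    unfolding F_def by auto
  have QC: "ideal_on C Q" "Q \<subseteq> C" "I \<subseteq> Q" "Q \<inter> S = {}" using Q(1) by (auto simp: F_def ideal_onD)
  have key: "\<exists>j\<in>Q. \<exists>r\<in>C. j + r * x \<in> S" if x: "x \<in> C" "x \<notin> Q" for x
  proof (rule ccontr)
    assume neg: "\<not> ?thesis"
    have g: "gen C (Q \<union> {x}) = {u + v |u v. u \<in> gen C Q \<and> v \<in> gen C {x}}"
      using C(1) QC(2) x by (intro gen_Un) auto
    have gQ: "gen C Q = Q" using gen_minimal[OF QC(1), of Q] gen_superset[of Q C] by auto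
    have "gen C (Q \<union> {x}) \<inter> S = {}"
      using neg unfolding g gQ gen_singleton[OF C(1) x(1)] by blast
    moreover have "ideal_on C (gen C (Q \<union> {x}))"
      using C(1) QC(2) x by (intro gen_ideal) auto
    moreover have sup: "Q \<union> {x} \<subseteq> gen C (Q \<union> {x})" by (rule gen_superset)
    ultimately have "gen C (Q \<union> {x}) \<in> F" using QC(3) unfolding F_def by blast
    then have "gen C (Q \<union> {x}) = Q" using Q(2) sup by blast
    then show False using sup x by auto
  qed
  have "x \<in> Q \<or> y \<in> Q" if xy: "x \<in> C" "y \<in> C" "x * y \<in> Q" for x y
  proof (rule ccontr)
    assume "\<not> ?thesis"
    then obtain j r j' r' where *: "j \<in> Q" "r \<in> C" "j + r * x \<in> S" "j' \<in> Q" "r' \<in> C" "j' + r' * y \<in> S"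
      using key[OF xy(1)] key[OF xy(2)] by blast
    have "(j + r * x) * (j' + r' * y) = (j' + r' * y) * j + (r * x) * j' + (r * r') * (x * y)"
      by (simp add: algebra_simps)
    also have "\<dots> \<in> Q"
    proof -
      have "j' + r' * y \<in> C" "r * x \<in> C" "r * r' \<in> C"
        using *(6) S(1) * xy subring_onD(5)[OF C(1)] by blast+
      then show ?thesis
        using ideal_onD(3,4)[OF QC(1)] *(1,4) xy(3) by metis
    qed
    finally show False using S(3)[OF *(3,6)] QC(4) by blast
  qed
  then have "prime_on C Q" using QC S(2) by (auto simp: prime_on_def)
  then show ?thesis using QC by blast
qed

section \<open>Translation between subsets of a type and HOL-Algebra records\<close>

lemma ring_on_simps [simp]:
  "carrier (ring_on C) = C" "x \<otimes>\<^bsub>ring_on C\<^esub> y = x * y" "x \<oplus>\<^bsub>ring_on C\<^esub> y = x + y"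
  "\<one>\<^bsub>ring_on C\<^esub> = 1" "\<zero>\<^bsub>ring_on C\<^esub> = 0"
  "x \<otimes>\<^bsub>ring_of_type_algebra\<^esub> y = x * y" "x \<oplus>\<^bsub>ring_of_type_algebra\<^esub> y = x + y"
  "\<one>\<^bsub>ring_of_type_algebra\<^esub> = 1" "\<zero>\<^bsub>ring_of_type_algebra\<^esub> = 0"
  "carrier ring_of_type_algebra = UNIV"
  by (simp_all add: ring_of_type_algebra_def)

lemma cring_ring_on: 
  assumes "subring_on C" 
  shows "cring (ring_on C)"
proof (intro cringI abelian_groupI comm_monoidI)
  show "\<exists>y\<in>carrier (ring_on C). y \<oplus>\<^bsub>ring_on C\<^esub> x = \<zero>\<^bsub>ring_on C\<^esub>" if "x \<in> carrier (ring_on C)" for x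
    using that subring_onD[OF assms] by (intro bexI[of _ "- x"]) auto
qed (use subring_onD[OF assms] in \<open>auto simp: algebra_simps\<close>)

lemma ideal_ring_on:
  assumes C: "subring_on C"
  shows "ideal I (ring_on C) \<longleftrightarrow> ideal_on C I"
proof
  interpret cring "ring_on C" by (rule cring_ring_on[OF C])
  assume "ideal I (ring_on C)"
  then interpret I: ideal I "ring_on C" .
  show "ideal_on C I"
    using I.Icarr I.I_l_closed I.a_closed I.zero_closed
    by (auto simp: ideal_on_def)
next
  interpret cring "ring_on C" by (rule cring_ring_on[OF C])
  assume I: "ideal_on C I"
  show "ideal I (ring_on C)"
  proof (rule idealI)
    show "ring (ring_on C)" by (rule ring_axioms)
    show "subgroup I (add_monoid (ring_on C))"
    proof (rule add.subgroupI)
      fix x assume x: "x \<in> I"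
      then have "x \<in> C" using ideal_onD(1)[OF I] by auto
      then have "\<ominus>\<^bsub>ring_on C\<^esub> x = - x"
        using subring_onD[OF C] by (intro minus_equality) auto
      then show "\<ominus>\<^bsub>ring_on C\<^esub> x \<in> I" using ideal_on_minus[OF C I x] by simp
    qed (use ideal_onD[OF I] in auto)
  qed (use ideal_onD[OF I] in auto)
qed

lemma primeideal_ring_on:
  assumes C: "subring_on C"
  shows "primeideal I (ring_on C) \<longleftrightarrow> prime_on C I"
proof
  assume "primeideal I (ring_on C)"
  then interpret I: primeideal I "ring_on C" .
  have "ideal_on C I" using ideal_ring_on[OF C] I.ideal_axioms by simp
  moreover have "1 \<notin> I"
    using I.one_imp_carrier I.I_notcarr by auto
  ultimately show "prime_on C I"
    using I.I_prime by (auto simp: prime_on_def)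
next
  assume P: "prime_on C I"
  then have I: "ideal I (ring_on C)" using ideal_ring_on[OF C] by (auto simp: prime_on_def)
  then interpret I: ideal I "ring_on C" .
  have "C \<noteq> I" using prime_onD(2)[OF P] subring_onD(2)[OF C] by auto
  then show "primeideal I (ring_on C)"
    using P cring_ring_on[OF C] I by (intro primeidealI) (auto simp: prime_on_def)
qed

lemma genideal_ring_on:
  assumes "subring_on C"
  shows "Idl\<^bsub>ring_on C\<^esub> T = gen C T"
  by (simp add: genideal_def gen_def ideal_ring_on[OF assms])

section \<open>Polynomials with coefficients in a subring\<close>

text \<open>Applied to a subring this is the polynomial ring; applied to an ideal q it is the
  extended ideal q[X].\<close>

definition pol :: "'c::comm_ring_1 set \<Rightarrow> 'c poly set" where
  "pol C = {h. \<forall>i. Polynomial.coeff h i \<in> C}"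

lemma pol_iff: "h \<in> pol C \<longleftrightarrow> (\<forall>i. Polynomial.coeff h i \<in> C)"
  by (simp add: pol_def)

lemma pol_mono: "C \<subseteq> D \<Longrightarrow> pol C \<subseteq> pol D"
  by (auto simp: pol_def)

lemma const_mem_pol [simp]: "0 \<in> C \<Longrightarrow> [:x:] \<in> pol C \<longleftrightarrow> x \<in> C"
  by (auto simp: pol_def coeff_pCons split: nat.splits dest: spec[of _ 0])

lemma pCons_mem_pol: "pCons x h \<in> pol C \<longleftrightarrow> x \<in> C \<and> h \<in> pol C"
  by (auto simp: pol_def coeff_pCons split: nat.splits dest: spec[of _ 0] spec[of _ "Suc _"])

lemma subring_on_pol: 
  assumes "subring_on C"
  shows "subring_on (pol C)"
  unfolding subring_on_def
  using subring_onD[OF assms]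
  by (auto simp: pol_def coeff_mult Polynomial.coeff_1 intro!: subring_on_sum[OF assms])

lemma ideal_on_pol:
  assumes C: "subring_on C" and I: "ideal_on C I"
  shows "ideal_on (pol C) (pol I)"
  unfolding ideal_on_def
proof (intro conjI ballI)
  show "pol I \<subseteq> pol C" using ideal_onD(1)[OF I] by (rule pol_mono)
  show "0 \<in> pol I" using ideal_onD(2)[OF I] by (simp add: pol_def)
  show "x + y \<in> pol I" if "x \<in> pol I" "y \<in> pol I" for x y
    using that ideal_onD(3)[OF I] by (simp add: pol_def)
  show "r * x \<in> pol I" if "r \<in> pol C" "x \<in> pol I" for r x
    using that ideal_onD(4)[OF I] by (auto simp: pol_def coeff_mult intro!: ideal_on_sum[OF I])
qed

lemma smult_mem_pol: "ideal_on C I \<Longrightarrow> r \<in> C \<Longrightarrow> h \<in> pol I \<Longrightarrow> smult r h \<in> pol I"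
  by (simp add: pol_def ideal_onD)

lemma smult_mem_pol_subring: "subring_on C \<Longrightarrow> r \<in> C \<Longrightarrow> h \<in> pol C \<Longrightarrow> smult r h \<in> pol C"
  by (simp add: pol_def subring_onD)

lemma monom_mem_pol: "0 \<in> C \<Longrightarrow> c \<in> C \<Longrightarrow> Polynomial.monom c n \<in> pol C"
  by (simp add: pol_def)

lemma smult_mem_ideal:
  "subring_on C \<Longrightarrow> ideal_on (pol C) I \<Longrightarrow> r \<in> C \<Longrightarrow> h \<in> I \<Longrightarrow> smult r h \<in> I"
  using ideal_onD(4)[of "pol C" I "[:r:]" h] subring_onD(1)[of C] by simp

lemma self_ideal_on: "subring_on C \<Longrightarrow> ideal_on C C"
  by (auto simp: ideal_on_def intro: subring_onD)

subsection \<open>Hilbert's basis theorem\<close>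

text \<open>Members of degree at most m, not exactly m, are allowed: zero and sums with cancelling
  leading terms then do no harm, and multiplication by X makes the ideals increase with m.\<close>

definition lead_ideal :: "'c::comm_ring_1 poly set \<Rightarrow> nat \<Rightarrow> 'c set" where
  "lead_ideal I m = {c. \<exists>h\<in>I. (\<forall>i>m. Polynomial.coeff h i = 0) \<and> Polynomial.coeff h m = c}"

lemma lead_ideal_ideal:
  assumes C: "subring_on C" and I: "ideal_on (pol C) I"
  shows "ideal_on C (lead_ideal I m)"
  unfolding ideal_on_def
proof (intro conjI ballI)
  show "lead_ideal I m \<subseteq> C"
    using ideal_onD(1)[OF I] by (auto simp: lead_ideal_def pol_def)
  show "0 \<in> lead_ideal I m"
    using ideal_onD(2)[OF I] by (auto simp: lead_ideal_def intro!: bexI[of _ 0])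
  show "x + y \<in> lead_ideal I m" if xy: "x \<in> lead_ideal I m" "y \<in> lead_ideal I m" for x y
  proof -
    obtain h g where "h \<in> I" "\<forall>i>m. Polynomial.coeff h i = 0" "Polynomial.coeff h m = x"
      "g \<in> I" "\<forall>i>m. Polynomial.coeff g i = 0" "Polynomial.coeff g m = y"
      using xy unfolding lead_ideal_def by blast
    then show ?thesis
      using ideal_onD(3)[OF I, of h g] unfolding lead_ideal_def by (intro CollectI bexI[of _ "h + g"]) auto
  qed
  show "r * x \<in> lead_ideal I m" if rx: "r \<in> C" "x \<in> lead_ideal I m" for r x
  proof -
    obtain h where "h \<in> I" "\<forall>i>m. Polynomial.coeff h i = 0" "Polynomial.coeff h m = x"
      using rx unfolding lead_ideal_def by blast
    then show ?thesis
      using smult_mem_ideal[OF C I rx(1)] unfolding lead_ideal_def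
      by (intro CollectI bexI[of _ "smult r h"]) auto
  qed
qed

lemma lead_ideal_mono:
  assumes C: "subring_on C" and I: "ideal_on (pol C) I" and "m \<le> n"
  shows "lead_ideal I m \<subseteq> lead_ideal I n"
proof
  fix c assume "c \<in> lead_ideal I m"
  then obtain h where h: "h \<in> I" "\<forall>i>m. Polynomial.coeff h i = 0" "Polynomial.coeff h m = c"
    by (auto simp: lead_ideal_def)
  have "Polynomial.monom 1 (n - m) * h \<in> I"
    using h(1) C by (intro ideal_onD(4)[OF I] monom_mem_pol) (auto intro: subring_onD)
  moreover have "Polynomial.coeff (Polynomial.monom 1 (n - m) * h) i = 0" if "i > n" for i
    using that h(2) assms(3) by (simp add: coeff_monom_mult)
  moreover have "Polynomial.coeff (Polynomial.monom 1 (n - m) * h) n = c"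
    using h(3) assms(3) by (simp add: coeff_monom_mult)
  ultimately show "c \<in> lead_ideal I n" unfolding lead_ideal_def by blast
qed

text \<open>Induction on a bound for the degree: subtracting an element of G with the same top
  coefficient lowers the bound.\<close>

lemma ideal_eq_by_lead_ideals:
  assumes C: "subring_on C" and I: "ideal_on (pol C) I" and G: "ideal_on (pol C) G" "G \<subseteq> I"
    and lead: "\<And>m. lead_ideal I m \<subseteq> lead_ideal G m"
  shows "I \<subseteq> G"
proof -
  have C': "subring_on (pol C)" by (rule subring_on_pol[OF C])
  have "h \<in> G" if "h \<in> I" "\<forall>i\<ge>m. Polynomial.coeff h i = 0" for m h
    using that
  proof (induction m arbitrary: h)
    case 0
    then have "h = 0" by (simp add: poly_eq_iff)
    then show ?case using ideal_onD(2)[OF G(1)] by simp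
  next
    case (Suc m)
    have "Polynomial.coeff h m \<in> lead_ideal G m"
      using Suc.prems by (intro subsetD[OF lead]) (auto simp: lead_ideal_def Suc_le_eq)
    then obtain g where g: "g \<in> G" "\<forall>i>m. Polynomial.coeff g i = 0"
        "Polynomial.coeff g m = Polynomial.coeff h m"
      by (auto simp: lead_ideal_def)
    have "h - g \<in> I" using ideal_on_diff[OF C' I] Suc.prems(1) g(1) G(2) by blast
    moreover have "Polynomial.coeff (h - g) i = 0" if "i \<ge> m" for i
      using that g Suc.prems(2) by (cases "i = m") auto
    ultimately have "h - g \<in> G" using Suc.IH by blast
    then have "(h - g) + g \<in> G" using g(1) ideal_onD(3)[OF G(1)] by blast
    then show ?case by simp
  qed
  then show ?thesis using coeff_eq_0
    by (metis Suc_le_eq subsetI)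
qed

text \<open>Only the lead ideals up to the index N where they become stationary matter. Lifts of
  their finitely many generators generate an ideal G with the same lead ideals as I.\<close>

theorem hilbert_basis:
  assumes C: "subring_on C" "noeth C"
  shows "noeth (pol C)"
  unfolding noeth_def
proof (intro allI impI)
  fix I assume I: "ideal_on (pol C) I"
  have fg: "\<exists>T. finite T \<and> T \<subseteq> J \<and> J = gen C T" if "ideal_on C J" for J
    using C(2) that by (simp add: noeth_def)
  \<comment> \<open>The lead ideals increase with m, so a maximal one among them contains all
    others.\<close>
  obtain N where N: "\<And>m. lead_ideal I m \<subseteq> lead_ideal I N"
  proof -
    have ne: "range (lead_ideal I) \<noteq> {}" by simp
    have id: "\<And>J. J \<in> range (lead_ideal I) \<Longrightarrow> ideal_on C J"
      using lead_ideal_ideal[OF C(1) I] by blast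
    obtain L where L: "L \<in> range (lead_ideal I)" and max: "\<forall>J\<in>range (lead_ideal I). L \<subseteq> J \<longrightarrow> J = L"
      using noeth_maximal[OF C ne] id by (metis (no_types, lifting))
    then obtain N where "L = lead_ideal I N" by auto
    then have "lead_ideal I m \<subseteq> lead_ideal I N" for m
      using max[rule_format, OF rangeI[of _ "max m N"]] lead_ideal_mono[OF C(1) I, of N "max m N"]
        lead_ideal_mono[OF C(1) I, of m "max m N"] by auto
    then show ?thesis by (rule that)
  qed
  have "\<exists>T. finite T \<and> T \<subseteq> lead_ideal I m \<and> lead_ideal I m = gen C T" for m
    by (rule fg[OF lead_ideal_ideal[OF C(1) I]])
  then obtain T where T: "\<And>m. finite (T m)" "\<And>m. T m \<subseteq> lead_ideal I m"
      "\<And>m. lead_ideal I m = gen C (T m)"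
    by metis
  have "\<exists>h. \<forall>t\<in>T m. h t \<in> I \<and> (\<forall>i>m. Polynomial.coeff (h t) i = 0) \<and> Polynomial.coeff (h t) m = t" for m
    using T(2)[of m] by (intro bchoice) (auto simp: lead_ideal_def)
  then obtain h where h: "\<And>m t. t \<in> T m \<Longrightarrow> h m t \<in> I"
    "\<And>m t i. t \<in> T m \<Longrightarrow> i > m \<Longrightarrow> Polynomial.coeff (h m t) i = 0"
    "\<And>m t. t \<in> T m \<Longrightarrow> Polynomial.coeff (h m t) m = t"
    by metis
  define H where "H = (\<Union>m\<le>N. h m ` T m)"
  have H: "finite H" "H \<subseteq> I" using T(1) h(1) by (auto simp: H_def)
  define G where "G = gen (pol C) H"
  have G: "ideal_on (pol C) G" "G \<subseteq> I"
    unfolding G_def using gen_ideal[OF subring_on_pol[OF C(1)]] gen_minimal[OF I H(2)] H(2) ideal_onD(1)[OF I]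
    by (simp_all add: subset_trans)
  have small: "lead_ideal I m \<subseteq> lead_ideal G m" if "m \<le> N" for m
  proof -
    have "T m \<subseteq> lead_ideal G m"
    proof
      fix t assume t: "t \<in> T m"
      then have "h m t \<in> G"
        using that by (intro subsetD[OF gen_superset[of H "pol C", folded G_def]]) (auto simp: H_def)
      then show "t \<in> lead_ideal G m" using h(2,3)[OF t] unfolding lead_ideal_def by blast
    qed
    then show ?thesis using gen_minimal[OF lead_ideal_ideal[OF C(1) G(1)]] T(3) by simp
  qed
  have "lead_ideal I m \<subseteq> lead_ideal G m" for m
  proof (cases "m \<le> N")
    case False
    then have "lead_ideal I m \<subseteq> lead_ideal G N" using N[of m] small[of N] by auto
    also have "\<dots> \<subseteq> lead_ideal G m" using False by (intro lead_ideal_mono[OF C(1) G(1)]) simp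
    finally show ?thesis .
  qed (rule small)
  then have "I = G" using ideal_eq_by_lead_ideals[OF C(1) I G] G(2) by auto
  then show "\<exists>T. finite T \<and> T \<subseteq> I \<and> I = gen (pol C) T"
    using H unfolding G_def by blast
qed

subsection \<open>Prime ideals of a polynomial ring\<close>

definition contr :: "'c::comm_ring_1 poly set \<Rightarrow> 'c set" where
  "contr Q = {x. [:x:] \<in> Q}"

lemma contr_iff: "x \<in> contr Q \<longleftrightarrow> [:x:] \<in> Q"
  by (simp add: contr_def)

lemma contr_mono: "Q \<subseteq> Q' \<Longrightarrow> contr Q \<subseteq> contr Q'"
  by (auto simp: contr_def)

lemma contr_pol: "0 \<in> I \<Longrightarrow> contr (pol I) = I"
  by (auto simp: contr_def)

lemma contr_prime:
  assumes C: "subring_on C" and Q: "prime_on (pol C) Q"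
  shows "prime_on C (contr Q)"
proof -
  have 0: "0 \<in> C" using C by (rule subring_onD)
  note q = prime_onD[OF Q]
  have "contr Q \<subseteq> C"
    using q(3) 0 by (auto simp: contr_def)
  moreover have "r * x \<in> contr Q" if "r \<in> C" "x \<in> contr Q" for r x
    using q(6)[of "[:r:]" "[:x:]"] that 0 by (simp add: contr_def mult.commute)
  moreover have "x + y \<in> contr Q" if "x \<in> contr Q" "y \<in> contr Q" for x y
    using q(5)[of "[:x:]" "[:y:]"] that by (simp add: contr_def)
  moreover have "x \<in> contr Q \<or> y \<in> contr Q" if "x \<in> C" "y \<in> C" "x * y \<in> contr Q" for x y
    using q(8)[of "[:x:]" "[:y:]"] that 0 by (simp add: contr_def mult.commute)
  ultimately show ?thesis
    using q(2,4) by (auto simp: prime_on_def ideal_on_def contr_def one_pCons)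
qed

text \<open>Take the lowest coefficients of h and g outside q, at i and j. In the coefficient of h *
  g at i + j every other summand has a factor in q, so their product would have to lie in q.\<close>

lemma pol_prime:
  assumes C: "subring_on C" and q: "prime_on C q"
  shows "prime_on (pol C) (pol q)"
  unfolding prime_on_def
proof (intro conjI ballI impI)
  show "ideal_on (pol C) (pol q)" using prime_onD(1)[OF q] by (rule ideal_on_pol[OF C])
  show "1 \<notin> pol q" using prime_onD(2)[OF q] by (auto simp: pol_def dest!: spec[of _ 0])
next
  fix h g assume hg: "h \<in> pol C" "g \<in> pol C" "h * g \<in> pol q"
  show "h \<in> pol q \<or> g \<in> pol q"
  proof (rule ccontr)
    assume "\<not> ?thesis"
    then have ex: "\<exists>i. Polynomial.coeff h i \<notin> q" "\<exists>i. Polynomial.coeff g i \<notin> q"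
      by (auto simp: pol_def)
    obtain i where i: "Polynomial.coeff h i \<notin> q" "\<And>k. k < i \<Longrightarrow> Polynomial.coeff h k \<in> q"
      using ex(1)[THEN exists_least_iff[THEN iffD1]] by auto
    obtain j where j: "Polynomial.coeff g j \<notin> q" "\<And>k. k < j \<Longrightarrow> Polynomial.coeff g k \<in> q"
      using ex(2)[THEN exists_least_iff[THEN iffD1]] by auto
    have hC: "Polynomial.coeff h k \<in> C" and gC: "Polynomial.coeff g k \<in> C" for k
      using hg by (auto simp: pol_def)
    have "Polynomial.coeff (h * g) (i + j) =
        Polynomial.coeff h i * Polynomial.coeff g j
        + (\<Sum>k\<in>{..i + j} - {i}. Polynomial.coeff h k * Polynomial.coeff g (i + j - k))"
      unfolding coeff_mult by (subst sum.remove[of _ i]) auto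
    moreover have "(\<Sum>k\<in>{..i + j} - {i}. Polynomial.coeff h k * Polynomial.coeff g (i + j - k)) \<in> q"
    proof (rule ideal_on_sum[OF prime_onD(1)[OF q]])
      fix k assume "k \<in> {..i + j} - {i}"
      then consider "k < i" | "k > i" "i + j - k < j" by fastforce
      then show "Polynomial.coeff h k * Polynomial.coeff g (i + j - k) \<in> q"
        using i(2) j(2) hC gC prime_onD(6,7)[OF q] by cases blast+
    qed
    moreover have "Polynomial.coeff (h * g) (i + j) \<in> q" using hg(3) by (simp add: pol_def)
    ultimately have "Polynomial.coeff h i * Polynomial.coeff g j \<in> q"
      using ideal_on_add_iff(2)[OF C prime_onD(1)[OF q]] by metis
    then show False using prime_onD(8)[OF q] hC gC i(1) j(1) by blast
  qed
qed

lemma pol_contr_subset: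
  assumes C: "subring_on C" and Q: "ideal_on (pol C) Q"
  shows "pol (contr Q) \<subseteq> Q"
proof
  fix h assume h: "h \<in> pol (contr Q)"
  have "h = (\<Sum>i\<le>degree h. Polynomial.monom 1 i * [:Polynomial.coeff h i:])"
    by (subst poly_as_sum_of_monoms[symmetric]) (simp add: smult_monom mult.commute[of "Polynomial.monom _ _"])
  also have "\<dots> \<in> Q"
    using h C
    by (intro ideal_on_sum[OF Q] ideal_onD(4)[OF Q] monom_mem_pol)
      (auto simp: pol_def contr_def intro: subring_onD)
  finally show "h \<in> Q" .
qed

definition eps :: "'c::comm_ring_1 poly set \<Rightarrow> bool" where
  "eps Q \<longleftrightarrow> \<not> Q \<subseteq> pol (contr Q)"

lemma not_eps: "subring_on C \<Longrightarrow> ideal_on (pol C) Q \<Longrightarrow> \<not> eps Q \<Longrightarrow> Q = pol (contr Q)"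
  using pol_contr_subset[of C Q] by (auto simp: eps_def)

text \<open>The leading coefficient of h need not be invertible, so every step first multiplies by
  it and then cancels the top coefficient. The number n counts the steps and bounds the degree of
  the quotient s.\<close>

lemma pseudo_division:
  assumes C: "subring_on C" and q: "ideal_on C q" and h: "h \<in> pol C"
    and g: "g \<in> pol q" "\<forall>i\<ge>n + degree h. Polynomial.coeff g i = 0"
  shows "\<exists>j s r. s \<in> pol q \<and> r \<in> pol q \<and> smult (lead_coeff h ^ j) g = s * h + r \<and>
    (\<forall>i\<ge>degree h. Polynomial.coeff r i = 0) \<and> (\<forall>i\<ge>n. Polynomial.coeff s i = 0)"
  using g
proof (induction n arbitrary: g)
  case 0
  then show ?case
    using ideal_onD(2)[OF q] by (intro exI[of _ 0] exI[of _ g]) (simp add: pol_def)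
next
  case (Suc n)
  define l where "l = lead_coeff h"
  define c where "c = Polynomial.coeff g (n + degree h)"
  have l: "l \<in> C" using h by (simp add: l_def pol_def)
  have c: "c \<in> q" using Suc.prems by (simp add: c_def pol_def)
  define t where "t = Polynomial.monom c n"
  have t: "t \<in> pol q" using c ideal_onD(2)[OF q] by (simp add: t_def monom_mem_pol)
  define g' where "g' = smult l g - t * h"
  have I: "ideal_on (pol C) (pol q)" by (rule ideal_on_pol[OF C q])
  have "g' \<in> pol q"
    unfolding g'_def using ideal_onD(5)[OF I h t] smult_mem_pol[OF q l Suc.prems(1)]
    by (rule ideal_on_diff[OF subring_on_pol[OF C] I, rotated])
  moreover have "Polynomial.coeff g' i = 0" if "i \<ge> n + degree h" for i
  proof (cases "i = n + degree h")
    case True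
    then show ?thesis by (simp add: g'_def t_def coeff_monom_mult l_def c_def)
  next
    case False
    then have "Polynomial.coeff g i = 0" "Polynomial.coeff h (i - n) = 0"
      using that Suc.prems(2) by (auto intro: coeff_eq_0)
    then show ?thesis using that by (simp add: g'_def t_def coeff_monom_mult)
  qed
  ultimately obtain j s r where *: "s \<in> pol q" "r \<in> pol q" "smult (l ^ j) g' = s * h + r"
    "\<forall>i\<ge>degree h. Polynomial.coeff r i = 0" "\<forall>i\<ge>n. Polynomial.coeff s i = 0"
    using Suc.IH[of g'] unfolding l_def by metis
  have "smult (l ^ Suc j) g = smult (l ^ j) g' + smult (l ^ j) t * h"
    by (simp add: g'_def smult_diff_right mult.commute)
  also have "\<dots> = (s + smult (l ^ j) t) * h + r"
    using *(3) by (simp add: ring_distribs)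
  finally have "smult (l ^ Suc j) g = (s + smult (l ^ j) t) * h + r" .
  moreover have "s + smult (l ^ j) t \<in> pol q"
    using *(1) smult_mem_pol[OF q _ t] subring_onD(7)[OF C l] ideal_onD(3)[OF I] by blast
  moreover have "\<forall>i\<ge>Suc n. Polynomial.coeff (s + smult (l ^ j) t) i = 0"
    using *(5) by (simp add: t_def)
  ultimately show ?case using *(2,4) unfolding l_def by blast
qed

text \<open>Modulo \<open>q = contr Q\<close> and over the residue field of \<open>q\<close>, the prime \<open>Q\<close> becomes nonzero iff \<open>eps Q\<close>, and
  it is then generated by any such \<open>h\<close>.\<close>

definition min_poly_elt :: "'c::comm_ring_1 poly set \<Rightarrow> 'c poly \<Rightarrow> bool" where
  "min_poly_elt Q h \<longleftrightarrow> h \<in> Q \<and> lead_coeff h \<notin> contr Q \<and>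
     (\<forall>g\<in>Q. (\<forall>i\<ge>degree h. Polynomial.coeff g i = 0) \<longrightarrow> g \<in> pol (contr Q))"

text \<open>Choose h of least degree in Q outside q[X], where q is the contraction. If its leading
  coefficient were in q, removing the leading term, which lies in Q, would leave an element of
  smaller degree outside q[X].\<close>

lemma ex_min_poly_elt:
  assumes C: "subring_on C" and Q: "prime_on (pol C) Q" and "eps Q"
  shows "\<exists>h. min_poly_elt Q h"
proof -
  define S where "S = {g \<in> Q. g \<notin> pol (contr Q)}"
  obtain g0 where "g0 \<in> S" using assms(3) by (auto simp: eps_def S_def)
  then obtain h where h: "h \<in> S" "\<And>g. g \<in> S \<Longrightarrow> degree h \<le> degree g"
    using exists_least_iff[of "\<lambda>n. \<exists>g\<in>S. degree g = n"] by (metis not_less)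
  have min: "g \<in> pol (contr Q)" if "g \<in> Q" "\<forall>i\<ge>degree h. Polynomial.coeff g i = 0" for g
  proof (rule ccontr)
    assume g: "g \<notin> pol (contr Q)"
    then have "degree h \<le> degree g" using h(2) that(1) by (simp add: S_def)
    then have "lead_coeff g = 0" using that(2) by blast
    then have "g = 0" by simp
    then show False using g prime_onD(4)[OF contr_prime[OF C Q]] by (simp add: pol_def)
  qed
  have "lead_coeff h \<notin> contr Q"
  proof
    assume lc: "lead_coeff h \<in> contr Q"
    note q = contr_prime[OF C Q]
    define t where "t = Polynomial.monom (lead_coeff h) (degree h)"
    have t: "t \<in> pol (contr Q)" using lc prime_onD(4)[OF q] by (simp add: t_def monom_mem_pol)
    then have "t \<in> Q" using pol_contr_subset[OF C prime_onD(1)[OF Q]] by blast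
    then have "h - t \<in> Q"
      using ideal_on_diff[OF subring_on_pol[OF C] prime_onD(1)[OF Q]] h(1) by (simp add: S_def)
    moreover have "Polynomial.coeff (h - t) i = 0" if "i \<ge> degree h" for i
      using that by (cases "i = degree h") (auto simp: t_def coeff_eq_0)
    ultimately have "h - t \<in> pol (contr Q)" using min by blast
    then have "(h - t) + t \<in> pol (contr Q)"
      using t ideal_onD(3)[OF ideal_on_pol[OF C prime_onD(1)[OF q]]] by blast
    then show False using h(1) by (simp add: S_def)
  qed
  then show ?thesis using h(1) min unfolding min_poly_elt_def S_def by blast
qed

text \<open>The remainder lies in Q and has no coefficients from \<open>degree h\<close> on, so it
  lies in q[X] by the choice of h.\<close>

lemma min_poly_elt_division:
  assumes C: "subring_on C" and Q: "prime_on (pol C) Q" and h: "min_poly_elt Q h" and g: "g \<in> Q"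
  shows "\<exists>j s r. s \<in> pol C \<and> r \<in> pol (contr Q) \<and> smult (lead_coeff h ^ j) g = s * h + r \<and>
    (\<forall>i\<ge>n. n + degree h > degree g \<longrightarrow> Polynomial.coeff s i = 0)"
proof -
  \<comment> \<open>If n is too small for the degree of g, the claim about s is vacuous, and a
    trivial bound on the number of division steps is used instead.\<close>
  define n' where "n' = (if n + degree h > degree g then n else Suc (degree g))"
  have hQ: "h \<in> Q" "h \<in> pol C" "lead_coeff h \<in> C" and gC: "g \<in> pol C"
    using h g prime_onD(3)[OF Q] by (auto simp: min_poly_elt_def pol_def)
  obtain j s r where *: "s \<in> pol C" "r \<in> pol C" "smult (lead_coeff h ^ j) g = s * h + r"
    "\<forall>i\<ge>degree h. Polynomial.coeff r i = 0" "\<forall>i\<ge>n'. Polynomial.coeff s i = 0"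
  proof -
    have "\<forall>i\<ge>n' + degree h. Polynomial.coeff g i = 0"
      by (auto simp: n'_def intro: coeff_eq_0 split: if_splits)
    then show ?thesis using pseudo_division[OF C self_ideal_on[OF C] hQ(2) gC] that by blast
  qed
  have "r = smult (lead_coeff h ^ j) g - s * h" using *(3) by simp
  also have "\<dots> \<in> Q"
    using smult_mem_ideal[OF C prime_onD(1)[OF Q] subring_onD(7)[OF C hQ(3)] g] prime_onD(6)[OF Q *(1) hQ(1)]
    by (rule ideal_on_diff[OF subring_on_pol[OF C] prime_onD(1)[OF Q]])
  finally have "r \<in> pol (contr Q)" using h *(4) by (auto simp: min_poly_elt_def)
  then show ?thesis using *(1,3,5) by (intro exI[of _ j] exI[of _ s] exI[of _ r]) (auto simp: n'_def)
qed

lemma contr_ideal: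
  assumes C: "subring_on C" and I: "ideal_on (pol C) I"
  shows "ideal_on C (contr I)"
proof -
  have 0: "0 \<in> C" using C by (rule subring_onD)
  note i = ideal_onD[OF I]
  have "contr I \<subseteq> C" using i(1) 0 by (auto simp: contr_def)
  moreover have "r * x \<in> contr I" if "r \<in> C" "x \<in> contr I" for r x
    using i(4)[of "[:r:]" "[:x:]"] that 0 by (simp add: contr_def mult.commute)
  moreover have "x + y \<in> contr I" if "x \<in> contr I" "y \<in> contr I" for x y
    using i(3)[of "[:x:]" "[:y:]"] that by (simp add: contr_def)
  ultimately show ?thesis using i(2) by (auto simp: ideal_on_def contr_def)
qed

lemma pol_gen_subset:
  assumes C: "subring_on C" and V: "V \<subseteq> C"
  shows "pol (gen C V) \<subseteq> gen (pol C) ((\<lambda>x. [:x:]) ` V)"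
proof -
  define G where "G = gen (pol C) ((\<lambda>x. [:x:]) ` V)"
  have "(\<lambda>x. [:x:]) ` V \<subseteq> pol C" using V subring_onD(1)[OF C] by auto
  then have G: "ideal_on (pol C) G" unfolding G_def by (rule gen_ideal[OF subring_on_pol[OF C]])
  have "V \<subseteq> contr G"
    using gen_superset[of "(\<lambda>x. [:x:]) ` V" "pol C"] by (auto simp: contr_def G_def)
  then have "gen C V \<subseteq> contr G" by (rule gen_minimal[OF contr_ideal[OF C G]])
  then have "pol (gen C V) \<subseteq> pol (contr G)" by (rule pol_mono)
  also have "\<dots> \<subseteq> G" by (rule pol_contr_subset[OF C G])
  finally show ?thesis by (simp add: G_def)
qed

text \<open>A polynomial has finitely many coefficients, so the product of their denominators clears
  all of them at once.\<close>

lemma pol_common_denom: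
  assumes C: "subring_on C" and q: "prime_on C q" and J: "ideal_on C J" and S: "S \<subseteq> C" "0 \<in> S"
    and loc: "\<And>c. c \<in> S \<Longrightarrow> \<exists>u\<in>C - q. u * c \<in> J" and h: "h \<in> pol S"
  shows "\<exists>u\<in>C - q. smult u h \<in> pol J"
  using h
proof (induction h)
  case 0
  show ?case using subring_onD(2)[OF C] prime_onD(2)[OF q] ideal_onD(2)[OF J]
    by (intro bexI[of _ 1]) (auto simp: pol_def)
next
  case (pCons c h)
  then have "c \<in> S" "h \<in> pol S" by (auto simp: pCons_mem_pol)
  then obtain u where u: "u \<in> C - q" "smult u h \<in> pol J" using pCons by blast
  obtain v where v: "v \<in> C - q" "v * c \<in> J" using loc[OF \<open>c \<in> S\<close>] by blast
  have "smult (v * u) h \<in> pol J"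
    using smult_mem_pol[OF J _ u(2), of v] v(1) by simp
  moreover have "(v * u) * c \<in> J"
    using ideal_onD(4)[OF J _ v(2), of u] u(1) by (simp add: algebra_simps)
  ultimately have "smult (v * u) (pCons c h) \<in> pol J" by (simp add: pCons_mem_pol)
  moreover have "v * u \<in> C - q"
    using u(1) v(1) subring_onD(5)[OF C] prime_onD(8)[OF q] by blast
  ultimately show ?case by blast
qed

subsection \<open>Local bases of prime ideals\<close>

text \<open>Statements about the localization \<open>C\<^sub>Q\<close> are expressed in \<open>C\<close> by means of denominators outside \<open>Q\<close>:
  \<open>lsq C Q\<close> is the preimage of the square of its maximal ideal, and an \<open>lbasis\<close> maps to a basis of the
  cotangent space.\<close>

definition msq :: "'c::comm_ring_1 set \<Rightarrow> 'c set \<Rightarrow> 'c set" where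
  "msq C Q = gen C {x * y |x y. x \<in> Q \<and> y \<in> Q}"

definition lsq :: "'c::comm_ring_1 set \<Rightarrow> 'c set \<Rightarrow> 'c set" where
  "lsq C Q = {x \<in> C. \<exists>u\<in>C - Q. u * x \<in> msq C Q}"

definition indep :: "'c::comm_ring_1 set \<Rightarrow> 'c set \<Rightarrow> 'i set \<Rightarrow> ('i \<Rightarrow> 'c) \<Rightarrow> bool" where
  "indep C Q I w \<longleftrightarrow> (\<forall>a. (\<forall>i\<in>I. a i \<in> C) \<longrightarrow> (\<Sum>i\<in>I. a i * w i) \<in> lsq C Q \<longrightarrow> (\<forall>i\<in>I. a i \<in> Q))"

definition lgen :: "'c::comm_ring_1 set \<Rightarrow> 'c set \<Rightarrow> 'c set \<Rightarrow> bool" where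
  "lgen C Q V \<longleftrightarrow> (\<forall>x\<in>Q. \<exists>u\<in>C - Q. u * x \<in> gen C V)"

definition lbasis :: "'c::comm_ring_1 set \<Rightarrow> 'c set \<Rightarrow> 'c set \<Rightarrow> bool" where
  "lbasis C Q V \<longleftrightarrow> finite V \<and> V \<subseteq> Q \<and> lgen C Q V \<and> indep C Q V (\<lambda>v. v)"

section \<open>Calculus with denominators outside a prime\<close>

lemma diff_prime_mult:
  "subring_on C \<Longrightarrow> prime_on C Q \<Longrightarrow> u \<in> C - Q \<Longrightarrow> v \<in> C - Q \<Longrightarrow> u * v \<in> C - Q"
  using subring_onD(5)[of C u v] prime_onD(8)[of C Q u v] by blast

lemma diff_prime_one: "subring_on C \<Longrightarrow> prime_on C Q \<Longrightarrow> 1 \<in> C - Q"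
  using subring_onD(2)[of C] prime_onD(2)[of C Q] by blast

text \<open>The colon ideal of A by x, formed in the localization at Q and pulled back to C; x = 1
  gives the saturation of A.\<close>

lemma local_colon_ideal:
  assumes C: "subring_on C" and Q: "prime_on C Q" and A: "ideal_on C A" and x: "x \<in> C"
  shows "ideal_on C {y \<in> C. \<exists>u\<in>C - Q. u * x * y \<in> A}" (is "ideal_on C ?J")
  unfolding ideal_on_def
proof (intro conjI ballI)
  show "?J \<subseteq> C" by blast
  show "0 \<in> ?J" using ideal_onD(2)[OF A] subring_onD(1)[OF C] diff_prime_one[OF C Q] by auto
next
  fix y z assume "y \<in> ?J" "z \<in> ?J"
  then obtain u v where u: "y \<in> C" "u \<in> C - Q" "u * x * y \<in> A"
    and v: "z \<in> C" "v \<in> C - Q" "v * x * z \<in> A" by auto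
  have "(u * v) * x * (y + z) = v * (u * x * y) + u * (v * x * z)" by (simp add: algebra_simps)
  also have "\<dots> \<in> A" using u v ideal_onD(3,4)[OF A] by simp
  finally show "y + z \<in> ?J"
    using diff_prime_mult[OF C Q u(2) v(2)] u v subring_onD(3)[OF C] by blast
next
  fix r y assume r: "r \<in> C" and "y \<in> ?J"
  then obtain u where u: "y \<in> C" "u \<in> C - Q" "u * x * y \<in> A" by auto
  have "u * x * (r * y) = r * (u * x * y)" by (simp add: algebra_simps)
  also have "\<dots> \<in> A" using u r ideal_onD(4)[OF A] by simp
  finally show "r * y \<in> ?J" using u r subring_onD(5)[OF C] by blast
qed

lemma msq_props:
  assumes C: "subring_on C" and Q: "prime_on C Q"
  shows "ideal_on C (msq C Q)" "msq C Q \<subseteq> Q" "x \<in> Q \<Longrightarrow> y \<in> Q \<Longrightarrow> x * y \<in> msq C Q"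
proof -
  have "{x * y |x y. x \<in> Q \<and> y \<in> Q} \<subseteq> Q"
    using prime_onD(3)[OF Q] prime_onD(6)[OF Q] by blast
  then show "msq C Q \<subseteq> Q" "ideal_on C (msq C Q)"
    unfolding msq_def using gen_minimal[OF prime_onD(1)[OF Q]] prime_onD(3)[OF Q]
    by (auto intro!: gen_ideal[OF C])
  show "x \<in> Q \<Longrightarrow> y \<in> Q \<Longrightarrow> x * y \<in> msq C Q"
    unfolding msq_def by (rule subsetD[OF gen_superset]) blast
qed

lemma lsq_cancel:
  assumes C: "subring_on C" and Q: "prime_on C Q" and "u \<in> C - Q" "x \<in> C" "u * x \<in> lsq C Q"
  shows "x \<in> lsq C Q"
proof -
  obtain v where v: "v \<in> C - Q" "v * (u * x) \<in> msq C Q" using assms(5) by (auto simp: lsq_def)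
  then have "(v * u) * x \<in> msq C Q" by (simp add: mult.assoc)
  then show ?thesis using diff_prime_mult[OF C Q v(1) assms(3)] assms(4) unfolding lsq_def by blast
qed

lemma msq_subset_lsq:
  assumes C: "subring_on C" and Q: "prime_on C Q"
  shows "msq C Q \<subseteq> lsq C Q"
proof
  fix x assume x: "x \<in> msq C Q"
  then have "x \<in> C" using ideal_onD(1)[OF msq_props(1)[OF C Q]] by blast
  then show "x \<in> lsq C Q" unfolding lsq_def using x diff_prime_one[OF C Q] by (auto intro!: bexI[of _ 1])
qed

lemma lsq_props:
  assumes C: "subring_on C" and Q: "prime_on C Q"
  shows "ideal_on C (lsq C Q)" "lsq C Q \<subseteq> Q" "x \<in> Q \<Longrightarrow> y \<in> Q \<Longrightarrow> x * y \<in> lsq C Q"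
proof -
  note m = msq_props[OF C Q]
  show "lsq C Q \<subseteq> Q"
  proof
    fix x assume "x \<in> lsq C Q"
    then obtain u where "x \<in> C" "u \<in> C - Q" "u * x \<in> Q" using m(2) by (auto simp: lsq_def)
    then show "x \<in> Q" using prime_onD(8)[OF Q, of u x] by blast
  qed
  show "ideal_on C (lsq C Q)"
    using local_colon_ideal[OF C Q m(1) subring_onD(2)[OF C]] by (simp add: lsq_def)
  show "x \<in> Q \<Longrightarrow> y \<in> Q \<Longrightarrow> x * y \<in> lsq C Q"
    using m(3) msq_subset_lsq[OF C Q] by blast
qed

lemma gen_empty: "subring_on C \<Longrightarrow> gen C {} = {0}"
  by (subst gen_finite) auto

lemma gen_insert:
  assumes C: "subring_on C" and "t \<in> C" "T \<subseteq> C"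
  shows "gen C (insert t T) = {c * t + y |c y. c \<in> C \<and> y \<in> gen C T}"
  using gen_Un[OF C, of "{t}" T] gen_singleton[OF C assms(2)] assms by auto

text \<open>Steinitz exchange in the cotangent space \<open>Q/Q\<^sup>2\<close> of the localization at \<open>Q\<close>.\<close>

lemma indep_card_le:
  assumes C: "subring_on C" and Q: "prime_on C Q"
    and "finite T" "T \<subseteq> Q" "finite I" "indep C Q I w"
    and "\<And>i. i \<in> I \<Longrightarrow> w i \<in> Q"
    and "\<And>i. i \<in> I \<Longrightarrow> \<exists>u\<in>C - Q. \<exists>y\<in>gen C T. u * w i - y \<in> lsq C Q"
  shows "card I \<le> card T"
  using assms(3-)
proof (induction T arbitrary: I w rule: finite_induct)
  case empty
  note L = lsq_props[OF C Q]
  have False if i: "i \<in> I" for i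
  proof -
    obtain u where u: "u \<in> C - Q" "u * w i \<in> lsq C Q"
      using empty.prems(5)[OF i] by (auto simp: gen_empty[OF C])
    define a where "a k = (if k = i then u else 0)" for k
    have "(\<Sum>k\<in>I. a k * w k) = (\<Sum>k\<in>I. if k = i then u * w i else 0)"
      by (intro sum.cong) (auto simp: a_def)
    then have "(\<Sum>k\<in>I. a k * w k) \<in> lsq C Q" using i empty.prems(2) u(2) by simp
    moreover have "\<forall>k\<in>I. a k \<in> C" using u(1) subring_onD(1)[OF C] by (auto simp: a_def)
    ultimately have "a i \<in> Q" using empty.prems(3) i unfolding indep_def by blast
    then show False using u(1) by (simp add: a_def)
  qed
  then have "I = {}" by blast
  then show ?case by simp
next
  case (insert t T)
  note L = lsq_props[OF C Q]
  have tQ: "t \<in> Q" "T \<subseteq> Q" and TC: "t \<in> C" "T \<subseteq> C"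
    using insert.prems(1) prime_onD(3)[OF Q] by auto
  have GT: "ideal_on C (gen C T)" by (rule gen_ideal[OF C TC(2)])
  have "\<exists>u c y. u \<in> C - Q \<and> c \<in> C \<and> y \<in> gen C T \<and> u * w i - (c * t + y) \<in> lsq C Q" if "i \<in> I" for i
    using insert.prems(5)[OF that] unfolding gen_insert[OF C TC] by blast
  then obtain u c y where *: "\<And>i. i \<in> I \<Longrightarrow> u i \<in> C - Q" "\<And>i. i \<in> I \<Longrightarrow> c i \<in> C"
    "\<And>i. i \<in> I \<Longrightarrow> y i \<in> gen C T" "\<And>i. i \<in> I \<Longrightarrow> u i * w i - (c i * t + y i) \<in> lsq C Q"
    by metis
  show ?case
  proof (cases "\<forall>i\<in>I. c i \<in> Q")
    case True
    have "\<exists>u\<in>C - Q. \<exists>y\<in>gen C T. u * w i - y \<in> lsq C Q" if i: "i \<in> I" for i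
    proof -
      have "c i * t \<in> lsq C Q" using L(3) True i tQ by blast
      then have "(u i * w i - (c i * t + y i)) + c i * t \<in> lsq C Q"
        using *(4)[OF i] ideal_onD(3)[OF L(1)] by blast
      then have "u i * w i - y i \<in> lsq C Q" by simp
      then show ?thesis using *(1,3)[OF i] by blast
    qed
    then have "card I \<le> card T"
      using insert.IH[OF tQ(2) insert.prems(2,3,4)] by blast
    then show ?thesis using insert.hyps by simp
  next
    case False
    then obtain k where k: "k \<in> I" "c k \<notin> Q" by blast
    \<comment> \<open>Pivot on k: the combination cancels t and leaves a family with one index
      fewer, spanned by T modulo the square.\<close>
    define w' where "w' i = c k * (u i * w i) - c i * (u k * w k)" for i
    have wC: "w i \<in> C" if "i \<in> I" for i using insert.prems(4)[OF that] prime_onD(3)[OF Q] by blast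
    have uC: "u i \<in> C" if "i \<in> I" for i using *(1)[OF that] by blast
    note s = subring_onD[OF C]
    have w'Q: "w' i \<in> Q" if i: "i \<in> I" for i
      unfolding w'_def
      by (intro ideal_on_diff[OF C prime_onD(1)[OF Q]] prime_onD(6)[OF Q] insert.prems(4) *(2) uC i k)
    have "indep C Q (I - {k}) w'"
      unfolding indep_def
    proof (intro allI impI)
      fix a assume a: "\<forall>i\<in>I - {k}. a i \<in> C" and sum: "(\<Sum>i\<in>I - {k}. a i * w' i) \<in> lsq C Q"
      \<comment> \<open>The relation a between the \<open>w' i\<close>, read as a relation between
        the \<open>w i\<close>. Off k its coefficients are those of a times elements outside
        Q.\<close>
      define b where "b i = (if i = k then - (\<Sum>i\<in>I - {k}. a i * (c i * u k)) else a i * (c k * u i))" for i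
      have bC: "\<forall>i\<in>I. b i \<in> C"
        using a k *(2) uC by (auto simp: b_def intro!: s subring_on_sum[OF C])
      have "(\<Sum>i\<in>I. b i * w i) = b k * w k + (\<Sum>i\<in>I - {k}. a i * (c k * u i) * w i)"
        using k(1) insert.prems(2) by (subst sum.remove[of _ k]) (auto simp: b_def)
      also have "\<dots> = (\<Sum>i\<in>I - {k}. a i * (c k * u i) * w i - a i * (c i * u k) * w k)"
        by (simp add: b_def sum_subtractf sum_distrib_right)
      also have "\<dots> = (\<Sum>i\<in>I - {k}. a i * w' i)"
        by (intro sum.cong) (auto simp: w'_def algebra_simps)
      finally have "(\<Sum>i\<in>I. b i * w i) \<in> lsq C Q" using sum by simp
      then have bQ: "\<forall>i\<in>I. b i \<in> Q" using insert.prems(3) bC unfolding indep_def by blast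
      show "\<forall>i\<in>I - {k}. a i \<in> Q"
      proof
        fix i assume i: "i \<in> I - {k}"
        then have "a i * (c k * u i) \<in> Q" using bQ by (auto simp: b_def dest!: bspec[of _ _ i])
        moreover have "c k * u i \<in> C - Q"
          using diff_prime_mult[OF C Q] k *(2)[OF k(1)] *(1) i by blast
        ultimately show "a i \<in> Q" using prime_onD(8)[OF Q, of "a i" "c k * u i"] a i by blast
      qed
    qed
    moreover have "\<exists>u\<in>C - Q. \<exists>y\<in>gen C T. u * w' i - y \<in> lsq C Q" if "i \<in> I - {k}" for i
    proof -
      have i: "i \<in> I" using that by blast
      define z where "z = c k * y i - c i * y k"
      have "z \<in> gen C T"
        unfolding z_def using ideal_on_diff[OF C GT] ideal_onD(4)[OF GT] *(2,3) i k(1) by blast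
      have "c k * (u i * w i - (c i * t + y i)) - c i * (u k * w k - (c k * t + y k)) \<in> lsq C Q"
        using ideal_on_diff[OF C L(1)] ideal_onD(4)[OF L(1)] *(2,4) i k(1) by blast
      moreover have "c k * (u i * w i - (c i * t + y i)) - c i * (u k * w k - (c k * t + y k)) = 1 * w' i - z"
        by (simp add: w'_def z_def algebra_simps)
      ultimately show ?thesis using \<open>z \<in> gen C T\<close> diff_prime_one[OF C Q] by metis
    qed
    ultimately have "card (I - {k}) \<le> card T"
      using insert.IH[OF tQ(2), of "I - {k}" w'] insert.prems(2) w'Q by blast
    then show ?thesis using insert.hyps k(1) insert.prems(2) by simp
  qed
qed

text \<open>Write u f as a combination of V. Since f is outside the square, some coefficient r v is
  outside Q, so the equation can be solved for v after localization.\<close>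

lemma lbasis_exchange:
  assumes C: "subring_on C" and Q: "prime_on C Q" and V: "lbasis C Q V" and f: "f \<in> Q" "f \<notin> lsq C Q"
  shows "\<exists>v\<in>V. lgen C Q (insert f (V - {v}))"
proof -
  note L = lsq_props[OF C Q]
  have fV: "finite V" and VQ: "V \<subseteq> Q" and gV: "lgen C Q V" using V by (auto simp: lbasis_def)
  have VC: "V \<subseteq> C" using VQ prime_onD(3)[OF Q] by blast
  have fC: "f \<in> C" using f(1) prime_onD(3)[OF Q] by blast
  obtain u where u: "u \<in> C - Q" "u * f \<in> gen C V" using gV f(1) by (auto simp: lgen_def)
  obtain r where r: "\<forall>v\<in>V. r v \<in> C" "u * f = (\<Sum>v\<in>V. r v * v)"
    using u(2) unfolding gen_finite[OF C fV VC] by blast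
  have "\<exists>v\<in>V. r v \<notin> Q"
  proof (rule ccontr)
    assume "\<not> ?thesis"
    then have "(\<Sum>v\<in>V. r v * v) \<in> lsq C Q"
      using VQ L(3) by (intro ideal_on_sum[OF L(1)]) blast
    then show False using lsq_cancel[OF C Q u(1) fC] r(2) f(2) by simp
  qed
  then obtain v where v: "v \<in> V" "r v \<notin> Q" by blast
  define G where "G = gen C (insert f (V - {v}))"
  have G: "ideal_on C G" unfolding G_def using fC VC by (intro gen_ideal[OF C]) auto
  have sup: "insert f (V - {v}) \<subseteq> G" unfolding G_def by (rule gen_superset)
  have "r v * v = u * f - (\<Sum>w\<in>V - {v}. r w * w)"
    using r(2) v(1) fV by (subst (asm) sum.remove[of _ v]) auto
  also have "\<dots> \<in> G"
    using sup u(1) r(1)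
    by (intro ideal_on_diff[OF C G] ideal_on_sum[OF G] ideal_onD(4)[OF G]) auto
  finally have rv: "r v * v \<in> G" .
  have rw: "r v * w \<in> G" if w: "w \<in> V" for w
  proof (cases "w = v")
    case False
    then show ?thesis using w sup r(1) v(1) by (intro ideal_onD(4)[OF G]) auto
  qed (use rv in simp)
  have rx: "r v * x \<in> G" if x: "x \<in> gen C V" for x
  proof -
    obtain s where s: "\<forall>v\<in>V. s v \<in> C" "x = (\<Sum>v\<in>V. s v * v)"
      using x unfolding gen_finite[OF C fV VC] by blast
    have "r v * x = (\<Sum>w\<in>V. s w * (r v * w))" by (simp add: s(2) sum_distrib_left algebra_simps)
    also have "\<dots> \<in> G"
      using s(1) rw by (intro ideal_on_sum[OF G]) (blast intro: ideal_onD(4)[OF G])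
    finally show ?thesis .
  qed
  have "lgen C Q (insert f (V - {v}))"
    unfolding lgen_def
  proof (intro ballI)
    fix x assume "x \<in> Q"
    then obtain u' where u': "u' \<in> C - Q" "u' * x \<in> gen C V" using gV by (auto simp: lgen_def)
    have "(r v * u') * x \<in> G" using rx[OF u'(2)] by (simp add: mult.assoc)
    moreover have "r v * u' \<in> C - Q" using diff_prime_mult[OF C Q _ u'(1)] r(1) v by blast
    ultimately show "\<exists>u\<in>C - Q. u * x \<in> gen C (insert f (V - {v}))" unfolding G_def by blast
  qed
  then show ?thesis using v(1) by blast
qed

section \<open>Local bases along the step from C to C[X]\<close>

text \<open>The members of V are constants, so each power of X gives a separate relation between
  them over C.\<close>

lemma indep_coeffs:
  assumes C: "subring_on C" and q: "prime_on C q" and V: "finite V" "V \<subseteq> C" "indep C q V (\<lambda>v. v)"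
    and b: "\<And>v. v \<in> V \<Longrightarrow> b v \<in> pol C" "(\<Sum>v\<in>V. b v * [:v:]) \<in> pol (msq C q)"
    and v: "v \<in> V"
  shows "b v \<in> pol q"
  unfolding pol_iff
proof
  fix n
  have "(\<Sum>v\<in>V. Polynomial.coeff (b v) n * v) = Polynomial.coeff (\<Sum>v\<in>V. b v * [:v:]) n"
    by (simp add: coeff_sum mult.commute)
  also have "\<dots> \<in> lsq C q" using b(2) msq_subset_lsq[OF C q] by (auto simp: pol_def)
  finally have "(\<Sum>v\<in>V. Polynomial.coeff (b v) n * v) \<in> lsq C q" .
  moreover have "\<forall>v\<in>V. Polynomial.coeff (b v) n \<in> C" using b(1) by (auto simp: pol_def)
  ultimately show "Polynomial.coeff (b v) n \<in> q"
    using V(3)[unfolded indep_def, rule_format, of "\<lambda>v. Polynomial.coeff (b v) n"] v by blast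
qed

lemma msq_pol:
  assumes C: "subring_on C" and q: "prime_on C q" and "x \<in> pol q" "y \<in> pol q"
  shows "x * y \<in> pol (msq C q)"
  using assms(3,4) msq_props[OF C q]
  by (auto simp: pol_def coeff_mult intro!: ideal_on_sum[of C])

lemma const_not_mem:
  assumes "subring_on C" "u \<in> C - contr Q"
  shows "[:u:] \<in> pol C - Q"
  using assms subring_onD(1)[OF assms(1)] by (auto simp: contr_def)

lemma inj_const: "inj_on (\<lambda>x. [:x:]) V"
  by (auto simp: inj_on_def)

text \<open>Here Q = q[X], and both generation and independence can be checked coefficient by
  coefficient.\<close>

lemma lbasis_pol:
  assumes C: "subring_on C" and Q: "prime_on (pol C) Q" and V: "lbasis C (contr Q) V" and "\<not> eps Q"
  shows "lbasis (pol C) Q ((\<lambda>x. [:x:]) ` V)"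
proof -
  define q where "q = contr Q"
  have C': "subring_on (pol C)" by (rule subring_on_pol[OF C])
  have q: "prime_on C q" unfolding q_def by (rule contr_prime[OF C Q])
  have Qq: "Q = pol q" unfolding q_def by (rule not_eps[OF C prime_onD(1)[OF Q] assms(4)])
  have fV: "finite V" and Vq: "V \<subseteq> q" and gV: "lgen C q V" and iV: "indep C q V (\<lambda>v. v)"
    using V by (auto simp: lbasis_def q_def)
  have VC: "V \<subseteq> C" using Vq prime_onD(3)[OF q] by blast
  have "lgen (pol C) Q ((\<lambda>x. [:x:]) ` V)"
    unfolding lgen_def
  proof
    fix x assume "x \<in> Q"
    then obtain u where u: "u \<in> C - q" "smult u x \<in> pol (gen C V)"
      using pol_common_denom[OF C q gen_ideal[OF C VC] prime_onD(3)[OF q] prime_onD(4)[OF q], of x] gV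
      by (auto simp: Qq lgen_def)
    then have "[:u:] * x \<in> gen (pol C) ((\<lambda>x. [:x:]) ` V)" using pol_gen_subset[OF C VC] by auto
    then show "\<exists>u\<in>pol C - Q. u * x \<in> gen (pol C) ((\<lambda>x. [:x:]) ` V)"
      using const_not_mem[OF C u(1)[unfolded q_def]] by blast
  qed
  moreover have "indep (pol C) Q ((\<lambda>x. [:x:]) ` V) (\<lambda>v. v)"
    unfolding indep_def
  proof (intro allI impI)
    fix a assume a: "\<forall>i\<in>(\<lambda>x. [:x:]) ` V. a i \<in> pol C"
      and "(\<Sum>i\<in>(\<lambda>x. [:x:]) ` V. a i * i) \<in> lsq (pol C) Q"
    then obtain u where u: "u \<in> pol C - Q" "u * (\<Sum>v\<in>V. a [:v:] * [:v:]) \<in> msq (pol C) Q"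
      unfolding lsq_def sum.reindex[OF inj_const] o_def by blast
    have "msq (pol C) Q \<subseteq> pol (msq C q)"
      unfolding msq_def[of "pol C"]
      using ideal_on_pol[OF C msq_props(1)[OF C q]] msq_pol[OF C q]
      by (intro gen_minimal) (auto simp: Qq)
    then have "(\<Sum>v\<in>V. (u * a [:v:]) * [:v:]) \<in> pol (msq C q)"
      using u(2) by (auto simp: sum_distrib_left mult.assoc)
    then have "u * a [:v:] \<in> pol q" if "v \<in> V" for v
      using indep_coeffs[OF C q fV VC iV, of "\<lambda>v. u * a [:v:]"] a u(1) that subring_onD(5)[OF C'] by blast
    then show "\<forall>i\<in>(\<lambda>x. [:x:]) ` V. a i \<in> Q"
      using prime_onD(8)[OF Q] u(1) a unfolding Qq by blast
  qed
  moreover have "(\<lambda>x. [:x:]) ` V \<subseteq> Q" using Vq by (auto simp: q_def contr_def)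
  ultimately show ?thesis using fV by (simp add: lbasis_def)
qed

lemma min_poly_elt_reduce:
  assumes "subring_on C" "prime_on (pol C) Q" "min_poly_elt Q h" "g \<in> Q"
  shows "\<exists>j s r. s \<in> pol C \<and> r \<in> pol (contr Q) \<and> smult (lead_coeff h ^ j) g = s * h + r"
  using min_poly_elt_division[OF assms, of 0] by (elim exE conjE) (intro exI conjI)

text \<open>Up to powers of its leading coefficient, h together with q[X] generates Q, so the square
  is spanned by h^2, h q[X] and q^2[X]. The elements with such an expansion form an ideal containing
  all products of two members of Q.\<close>

lemma msq_expansion:
  assumes C: "subring_on C" and Q: "prime_on (pol C) Q" and h: "min_poly_elt Q h"
    and x: "x \<in> msq (pol C) Q"
  shows "\<exists>j s t r. s \<in> pol C \<and> t \<in> pol (contr Q) \<and> r \<in> pol (msq C (contr Q)) \<and>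
    smult (lead_coeff h ^ j) x = s * h * h + t * h + r"
proof -
  define q where "q = contr Q"
  define l where "l = lead_coeff h"
  have C': "subring_on (pol C)" by (rule subring_on_pol[OF C])
  have q: "prime_on C q" unfolding q_def by (rule contr_prime[OF C Q])
  have hQ: "h \<in> Q" "h \<in> pol C" "l \<in> C"
    using h prime_onD(3)[OF Q] by (auto simp: min_poly_elt_def pol_def l_def)
  have q': "ideal_on (pol C) (pol q)" by (rule ideal_on_pol[OF C prime_onD(1)[OF q]])
  have m: "ideal_on C (msq C q)" by (rule msq_props[OF C q])
  have m': "ideal_on (pol C) (pol (msq C q))" by (rule ideal_on_pol[OF C m])
  define J where "J = {x \<in> pol C. \<exists>j s t r. s \<in> pol C \<and> t \<in> pol q \<and> r \<in> pol (msq C q) \<and>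
    smult (l ^ j) x = s * h * h + t * h + r}"
  have lpow: "l ^ j \<in> C" for j by (rule subring_onD(7)[OF C hQ(3)])
  have "ideal_on (pol C) J"
    unfolding ideal_on_def
  proof (intro conjI ballI)
    show "J \<subseteq> pol C" by (auto simp: J_def)
    show "0 \<in> J" unfolding J_def
      using subring_onD(1)[OF C'] ideal_onD(2)[OF q'] ideal_onD(2)[OF m']
      by (intro CollectI conjI exI[of _ 0]) auto
  next
    fix x y assume "x \<in> J" "y \<in> J"
    then obtain i s t r j s' t' r' where
      1: "x \<in> pol C" "s \<in> pol C" "t \<in> pol q" "r \<in> pol (msq C q)" "smult (l ^ i) x = s * h * h + t * h + r"
      and 2: "y \<in> pol C" "s' \<in> pol C" "t' \<in> pol q" "r' \<in> pol (msq C q)" "smult (l ^ j) y = s' * h * h + t' * h + r'"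
      unfolding J_def by blast
    have "smult (l ^ (i + j)) (x + y) = smult (l ^ j) (smult (l ^ i) x) + smult (l ^ i) (smult (l ^ j) y)"
      by (simp add: power_add smult_add_right mult.commute)
    also have "\<dots> = (smult (l ^ j) s + smult (l ^ i) s') * h * h + (smult (l ^ j) t + smult (l ^ i) t') * h
      + (smult (l ^ j) r + smult (l ^ i) r')"
      unfolding 1(5) 2(5) by (simp add: smult_add_right ring_distribs)
    finally have e: "smult (l ^ (i + j)) (x + y) = \<dots>" .
    have "smult (l ^ j) s + smult (l ^ i) s' \<in> pol C"
      using smult_mem_pol_subring[OF C lpow] 1 2 subring_onD(3)[OF C'] by blast
    moreover have "smult (l ^ j) t + smult (l ^ i) t' \<in> pol q"
      using smult_mem_pol[OF prime_onD(1)[OF q] lpow] 1 2 ideal_onD(3)[OF q'] by blast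
    moreover have "smult (l ^ j) r + smult (l ^ i) r' \<in> pol (msq C q)"
      using smult_mem_pol[OF m lpow] 1 2 ideal_onD(3)[OF m'] by blast
    moreover have "x + y \<in> pol C" using 1 2 subring_onD(3)[OF C'] by blast
    ultimately show "x + y \<in> J" using e unfolding J_def by blast
  next
    fix c x assume c: "c \<in> pol C" and "x \<in> J"
    then obtain i s t r where
      1: "x \<in> pol C" "s \<in> pol C" "t \<in> pol q" "r \<in> pol (msq C q)" "smult (l ^ i) x = s * h * h + t * h + r"
      unfolding J_def by blast
    have "smult (l ^ i) (c * x) = c * smult (l ^ i) x" by simp
    also have "\<dots> = (c * s) * h * h + (c * t) * h + c * r"
      unfolding 1(5) by (simp add: algebra_simps)
    finally have "smult (l ^ i) (c * x) = (c * s) * h * h + (c * t) * h + c * r" .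
    moreover have "c * s \<in> pol C" "c * x \<in> pol C" using c 1 subring_onD(5)[OF C'] by blast+
    moreover have "c * t \<in> pol q" using c 1 ideal_onD(4)[OF q'] by blast
    moreover have "c * r \<in> pol (msq C q)" using c 1 ideal_onD(4)[OF m'] by blast
    ultimately show "c * x \<in> J" unfolding J_def by blast
  qed
  moreover have "{x * y |x y. x \<in> Q \<and> y \<in> Q} \<subseteq> J"
  proof clarify
    fix x y assume xy: "x \<in> Q" "y \<in> Q"
    obtain i s r where 1: "s \<in> pol C" "r \<in> pol q" "smult (l ^ i) x = s * h + r"
      using min_poly_elt_reduce[OF C Q h xy(1)] unfolding l_def q_def by blast
    obtain j s' r' where 2: "s' \<in> pol C" "r' \<in> pol q" "smult (l ^ j) y = s' * h + r'"
      using min_poly_elt_reduce[OF C Q h xy(2)] unfolding l_def q_def by blast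
    have "smult (l ^ (i + j)) (x * y) = smult (l ^ i) x * smult (l ^ j) y"
      by (simp add: power_add mult.commute)
    also have "\<dots> = (s * s') * h * h + (s * r' + s' * r) * h + r * r'"
      unfolding 1(3) 2(3) by (simp add: algebra_simps)
    finally have "smult (l ^ (i + j)) (x * y) = (s * s') * h * h + (s * r' + s' * r) * h + r * r'" .
    moreover have "s * s' \<in> pol C" using 1 2 subring_onD(5)[OF C'] by blast
    moreover have "x * y \<in> pol C" using xy prime_onD(3)[OF Q] subring_onD(5)[OF C'] by blast
    moreover have "s * r' + s' * r \<in> pol q" using 1 2 ideal_onD(3,4)[OF q'] by blast
    moreover have "r * r' \<in> pol (msq C q)" using msq_pol[OF C q] 1 2 by blast
    ultimately show "x * y \<in> J" unfolding J_def by blast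
  qed
  ultimately have "msq (pol C) Q \<subseteq> J" unfolding msq_def[of "pol C"] by (rule gen_minimal)
  then show ?thesis using x unfolding J_def l_def q_def by blast
qed

text \<open>Generation is division by h. For independence, the expansion of a relation in h^2, h
  q[X] and q^2[X] is used twice: modulo q[X] it determines the coefficient of h, and then modulo
  q^2[X] the coefficients of V.\<close>

lemma lbasis_pol_eps:
  assumes C: "subring_on C" and Q: "prime_on (pol C) Q" and V: "lbasis C (contr Q) V" and h: "min_poly_elt Q h"
  shows "lbasis (pol C) Q (insert h ((\<lambda>x. [:x:]) ` V))" "h \<notin> (\<lambda>x. [:x:]) ` V"
proof -
  define q where "q = contr Q"
  define l where "l = lead_coeff h"
  define W where "W = (\<lambda>x::'a. [:x:]) ` V"
  have C': "subring_on (pol C)" by (rule subring_on_pol[OF C])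
  have q: "prime_on C q" unfolding q_def by (rule contr_prime[OF C Q])
  have pq: "prime_on (pol C) (pol q)" by (rule pol_prime[OF C q])
  have pqQ: "pol q \<subseteq> Q" unfolding q_def by (rule pol_contr_subset[OF C prime_onD(1)[OF Q]])
  have hQ: "h \<in> Q" "h \<in> pol C" "l \<in> C" "l \<notin> q"
    using h prime_onD(3)[OF Q] by (auto simp: min_poly_elt_def pol_def l_def q_def)
  then have hq: "h \<notin> pol q" by (auto simp: pol_def l_def)
  have lj: "l ^ j \<in> C - q" for j
    using subring_onD(7)[OF C hQ(3)] prime_on_power[OF C q hQ(3,4)] by blast
  then have lj': "[:l ^ j:] \<in> pol C - Q" for j unfolding q_def by (rule const_not_mem[OF C])
  have fV: "finite V" and Vq: "V \<subseteq> q" and gV: "lgen C q V" and iV: "indep C q V (\<lambda>v. v)"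
    using V by (auto simp: lbasis_def q_def)
  have VC: "V \<subseteq> C" using Vq prime_onD(3)[OF q] by blast
  have WQ: "W \<subseteq> pol q" using Vq prime_onD(4)[OF q] by (auto simp: W_def)
  have WC: "W \<subseteq> pol C" using WQ prime_onD(3)[OF pq] by blast
  show hW: "h \<notin> (\<lambda>x. [:x:]) ` V" using WQ hq unfolding W_def by blast
  note s = subring_onD[OF C']
  have GW: "gen (pol C) W \<subseteq> gen (pol C) (insert h W)"
    using gen_superset[of "insert h W" "pol C"] by (auto simp: gen_def)
  have GI: "ideal_on (pol C) (gen (pol C) (insert h W))"
    using hQ(2) WC by (intro gen_ideal[OF C']) auto
  have hG: "h \<in> gen (pol C) (insert h W)" using gen_superset[of "insert h W" "pol C"] by blast
  have denom: "\<exists>u\<in>C - q. smult u x \<in> gen (pol C) W" if x: "x \<in> pol q" for x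
  proof -
    obtain u where u: "u \<in> C - q" "smult u x \<in> pol (gen C V)"
      using pol_common_denom[OF C q gen_ideal[OF C VC] prime_onD(3)[OF q] prime_onD(4)[OF q], of x] gV x
      by (auto simp: lgen_def)
    then show ?thesis using pol_gen_subset[OF C VC] unfolding W_def by blast
  qed
  have "lgen (pol C) Q (insert h W)"
    unfolding lgen_def
  proof
    fix x assume x: "x \<in> Q"
    obtain j t r where 1: "t \<in> pol C" "r \<in> pol q" "smult (l ^ j) x = t * h + r"
      using min_poly_elt_reduce[OF C Q h x] unfolding l_def q_def by blast
    obtain u where u: "u \<in> C - q" "smult u r \<in> gen (pol C) W" using denom[OF 1(2)] by blast
    have "[:u * l ^ j:] * x = smult u (smult (l ^ j) x)" by simp
    also have "\<dots> = smult u t * h + smult u r" unfolding 1(3) by (simp add: smult_add_right)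
    also have "\<dots> \<in> gen (pol C) (insert h W)"
      using u GW smult_mem_pol_subring[OF C _ 1(1), of u] hG ideal_onD(3,4)[OF GI] by blast
    finally have "[:u * l ^ j:] * x \<in> gen (pol C) (insert h W)" .
    moreover have "[:u * l ^ j:] \<in> pol C - Q"
      using diff_prime_mult[OF C q u(1) lj[of j]] unfolding q_def by (rule const_not_mem[OF C])
    ultimately show "\<exists>u\<in>pol C - Q. u * x \<in> gen (pol C) (insert h W)" by blast
  qed
  moreover have "indep (pol C) Q (insert h W) (\<lambda>v. v)"
    unfolding indep_def
  proof (intro allI impI)
    fix a assume a: "\<forall>i\<in>insert h W. a i \<in> pol C" and "(\<Sum>i\<in>insert h W. a i * i) \<in> lsq (pol C) Q"
    then obtain u where u: "u \<in> pol C - Q" "u * (\<Sum>i\<in>insert h W. a i * i) \<in> msq (pol C) Q"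
      unfolding lsq_def by blast
    define A where "A = (\<Sum>v\<in>V. (u * a [:v:]) * [:v:])"
    have aW: "a [:v:] \<in> pol C" if "v \<in> V" for v using a that by (auto simp: W_def)
    have Apq: "A \<in> pol q"
      unfolding A_def using aW u(1) Vq WQ
      by (intro ideal_on_sum[OF prime_onD(1)[OF pq]] prime_onD(6)[OF pq]) (auto simp: W_def intro!: s)
    have "(\<Sum>i\<in>insert h W. a i * i) = a h * h + (\<Sum>v\<in>V. a [:v:] * [:v:])"
      using hW fV unfolding W_def by (subst sum.insert) (simp_all add: sum.reindex[OF inj_const] del: mult_pCons_right)
    then have e: "u * (\<Sum>i\<in>insert h W. a i * i) = (u * a h) * h + A"
      by (simp only: A_def ring_distribs sum_distrib_left mult.assoc)
    obtain j S T R where 1: "S \<in> pol C" "T \<in> pol q" "R \<in> pol (msq C q)"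
        "smult (l ^ j) ((u * a h) * h + A) = S * h * h + T * h + R"
      using msq_expansion[OF C Q h u(2)] unfolding e l_def q_def by blast
    have Rq: "R \<in> pol q" using 1(3) pol_mono[OF msq_props(2)[OF C q]] by blast
    have uah: "u * a h \<in> pol C" using u(1) a s(5) by blast
    have lS: "smult (l ^ j) x \<in> pol C" if "x \<in> pol C" for x
      using smult_mem_pol_subring[OF C _ that] lj by blast
    have lq: "smult (l ^ j) x \<in> pol q" if "x \<in> pol q" for x
      using smult_mem_pol[OF prime_onD(1)[OF q] _ that] lj by blast
    \<comment> \<open>Modulo q[X] only multiples of h survive, and h can be cancelled because q[X]
      is prime; this puts the coefficient of h into Q.\<close>
    have "(smult (l ^ j) (u * a h) - S * h) * h = T * h + R - smult (l ^ j) A"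
      using 1(4) by (simp add: smult_add_right algebra_simps)
    also have "\<dots> \<in> pol q"
      using lq[OF Apq] Rq prime_onD(7)[OF pq hQ(2) 1(2)] prime_onD(5)[OF pq]
      by (intro ideal_on_diff[OF C' prime_onD(1)[OF pq]]) auto
    finally have "smult (l ^ j) (u * a h) - S * h \<in> pol q"
      using prime_onD(8)[OF pq, of "smult (l ^ j) (u * a h) - S * h" h] hq hQ(2) s(6)[OF lS[OF uah] s(5)[OF 1(1) hQ(2)]]
      by blast
    then have "(smult (l ^ j) (u * a h) - S * h) + S * h \<in> Q"
      using pqQ prime_onD(5)[OF Q] prime_onD(6)[OF Q 1(1) hQ(1)] by blast
    then have "([:l ^ j:] * u) * a h \<in> Q" by simp
    moreover have lu: "[:l ^ j:] * u \<in> pol C - Q"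
      by (rule diff_prime_mult[OF C' Q lj' u(1)])
    ultimately have ahQ: "a h \<in> Q"
      using prime_onD(8)[OF Q, of "[:l ^ j:] * u" "a h"] a by blast
    have "A = u * (\<Sum>i\<in>insert h W. a i * i) - (u * a h) * h" using e by simp
    moreover have "(u * a h) * h \<in> msq (pol C) Q"
      using msq_props(3)[OF C' Q, of "u * a h" h] prime_onD(6)[OF Q _ ahQ] u(1) hQ(1) by blast
    ultimately have "A \<in> msq (pol C) Q"
      using ideal_on_diff[OF C' msq_props(1)[OF C' Q] u(2)] by metis
    then obtain k S' T' R' where 2: "S' \<in> pol C" "T' \<in> pol q" "R' \<in> pol (msq C q)"
        "smult (l ^ k) A = S' * h * h + T' * h + R'"
      using msq_expansion[OF C Q h] unfolding l_def q_def by blast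
    \<comment> \<open>With the h-term gone, A itself lies in the square. In its expansion the
      cofactor w of h must lie in q[X], so w is a combination of V up to a denominator.\<close>
    define w where "w = S' * h + T'"
    have R'q: "R' \<in> pol q" using 2(3) pol_mono[OF msq_props(2)[OF C q]] by blast
    have T'C: "T' \<in> pol C" using 2(2) prime_onD(3)[OF pq] by blast
    have wC: "w \<in> pol C" unfolding w_def using 2(1) T'C hQ(2) s(3,5) by blast
    have "w * h = smult (l ^ k) A - R'" using 2(4) by (simp add: w_def algebra_simps)
    also have "\<dots> \<in> pol q"
      using smult_mem_pol[OF prime_onD(1)[OF q] _ Apq] lj R'q
      by (intro ideal_on_diff[OF C' prime_onD(1)[OF pq]]) auto
    finally have "w \<in> pol q" using prime_onD(8)[OF pq _ wC hQ(2)] hq by blast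
    then obtain c where c: "c \<in> C - q" "smult c w \<in> gen (pol C) W" using denom by blast
    then obtain r where r: "\<forall>t\<in>W. r t \<in> pol C" "smult c w = (\<Sum>t\<in>W. r t * t)"
      using gen_finite[OF C' _ WC] fV unfolding W_def by blast
    \<comment> \<open>Moving w * h to the side of A gives a combination of V with value in q^2[X].
      Its coefficients are the \<open>a [:v:]\<close>, up to factors outside Q, minus multiples of
      h.\<close>
    define b where "b v = [:c * l ^ k:] * (u * a [:v:]) - r [:v:] * h" for v
    have rV: "smult c w = (\<Sum>v\<in>V. r [:v:] * [:v:])"
      using r(2) unfolding W_def by (simp add: sum.reindex[OF inj_const] del: mult_pCons_right)
    have rC: "r [:v:] \<in> pol C" if "v \<in> V" for v using r(1) that by (auto simp: W_def)
    have "c * l ^ k \<in> C - q" by (rule diff_prime_mult[OF C q c(1) lj])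
    then have cl: "[:c * l ^ k:] \<in> pol C - Q" unfolding q_def by (rule const_not_mem[OF C])
    have "(\<Sum>v\<in>V. b v * [:v:]) = [:c * l ^ k:] * A - smult c w * h"
      unfolding rV A_def b_def sum_distrib_left sum_distrib_right sum_subtractf[symmetric]
      by (intro sum.cong) (auto simp only: algebra_simps)
    also have "\<dots> = smult c (smult (l ^ k) A - w * h)" by (simp add: smult_diff_right)
    also have "\<dots> = smult c R'" using 2(4) by (simp add: w_def algebra_simps)
    also have "\<dots> \<in> pol (msq C q)"
      using smult_mem_pol[OF msq_props(1)[OF C q] _ 2(3)] c(1) by blast
    finally have sum: "(\<Sum>v\<in>V. b v * [:v:]) \<in> pol (msq C q)" .
    have bC: "b v \<in> pol C" if "v \<in> V" for v
    proof -
      have "[:c * l ^ k:] \<in> pol C" "u \<in> pol C" using cl u(1) by blast+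
      then show ?thesis
        unfolding b_def by (rule s(6)[OF s(5)[OF _ s(5)[OF _ aW[OF that]]] s(5)[OF rC[OF that] hQ(2)]])
    qed
    have "a [:v:] \<in> Q" if v: "v \<in> V" for v
    proof -
      have "b v \<in> pol q" using indep_coeffs[OF C q fV VC iV bC sum v] by blast
      then have "b v + r [:v:] * h \<in> Q"
        using pqQ prime_onD(5)[OF Q] prime_onD(6)[OF Q rC[OF v] hQ(1)] by blast
      then have "([:c * l ^ k:] * u) * a [:v:] \<in> Q" by (simp add: b_def mult.assoc)
      moreover have "[:c * l ^ k:] * u \<in> pol C - Q" by (rule diff_prime_mult[OF C' Q cl u(1)])
      ultimately show ?thesis using prime_onD(8)[OF Q, of "[:c * l ^ k:] * u" "a [:v:]"] aW[OF v] by blast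
    qed
    then show "\<forall>i\<in>insert h W. a i \<in> Q" using ahQ by (auto simp: W_def)
  qed
  ultimately show "lbasis (pol C) Q (insert h ((\<lambda>x. [:x:]) ` V))"
    using fV WQ pqQ hQ(1) unfolding lbasis_def W_def by blast
qed

text \<open>That W keeps the constants from V matters: a uniformizer of P survives in the local
  basis of a prime of B[X,Y] over P.\<close>

lemma lbasis_tower:
  assumes C: "subring_on C" and Q: "prime_on (pol C) Q" and V: "lbasis C (contr Q) V"
  shows "\<exists>W. lbasis (pol C) Q W \<and> card W = card V + of_bool (eps Q) \<and> (\<lambda>x. [:x:]) ` V \<subseteq> W"
proof (cases "eps Q")
  case True
  then obtain h where h: "min_poly_elt Q h" using ex_min_poly_elt[OF C Q] by blast
  have "card (insert h ((\<lambda>x. [:x:]) ` V)) = Suc (card V)"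
    using lbasis_pol_eps(2)[OF C Q V h] V by (simp add: lbasis_def card_image[OF inj_const])
  then show ?thesis
    using lbasis_pol_eps(1)[OF C Q V h] True
    by (intro exI[of _ "insert h ((\<lambda>x. [:x:]) ` V)"] conjI subset_insertI) simp_all
next
  case False
  then show ?thesis using lbasis_pol[OF C Q V]
    by (intro exI[of _ "(\<lambda>x. [:x:]) ` V"]) (simp add: card_image[OF inj_const])
qed

text \<open>Over the residue field of q the fibre is a polynomial ring in one variable, where a
  nonzero prime is maximal. Concretely, if both primes were nonzero there, division between their
  minimal elements h and h' would yield either that Q' lies in Q or that h lies in q[X].\<close>

lemma eps_of_strict:
  assumes C: "subring_on C" and Q: "prime_on (pol C) Q" and Q': "prime_on (pol C) Q'"
    and sub: "Q \<subset> Q'" and eq: "contr Q = contr Q'"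
  shows "eps Q'" "\<not> eps Q"
proof -
  define q where "q = contr Q"
  have C': "subring_on (pol C)" by (rule subring_on_pol[OF C])
  have q: "prime_on C q" unfolding q_def by (rule contr_prime[OF C Q])
  have pq: "prime_on (pol C) (pol q)" by (rule pol_prime[OF C q])
  have pqQ: "pol q \<subseteq> Q" unfolding q_def by (rule pol_contr_subset[OF C prime_onD(1)[OF Q]])
  show e': "eps Q'" using sub pqQ unfolding eps_def eq[symmetric] q_def by blast
  show "\<not> eps Q"
  proof
    assume "eps Q"
    then obtain h where h: "min_poly_elt Q h" using ex_min_poly_elt[OF C Q] by blast
    obtain h' where h': "min_poly_elt Q' h'" using ex_min_poly_elt[OF C Q' e'] by blast
    have hQ: "h \<in> Q" "h \<in> pol C" "lead_coeff h \<in> C" "lead_coeff h \<notin> q"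
      using h prime_onD(3)[OF Q] by (auto simp: min_poly_elt_def pol_def q_def)
    have hQ': "h' \<in> Q'" "h' \<in> pol C" "lead_coeff h' \<in> C" "lead_coeff h' \<notin> q"
      using h' prime_onD(3)[OF Q'] by (auto simp: min_poly_elt_def pol_def q_def eq)
    have hq: "h \<notin> pol q" using hQ(4) by (auto simp: pol_def)
    have hq': "h' \<notin> pol q" using hQ'(4) by (auto simp: pol_def)
    show False
    proof (cases "degree h \<le> degree h'")
      case True
      obtain x where x: "x \<in> Q'" "x \<notin> Q" using sub by blast
      then have xC: "x \<in> pol C" using prime_onD(3)[OF Q'] by blast
      have "\<forall>i\<ge>Suc (degree x) + degree h. Polynomial.coeff x i = 0" by (auto intro: coeff_eq_0)
      from pseudo_division[OF C self_ideal_on[OF C] hQ(2) xC this]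
      obtain j t r where 1: "t \<in> pol C" "r \<in> pol C" "smult (lead_coeff h ^ j) x = t * h + r"
        "\<forall>i\<ge>degree h. Polynomial.coeff r i = 0" by blast
      have "r = smult (lead_coeff h ^ j) x - t * h" using 1(3) by simp
      also have "\<dots> \<in> Q'"
        using smult_mem_ideal[OF C prime_onD(1)[OF Q'] subring_onD(7)[OF C hQ(3)] x(1)]
          prime_onD(6)[OF Q' 1(1)] hQ(1) sub
        by (intro ideal_on_diff[OF C' prime_onD(1)[OF Q']]) auto
      finally have "r \<in> pol q"
        using h' 1(4) True unfolding min_poly_elt_def q_def eq by auto
      then have "t * h + r \<in> Q" using pqQ prime_onD(5)[OF Q] prime_onD(6)[OF Q 1(1) hQ(1)] by blast
      then have "[:lead_coeff h ^ j:] * x \<in> Q" using 1(3) by simp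
      moreover have "[:lead_coeff h ^ j:] \<in> pol C - Q"
        using hQ(3,4) subring_onD(7)[OF C hQ(3)] prime_on_power[OF C q hQ(3,4)] unfolding q_def
        by (intro const_not_mem[OF C]) blast
      ultimately show False using prime_onD(8)[OF Q _ _ xC] x(2) by blast
    next
      case False
      have "h \<in> Q'" using hQ(1) sub by blast
      \<comment> \<open>With n = \<open>degree h\<close> the quotient t has degree below that of h
        as soon as h' is not constant. Being in Q, it then lies in q[X] by the minimality of
        h.\<close>
      from min_poly_elt_division[OF C Q' h' this, of "degree h"]
      obtain j t r where 1: "t \<in> pol C" "r \<in> pol q" "smult (lead_coeff h' ^ j) h = t * h' + r"
        "\<forall>i\<ge>degree h. degree h < degree h + degree h' \<longrightarrow> Polynomial.coeff t i = 0"
        unfolding q_def eq by blast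
      have "t * h' = smult (lead_coeff h' ^ j) h - r" using 1(3) by simp
      also have "\<dots> \<in> Q"
        using smult_mem_ideal[OF C prime_onD(1)[OF Q] subring_onD(7)[OF C hQ'(3)] hQ(1)] 1(2) pqQ
        by (intro ideal_on_diff[OF C' prime_onD(1)[OF Q]]) auto
      finally have "t * h' \<in> Q" .
      have h'Q: "h' \<notin> Q"
      proof
        assume "h' \<in> Q"
        moreover have "\<forall>i\<ge>degree h. Polynomial.coeff h' i = 0" using False by (auto intro: coeff_eq_0)
        ultimately have "h' \<in> pol q" using h unfolding min_poly_elt_def q_def by blast
        then show False using hq' by blast
      qed
      then have "t \<in> Q" using \<open>t * h' \<in> Q\<close> prime_onD(8)[OF Q _ 1(1) hQ'(2)] by blast
      show False
      proof (cases "degree h' = 0")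
        case True
        then obtain c where "h' = [:c:]" by (rule degree_eq_zeroE)
        moreover from this have "c \<in> contr Q'" using hQ'(1) by (simp add: contr_iff)
        then have "c \<in> q" unfolding q_def eq .
        ultimately show False using hQ'(4) by simp
      next
        case h'0: False
        have tq: "t \<in> pol q"
          using h \<open>t \<in> Q\<close> 1(4) h'0 unfolding min_poly_elt_def q_def by auto
        have "t * h' + r \<in> pol q"
          using prime_onD(7)[OF pq hQ'(2) tq] 1(2) prime_onD(5)[OF pq] by blast
        then have "[:lead_coeff h' ^ j:] * h \<in> pol q" using 1(3) by simp
        moreover have "[:lead_coeff h' ^ j:] \<in> pol C"
          using subring_onD(7)[OF C hQ'(3)] subring_onD(1)[OF C] by simp
        ultimately have "[:lead_coeff h' ^ j:] \<in> pol q"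
          using prime_onD(8)[OF pq _ _ hQ(2)] hq by blast
        then have "lead_coeff h' ^ j \<in> q" using prime_onD(4)[OF q] by simp
        then show False using prime_on_power[OF C q hQ'(3,4)] by blast
      qed
    qed
  qed
qed

section \<open>Primes inside the extension of a locally principal prime\<close>

lemma prime_zero:
  fixes C :: "'c::idom set"
  assumes "subring_on C"
  shows "prime_on C {0}"
  using subring_onD[OF assms] by (auto simp: prime_on_def ideal_on_def)

lemma pol_gen_singleton:
  assumes C: "subring_on C" and g: "g \<in> C" and h: "h \<in> pol (gen C {g})"
  shows "\<exists>h'\<in>pol C. h = smult g h'"
  using h
proof (induction h)
  case 0
  then show ?case using subring_onD(1)[OF C] by (intro bexI[of _ 0]) (auto simp: pol_def)
next
  case (pCons c h)
  then have "c \<in> gen C {g}" "h \<in> pol (gen C {g})" by (simp_all add: pCons_mem_pol)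
  then obtain r h' where "r \<in> C" "c = r * g" "h' \<in> pol C" "h = smult g h'"
    using pCons gen_singleton[OF C g] by blast
  then show ?case by (intro bexI[of _ "pCons r h'"]) (auto simp: pCons_mem_pol mult.commute)
qed

text \<open>A Krull intersection argument: an element of \<open>L\<close> could be divided by \<open>g\<close> indefinitely.\<close>

lemma no_infinite_division:
  fixes C :: "'c::idom set"
  assumes C: "subring_on C" "noeth C" and q': "prime_on C q'" and g: "g \<in> q'"
    and L: "L \<subseteq> C - {0}" "\<And>l. l \<in> L \<Longrightarrow> \<exists>u\<in>C - q'. \<exists>l'\<in>L. u * l = g * l'"
  shows "L = {}"
proof (rule ccontr)
  assume "L \<noteq> {}"
  \<comment> \<open>Elements that become multiples of l in the localization at q'. Dividing l by g
    enlarges this ideal, so a maximal one must be reached.\<close>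
  define J where "J l = {x \<in> C. \<exists>u\<in>C - q'. u * x \<in> gen C {l}}" for l
  have gC: "g \<in> C" using g(1) prime_onD(3)[OF q'(1)] by blast
  have LC: "L \<subseteq> C" using L(1) by blast
  have J: "ideal_on C (J l)" if l: "l \<in> C" for l
  proof -
    have I: "ideal_on C (gen C {l})" using l by (intro gen_ideal[OF C(1)]) simp
    show ?thesis
      using local_colon_ideal[OF C(1) q' I subring_onD(2)[OF C(1)]] by (simp add: J_def)
  qed
  have "J ` L \<noteq> {}" using \<open>L \<noteq> {}\<close> by simp
  moreover have "\<And>I. I \<in> J ` L \<Longrightarrow> ideal_on C I" using J LC by blast
  ultimately have "\<exists>M\<in>J ` L. \<forall>Z\<in>J ` L. M \<subseteq> Z \<longrightarrow> Z = M" by (rule noeth_maximal[OF C])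
  then obtain l where l: "l \<in> L" "\<forall>l'\<in>L. J l \<subseteq> J l' \<longrightarrow> J l' = J l" by blast
  obtain u l' where u: "u \<in> C - q'" and l'L: "l' \<in> L" and ul: "u * l = g * l'"
    using L(2)[OF l(1)] by blast
  have l'C: "l' \<in> C" and lC: "l \<in> C" and "l' \<noteq> 0" using l'L l(1) L(1) by blast+
  have "J l \<subseteq> J l'"
  proof
    fix x assume "x \<in> J l"
    then obtain v r where v: "x \<in> C" "v \<in> C - q'" "v * x = r * l" "r \<in> C"
      using gen_singleton[OF C(1) lC] by (auto simp: J_def)
    have "(u * v) * x = (r * g) * l'" using v(3) ul by (metis mult.assoc mult.commute)
    moreover have "r * g \<in> C" using v(4) gC subring_onD(5)[OF C(1)] by blast
    ultimately have "(u * v) * x \<in> gen C {l'}" using gen_singleton[OF C(1) l'C] by blast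
    then show "x \<in> J l'" using v(1) diff_prime_mult[OF C(1) q'(1) u v(2)] unfolding J_def by blast
  qed
  then have "J l' = J l" using l(2) l'L by blast
  moreover have "l' \<in> J l'"
    using l'C diff_prime_one[OF C(1) q'(1)] gen_superset[of "{l'}" C] by (auto simp: J_def intro!: bexI[of _ 1])
  ultimately obtain v r where v: "v \<in> C - q'" "v * l' = r * l" "r \<in> C"
    using gen_singleton[OF C(1) lC] by (auto simp: J_def)
  \<comment> \<open>At a maximal \<open>J l\<close> the quotient l' is locally a multiple of l,
    hence of g * l'; cancelling l' puts a product of elements outside q' into q'.\<close>
  have "(u * v) * l' = (r * g) * l'" using v(2) ul by (metis mult.assoc mult.commute)
  then have "u * v = r * g" using \<open>l' \<noteq> 0\<close> by simp
  moreover have "r * g \<in> q'" using prime_onD(6)[OF q'(1) v(3) g(1)] .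
  ultimately show False using diff_prime_mult[OF C(1) q'(1) u v(1)] by simp
qed

text \<open>Up to a denominator, each h in Q is g times some h', because its coefficients lie in q'.
  As g is a nonzero constant and Q contracts to 0, h' is again in Q. The leading coefficients are
  thus divisible by g indefinitely.\<close>

lemma contr_zero_below_principal:
  fixes C :: "'c::idom set"
  assumes C: "subring_on C" "noeth C" and Q: "prime_on (pol C) Q" "contr Q = {0}"
    and q': "prime_on C q'" "Q \<subseteq> pol q'" and g: "g \<in> q'" "g \<noteq> 0" "lgen C q' {g}"
  shows "Q = {0}"
proof -
  define L where "L = {l. \<exists>h\<in>Q. h \<noteq> 0 \<and> l = lead_coeff h}"
  have gC: "g \<in> C" using g(1) prime_onD(3)[OF q'(1)] by blast
  have "L \<subseteq> C - {0}" using prime_onD(3)[OF Q(1)] by (auto simp: L_def pol_def)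
  moreover have "\<exists>u\<in>C - q'. \<exists>l'\<in>L. u * l = g * l'" if l: "l \<in> L" for l
  proof -
    obtain h where h: "h \<in> Q" "h \<noteq> 0" "l = lead_coeff h" using l by (auto simp: L_def)
    have "\<And>c. c \<in> q' \<Longrightarrow> \<exists>u\<in>C - q'. u * c \<in> gen C {g}" using g(3) by (simp add: lgen_def)
    moreover have "ideal_on C (gen C {g})" using gC by (intro gen_ideal[OF C(1)]) simp
    ultimately obtain u where u: "u \<in> C - q'" "smult u h \<in> pol (gen C {g})"
      using pol_common_denom[OF C(1) q'(1) _ prime_onD(3)[OF q'(1)] prime_onD(4)[OF q'(1)]] h(1) q'(2) by blast
    then obtain h' where h': "h' \<in> pol C" "smult u h = smult g h'" using pol_gen_singleton[OF C(1) gC] by blast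
    have "[:g:] * h' \<in> Q"
      using smult_mem_ideal[OF C(1) prime_onD(1)[OF Q(1)] _ h(1), of u] u(1) h'(2) by simp
    moreover have "[:g:] \<in> pol C - Q" using Q(2) g(2) gC by (intro const_not_mem[OF C(1)]) auto
    ultimately have h'Q: "h' \<in> Q" using prime_onD(8)[OF Q(1) _ _ h'(1)] by blast
    have "u \<noteq> 0" using u(1) prime_onD(4)[OF q'(1)] by blast
    then have "h' \<noteq> 0" using h'(2) h(2) by auto
    have "lead_coeff h' \<in> L" using h'Q \<open>h' \<noteq> 0\<close> by (auto simp: L_def)
    moreover have "u * l = g * lead_coeff h'"
      using arg_cong[OF h'(2), of lead_coeff] g(2) \<open>u \<noteq> 0\<close> by (simp add: h(3))
    ultimately show ?thesis using u(1) by blast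
  qed
  ultimately have "L = {}" by (rule no_infinite_division[OF C q'(1) g(1)])
  then show ?thesis using prime_onD(4)[OF Q(1)] by (auto simp: L_def)
qed

section \<open>Rings of integers of number fields\<close>

lemma number_fieldD:
  fixes K :: "'k::field_char_0 set"
  assumes "number_field K"
  shows "subring_on K" "x \<in> K \<Longrightarrow> y \<in> K \<Longrightarrow> x / y \<in> K"
proof -
  interpret F: field "ring_of_type_algebra :: 'k ring" by (rule field_from_type_algebra)
  have K: "subfield K (ring_of_type_algebra :: 'k ring)" using assms by (simp add: number_field_def)
  note s = subringE[OF subfieldE(1)[OF K]]
  have minus: "- x \<in> K" if "x \<in> K" for x
  proof -
    have "\<ominus>\<^bsub>ring_of_type_algebra\<^esub> x = - x" by (rule F.minus_equality) auto
    then show ?thesis using s(5)[OF that] by simp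
  qed
  then show "subring_on K" using s by (auto simp: subring_on_def)
  have "inverse y \<in> K" if "y \<in> K" for y
  proof (cases "y = 0")
    case False
    then have "inv\<^bsub>ring_of_type_algebra\<^esub> y = inverse y" by (intro F.comm_inv_char) auto
    then show ?thesis using F.subfield_m_inv(1)[OF K, of y] False that by auto
  qed (use s(2) in auto)
  then show "x \<in> K \<Longrightarrow> y \<in> K \<Longrightarrow> x / y \<in> K" using s(6)[of x "inverse y"] by (simp add: divide_inverse)
qed

section \<open>Linear relations with integer coefficients in a number field\<close>

text \<open>\<open>combine\<close> stops at the shorter list, so only the first
  \<open>length Us\<close> scalars count; the last clause lets a nonzero one among them reappear as
  a value of c.\<close>

lemma combine_eq_sum:
  fixes Us Ks :: "'k::field list"
  assumes "distinct Us" "set Ks \<subseteq> S" "0 \<in> S"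
  shows "\<exists>c. (\<forall>u. c u \<in> S) \<and> ring.combine ring_of_type_algebra Ks Us = (\<Sum>u\<in>set Us. c u * u) \<and>
     set (take (length Us) Ks) \<subseteq> c ` set Us"
  using assms
proof (induction Us arbitrary: Ks)
  case Nil
  interpret F: field "ring_of_type_algebra :: 'k ring" by (rule field_from_type_algebra)
  show ?case using Nil by (intro exI[of _ "\<lambda>_. 0"]) auto
next
  case (Cons u Us)
  interpret F: field "ring_of_type_algebra :: 'k ring" by (rule field_from_type_algebra)
  show ?case
  proof (cases Ks)
    case Nil
    then show ?thesis using Cons.prems by (intro exI[of _ "\<lambda>_. 0"]) auto
  next
    case (Cons k Ks')
    then have kS: "k \<in> S" "set Ks' \<subseteq> S" using Cons.prems by auto
    obtain c where c: "\<forall>u. c u \<in> S" "F.combine Ks' Us = (\<Sum>u\<in>set Us. c u * u)"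
      "set (take (length Us) Ks') \<subseteq> c ` set Us"
      using Cons.IH[of Ks'] Cons.prems kS by auto
    define c' where "c' = c(u := k)"
    have e: "(\<Sum>v\<in>set Us. c' v * v) = (\<Sum>v\<in>set Us. c v * v)" "c' ` set Us = c ` set Us"
      using Cons.prems(1) by (auto simp: c'_def intro!: sum.cong)
    have "F.combine Ks (u # Us) = (\<Sum>v\<in>set (u # Us). c' v * v)"
      using Cons.prems(1) c(2) e(1) by (simp add: Cons c'_def)
    moreover have "set (take (length (u # Us)) Ks) \<subseteq> c' ` set (u # Us)"
      using c(3) e(2) by (auto simp: Cons c'_def)
    moreover have "\<forall>u. c' u \<in> S" using c(1) kS by (auto simp: c'_def)
    ultimately show ?thesis by blast
  qed
qed

lemma common_denominator:
  fixes c :: "'a \<Rightarrow> 'k::field_char_0"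
  assumes "finite U" "\<forall>u\<in>U. c u \<in> \<rat>"
  shows "\<exists>D::int. D > 0 \<and> (\<forall>u\<in>U. of_int D * c u \<in> \<int>)"
  using assms
proof (induction U)
  case empty
  show ?case by (intro exI[of _ 1]) auto
next
  case (insert u U)
  then obtain D :: int where D: "D > 0" "\<forall>u\<in>U. of_int D * c u \<in> \<int>" by auto
  obtain a b :: int where ab: "b > 0" "c u = of_int a / of_int b"
  proof -
    have "c u \<in> \<rat>" using insert.prems by simp
    then show ?thesis by (rule Rats_cases') (rule that)
  qed
  have "of_int (D * b) * c v \<in> \<int>" if "v \<in> insert u U" for v
  proof (cases "v = u")
    case True
    have "of_int (D * b) * c u = of_int (D * a)" using ab by simp
    then show ?thesis using True by (metis Ints_of_int)
  next
    case False
    then have "of_int D * c v \<in> \<int>" using D(2) that by blast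
    then have "of_int b * (of_int D * c v) \<in> \<int>" by (rule Ints_mult[OF Ints_of_int])
    then show ?thesis by (simp add: algebra_simps)
  qed
  then show ?case using D ab by (intro exI[of _ "D * b"]) auto
qed

text \<open>More elements than the dimension of K are linearly dependent over the rationals, and a
  common denominator makes the coefficients integers.\<close>

lemma number_field_relation:
  fixes K :: "'k::field_char_0 set"
  assumes "number_field K"
  shows "\<exists>n. \<forall>U. finite U \<longrightarrow> U \<subseteq> K \<longrightarrow> card U > n \<longrightarrow>
    (\<exists>c::'k \<Rightarrow> int. (\<exists>u\<in>U. c u \<noteq> 0) \<and> (\<Sum>u\<in>U. of_int (c u) * u) = 0)"
proof -
  interpret F: field "ring_of_type_algebra :: 'k ring" by (rule field_from_type_algebra)
  have "subring \<rat> (ring_of_type_algebra :: 'k ring)"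
  proof (rule F.subringI)
    show "\<ominus>\<^bsub>ring_of_type_algebra\<^esub> h \<in> \<rat>" if "h \<in> \<rat>" for h :: 'k
    proof -
      have "\<ominus>\<^bsub>ring_of_type_algebra\<^esub> h = - h" by (rule F.minus_equality) auto
      then show ?thesis using that by simp
    qed
  qed auto
  then have Q: "subfield \<rat> (ring_of_type_algebra :: 'k ring)"
  proof (rule F.subfieldI')
    show "inv\<^bsub>ring_of_type_algebra\<^esub> k \<in> \<rat>" if "k \<in> \<rat> - {\<zero>\<^bsub>ring_of_type_algebra\<^esub>}" for k :: 'k
    proof -
      have "inv\<^bsub>ring_of_type_algebra\<^esub> k = inverse k" using that by (intro F.comm_inv_char) auto
      then show ?thesis using that by simp
    qed
  qed
  obtain n where n: "F.dimension n \<rat> K"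
    using assms by (auto simp: number_field_def F.finite_dimension_def)
  have "\<exists>c::'k \<Rightarrow> int. (\<exists>u\<in>U. c u \<noteq> 0) \<and> (\<Sum>u\<in>U. of_int (c u) * u) = 0"
    if U: "finite U" "U \<subseteq> K" "card U > n" for U
  proof -
    obtain Us where Us: "set Us = U" "distinct Us" using finite_distinct_list[OF U(1)] by blast
    then have "length Us > n" using U(3) distinct_card by metis
    then have "\<not> F.independent \<rat> Us"
      using F.independent_length_le_dimension[OF Q n, of Us] U(2) Us(1) by auto
    then obtain Ks where Ks: "set Ks \<subseteq> \<rat>" "F.combine Ks Us = 0" "\<not> set (take (length Us) Ks) \<subseteq> {0}"
      using F.trivial_combine_imp_independent[OF Q, of Us] by auto
    obtain c where c: "\<forall>u. c u \<in> \<rat>" "0 = (\<Sum>u\<in>U. c u * u)" "set (take (length Us) Ks) \<subseteq> c ` U"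
      using combine_eq_sum[OF Us(2) Ks(1)] Ks(2) unfolding Us(1) by auto
    obtain u where u: "u \<in> U" "c u \<noteq> 0" using Ks(3) c(3) by auto
    obtain D :: int where D: "D > 0" "\<forall>u\<in>U. of_int D * c u \<in> \<int>"
      using common_denominator[OF U(1), of c] c(1) by blast
    have "\<forall>u\<in>U. \<exists>z::int. of_int D * c u = of_int z" using D(2) by (auto elim: Ints_cases)
    from bchoice[OF this] obtain z :: "'k \<Rightarrow> int" where z: "\<And>u. u \<in> U \<Longrightarrow> of_int D * c u = of_int (z u)"
      by blast
    have "(\<Sum>u\<in>U. of_int (z u) * u) = of_int D * (\<Sum>u\<in>U. c u * u)"
      unfolding sum_distrib_left by (intro sum.cong) (auto simp: z[symmetric] mult.assoc)
    then have "(\<Sum>u\<in>U. of_int (z u) * u) = 0" using c(2) by simp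
    moreover have "z u \<noteq> 0" using z[OF u(1)] u(2) D(1) by auto
    ultimately show ?thesis using u(1) by blast
  qed
  then show ?thesis by blast
qed

text \<open>While p divides all coefficients, dividing by p keeps the relation and lowers the sum of
  the absolute values.\<close>

lemma primitive_relation:
  fixes c :: "'k::field_char_0 \<Rightarrow> int"
  assumes "normalization_semidom_class.prime (p::nat)" "finite U" "\<exists>u\<in>U. c u \<noteq> 0" "(\<Sum>u\<in>U. of_int (c u) * u) = 0"
  shows "\<exists>c::'k \<Rightarrow> int. (\<exists>u\<in>U. \<not> int p dvd c u) \<and> (\<Sum>u\<in>U. of_int (c u) * u) = 0"
  using assms(3,4)
proof (induction "\<Sum>u\<in>U. nat \<bar>c u\<bar>" arbitrary: c rule: less_induct)
  case less
  show ?case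
  proof (cases "\<exists>u\<in>U. \<not> int p dvd c u")
    case True
    then show ?thesis using less.prems by blast
  next
    case False
    then have "\<forall>u\<in>U. \<exists>k. c u = int p * k" by (auto elim: dvdE)
    then obtain k where k: "\<And>u. u \<in> U \<Longrightarrow> c u = int p * k u" by metis
    have p: "p > 1" using assms(1) prime_gt_1_nat by blast
    have "of_nat p * (\<Sum>u\<in>U. of_int (k u) * u) = (\<Sum>u\<in>U. of_int (c u) * u)"
      unfolding sum_distrib_left by (intro sum.cong) (auto simp: k mult.assoc)
    then have 0: "(\<Sum>u\<in>U. of_int (k u) * u) = 0" using less.prems(2) p by simp
    have nz: "\<exists>u\<in>U. k u \<noteq> 0" using less.prems(1) k by auto
    have "(\<Sum>u\<in>U. nat \<bar>k u\<bar>) < (\<Sum>u\<in>U. nat \<bar>c u\<bar>)"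
    proof (rule sum_strict_mono_ex1[OF assms(2)])
      have e: "nat \<bar>c u\<bar> = p * nat \<bar>k u\<bar>" if "u \<in> U" for u
        using k[OF that] by (simp add: abs_mult nat_mult_distrib)
      show "\<forall>u\<in>U. nat \<bar>k u\<bar> \<le> nat \<bar>c u\<bar>" using e p by auto
      show "\<exists>u\<in>U. nat \<bar>k u\<bar> < nat \<bar>c u\<bar>" using e p nz by force
    qed
    then show ?thesis using less.hyps[of k] nz 0 by blast
  qed
qed

section \<open>The ring B: finite quotients, Noetherianity, dimension one, invertible primes\<close>

locale algebraic_integers =
  fixes K B :: "'k::field_char_0 set"
  assumes number_field: "number_field K" and B_def: "B = {x \<in> K. algebraic_int x}"
begin

lemma subring_on_B: "subring_on B"
  using number_fieldD(1)[OF number_field]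
  unfolding subring_on_def B_def by (auto intro: algebraic_int_add algebraic_int_mult)

text \<open>The dimension of B/pB over the field with p elements is at most that of K, since a
  primitive relation between lifts reduces to a nontrivial relation modulo p. The combinations of a
  maximal independent set with coefficients 0, ..., p-1 represent all classes.\<close>

lemma residues_mod_prime:
  assumes p: "normalization_semidom_class.prime (p::nat)"
  shows "\<exists>T. finite T \<and> T \<subseteq> B \<and> (\<forall>x\<in>B. \<exists>t\<in>T. \<exists>y\<in>B. x = t + of_nat p * y)"
proof -
  note s = subring_onD[OF subring_on_B] subring_on_of_int[OF subring_on_B] subring_on_of_nat[OF subring_on_B]
  obtain n where n: "\<And>U. finite U \<Longrightarrow> U \<subseteq> K \<Longrightarrow> card U > n \<Longrightarrow>
    (\<exists>c::'k \<Rightarrow> int. (\<exists>u\<in>U. c u \<noteq> 0) \<and> (\<Sum>u\<in>U. of_int (c u) * u) = 0)"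
    using number_field_relation[OF number_field] by blast
  \<comment> \<open>Says that the residues of U are linearly independent in B/pB over the field with
    p elements.\<close>
  define PI where "PI U \<longleftrightarrow> finite U \<and> U \<subseteq> B \<and>
    (\<forall>c::'k \<Rightarrow> int. \<forall>y\<in>B. (\<Sum>u\<in>U. of_int (c u) * u) = of_nat p * y \<longrightarrow> (\<forall>u\<in>U. int p dvd c u))" for U
  have bound: "card U \<le> n" if "PI U" for U
  proof (rule ccontr)
    assume c: "\<not> card U \<le> n"
    have U: "finite U" "U \<subseteq> K" using that by (auto simp: PI_def B_def)
    then have "\<exists>c::'k \<Rightarrow> int. (\<exists>u\<in>U. c u \<noteq> 0) \<and> (\<Sum>u\<in>U. of_int (c u) * u) = 0"
      using n c by simp
    then obtain c :: "'k \<Rightarrow> int" where "\<exists>u\<in>U. \<not> int p dvd c u" "(\<Sum>u\<in>U. of_int (c u) * u) = 0"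
      using primitive_relation[OF p U(1)] by blast
    then show False using that s(1) unfolding PI_def by (auto dest: spec[of _ c] bspec[of _ _ 0])
  qed
  have "PI {}" by (simp add: PI_def)
  then have "\<exists>U. PI U \<and> (\<forall>U'. PI U' \<longrightarrow> card U' \<le> card U)"
    by (rule ex_has_greatest_nat[where b = "Suc n"]) (use bound in \<open>simp add: less_Suc_eq_le\<close>)
  then obtain U where U: "PI U" "\<And>U'. PI U' \<Longrightarrow> card U' \<le> card U" by blast
  have fU: "finite U" and UB: "U \<subseteq> B" using U(1) by (auto simp: PI_def)
  define R where "R = PiE U (\<lambda>_. {0..<int p})"
  define T where "T = (\<lambda>c. \<Sum>u\<in>U. of_int (c u) * u) ` R"
  have sumB: "(\<Sum>u\<in>U. of_int (c u) * u) \<in> B" for c :: "'k \<Rightarrow> int"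
    using UB by (intro subring_on_sum[OF subring_on_B] s) auto
  have "finite T" unfolding T_def R_def using fU by (intro finite_imageI finite_PiE) auto
  moreover have "T \<subseteq> B" using sumB by (auto simp: T_def)
  moreover have "\<exists>t\<in>T. \<exists>y\<in>B. x = t + of_nat p * y" if x: "x \<in> B" for x
  proof -
    have "\<exists>c::'k \<Rightarrow> int. \<exists>y\<in>B. x = (\<Sum>u\<in>U. of_int (c u) * u) + of_nat p * y"
    proof (cases "x \<in> U")
      case True
      have "(\<Sum>u\<in>U. of_int (if u = x then 1 else 0) * u) = (\<Sum>u\<in>U. if u = x then x else 0)"
        by (intro sum.cong) auto
      then have "x = (\<Sum>u\<in>U. of_int (if u = x then 1 else 0) * u) + of_nat p * 0"
        using True fU by simp
      then show ?thesis using s(1) by (intro exI[of _ "\<lambda>u. if u = x then 1 else 0"] bexI[of _ 0])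
    next
      case False
      then have "\<not> PI (insert x U)" using U(2)[of "insert x U"] fU by auto
      then obtain c :: "'k \<Rightarrow> int" and y where c: "y \<in> B" "\<exists>u\<in>insert x U. \<not> int p dvd c u"
        "(\<Sum>u\<in>insert x U. of_int (c u) * u) = of_nat p * y"
        using x UB fU unfolding PI_def by auto
      have e: "of_int (c x) * x = of_nat p * y - (\<Sum>u\<in>U. of_int (c u) * u)"
        using c(3) False fU by (simp add: algebra_simps)
      have "\<not> int p dvd c x"
      proof
        assume "int p dvd c x"
        then obtain k where k: "c x = int p * k" by (elim dvdE)
        have "(\<Sum>u\<in>U. of_int (c u) * u) = of_nat p * (y - of_int k * x)"
          using e k by (simp add: algebra_simps)
        moreover have "y - of_int k * x \<in> B"
          by (intro s(6) s(5) c(1) x subring_on_of_int[OF subring_on_B])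
        ultimately have "\<forall>u\<in>U. int p dvd c u"
          using U(1)[unfolded PI_def, THEN conjunct2, THEN conjunct2, rule_format, of "y - of_int k * x" c] by blast
        then show False using c(2) \<open>int p dvd c x\<close> by auto
      qed
      \<comment> \<open>The coefficient of x is invertible modulo p, so the relation can be solved
        for x.\<close>
      then have "coprime (int p) (c x)" using p by (simp add: prime_imp_coprime)
      then obtain a b where ab: "a * int p + b * c x = 1" by (metis bezout_int coprime_imp_gcd_eq_1)
      have "x = of_int (a * int p + b * c x) * x" by (simp add: ab)
      also have "\<dots> = of_nat p * (of_int a * x) + of_int b * (of_int (c x) * x)"
        by (simp add: algebra_simps)
      also have "\<dots> = (\<Sum>u\<in>U. of_int (- b * c u) * u) + of_nat p * (of_int a * x + of_int b * y)"
        unfolding e by (simp add: algebra_simps sum_distrib_left sum_negf)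
      finally show ?thesis
        by (intro exI[of _ "\<lambda>u. - b * c u"] bexI[of _ "of_int a * x + of_int b * y"])
          (auto intro!: s(3) s(5) c(1) x subring_on_of_int[OF subring_on_B])
    qed
    then obtain c :: "'k \<Rightarrow> int" and y where c: "y \<in> B" "x = (\<Sum>u\<in>U. of_int (c u) * u) + of_nat p * y" by blast
    have pp: "int p > 0" using p prime_gt_0_nat by simp
    define c' where "c' = restrict (\<lambda>u. c u mod int p) U"
    have "c' \<in> R" using pp by (auto simp: c'_def R_def)
    have "(\<Sum>u\<in>U. of_int (c u) * u) = (\<Sum>u\<in>U. of_int (c' u) * u + of_nat p * (of_int (c u div int p) * u))"
    proof (intro sum.cong refl)
      fix u assume "u \<in> U"
      have "of_int (c u) = (of_int (c u mod int p + int p * (c u div int p)) :: 'k)" by simp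
      then have "of_int (c u) = of_int (c u mod int p) + (of_nat p * of_int (c u div int p) :: 'k)"
        unfolding of_int_add of_int_mult by simp
      then show "of_int (c u) * u = of_int (c' u) * u + of_nat p * (of_int (c u div int p) * u)"
        using \<open>u \<in> U\<close> by (simp add: c'_def algebra_simps)
    qed
    then have "x = (\<Sum>u\<in>U. of_int (c' u) * u) + of_nat p * ((\<Sum>u\<in>U. of_int (c u div int p) * u) + y)"
      using c(2) by (simp add: sum.distrib sum_distrib_left algebra_simps)
    moreover have "(\<Sum>u\<in>U. of_int (c' u) * u) \<in> T" using \<open>c' \<in> R\<close> by (auto simp: T_def)
    moreover have "(\<Sum>u\<in>U. of_int (c u div int p) * u) + y \<in> B" by (rule s(3)[OF sumB c(1)])
    ultimately show ?thesis by blast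
  qed
  ultimately show ?thesis by blast
qed

text \<open>Expansion along the prime factors of m, with one digit from a finite set of
  representatives for each factor.\<close>

lemma residues:
  assumes "m \<noteq> 0"
  shows "\<exists>T. finite T \<and> T \<subseteq> B \<and> (\<forall>x\<in>B. \<exists>t\<in>T. \<exists>y\<in>B. x = t + of_nat m * y)"
  using assms
proof (induction m rule: prime_divisors_induct)
  case (unit m)
  then have "m = 1" by simp
  then show ?case using subring_onD(1)[OF subring_on_B] by (intro exI[of _ "{0}"]) auto
next
  case (factor p m)
  note s = subring_onD[OF subring_on_B]
  obtain T where T: "finite T" "T \<subseteq> B" "\<forall>x\<in>B. \<exists>t\<in>T. \<exists>y\<in>B. x = t + of_nat m * y"
    using factor by auto
  obtain S where S: "finite S" "S \<subseteq> B" "\<forall>x\<in>B. \<exists>t\<in>S. \<exists>y\<in>B. x = t + of_nat p * y"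
    using residues_mod_prime[OF factor(1)] by blast
  define W where "W = (\<lambda>(t, u). t + of_nat p * u) ` (S \<times> T)"
  have "\<exists>w\<in>W. \<exists>y\<in>B. x = w + of_nat (p * m) * y" if x: "x \<in> B" for x
  proof -
    obtain t y where 1: "t \<in> S" "y \<in> B" "x = t + of_nat p * y" using S(3) x by blast
    obtain u z where 2: "u \<in> T" "z \<in> B" "y = u + of_nat m * z" using T(3) 1(2) by blast
    have "x = (t + of_nat p * u) + of_nat (p * m) * z" using 1(3) 2(3) by (simp add: algebra_simps)
    then show ?thesis using 1(1) 2(1,2) by (intro bexI[of _ "t + of_nat p * u"] bexI[of _ z]) (auto simp: W_def)
  qed
  moreover have "finite W" using S(1) T(1) by (simp add: W_def)
  moreover have "t + of_nat p * u \<in> B" if "t \<in> S" "u \<in> T" for t u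
    using that S(2) T(2) s(3,5) subring_on_of_nat[OF subring_on_B] by blast
  then have "W \<subseteq> B" by (auto simp: W_def)
  ultimately show ?case by blast
qed simp

text \<open>Take the constant term of an integer polynomial of least degree vanishing at x: it is a
  multiple of x in B, and it is nonzero since otherwise a factor X could be removed.\<close>

lemma ideal_contains_nat:
  assumes I: "ideal_on B I" and "x \<in> I" "x \<noteq> 0"
  shows "\<exists>m::nat. m \<noteq> 0 \<and> of_nat m \<in> I"
proof -
  have xB: "x \<in> B" using ideal_onD(1)[OF I] assms(2) by blast
  note s = subring_onD[OF subring_on_B]
  have "algebraic_int x" using xB by (simp add: B_def)
  then obtain p0 :: "int poly" where p0: "poly (map_poly of_int p0) x = 0" "lead_coeff p0 = 1"
    unfolding algebraic_int_altdef_ipoly by blast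
  then have "p0 \<noteq> 0 \<and> poly (map_poly of_int p0) x = 0" by auto
  from ex_has_least_nat[of "\<lambda>p::int poly. p \<noteq> 0 \<and> poly (map_poly of_int p) x = 0", OF this, of degree]
  obtain p :: "int poly" where p: "p \<noteq> 0" "poly (map_poly of_int p) x = 0"
    "\<And>q. q \<noteq> 0 \<Longrightarrow> poly (map_poly of_int q) x = 0 \<Longrightarrow> degree p \<le> degree q"
    by blast
  obtain c q where cq: "p = pCons c q" by (cases p)
  have e: "of_int c + x * poly (map_poly of_int q) x = 0" using p(2) by (simp add: cq Polynomial.map_poly_pCons)
  have "c \<noteq> 0"
  proof
    assume "c = 0"
    then have "poly (map_poly of_int q) x = 0" "q \<noteq> 0" using e assms(3) p(1) cq by auto
    then show False using p(3)[of q] cq by auto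
  qed
  have "poly (map_poly of_int q) x \<in> B"
    unfolding poly_altdef using xB
    by (intro subring_on_sum[OF subring_on_B] s) (auto intro: subring_on_of_int[OF subring_on_B])
  then have "of_int c \<in> I"
    using e ideal_onD(5)[OF I _ assms(2)] ideal_on_minus[OF subring_on_B I]
    by (metis add.commute add_eq_0_iff)
  then have "of_nat (nat \<bar>c\<bar>) \<in> I"
    using ideal_on_minus[OF subring_on_B I, of "of_int c"] by (cases "c \<ge> 0") auto
  then show ?thesis using \<open>c \<noteq> 0\<close> by (intro exI[of _ "nat \<bar>c\<bar>"]) auto
qed

text \<open>A nonzero I contains some natural number m > 0. As B/mB is finite, I is generated by m
  and those of finitely many representatives that lie in I.\<close>

lemma noeth_B: "noeth B"
  unfolding noeth_def
proof (intro allI impI)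
  fix I assume I: "ideal_on B I"
  note s = subring_onD[OF subring_on_B]
  have IB: "I \<subseteq> B" by (rule ideal_onD(1)[OF I])
  show "\<exists>T. finite T \<and> T \<subseteq> I \<and> I = gen B T"
  proof (cases "I = {0}")
    case True
    then show ?thesis using gen_singleton[OF subring_on_B s(1)] s(1) by (intro exI[of _ "{0}"]) auto
  next
    case False
    then obtain x where "x \<in> I" "x \<noteq> 0" using ideal_onD(2)[OF I] by blast
    then obtain m :: nat where m: "m \<noteq> 0" "of_nat m \<in> I" using ideal_contains_nat[OF I] by blast
    obtain T where T: "finite T" "T \<subseteq> B" "\<forall>x\<in>B. \<exists>t\<in>T. \<exists>y\<in>B. x = t + of_nat m * y"
      using residues[OF m(1)] by blast
    define S where "S = insert (of_nat m) (T \<inter> I)"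
    have S: "finite S" "S \<subseteq> I" using T m by (auto simp: S_def)
    have G: "ideal_on B (gen B S)" using S IB by (intro gen_ideal[OF subring_on_B]) auto
    have "I \<subseteq> gen B S"
    proof
      fix x assume x: "x \<in> I"
      then obtain t y where ty: "t \<in> T" "y \<in> B" "x = t + of_nat m * y" using T(3) IB by blast
      have my: "of_nat m * y \<in> I" using ideal_onD(5)[OF I ty(2) m(2)] .
      have "t \<in> I" using ideal_on_diff[OF subring_on_B I x my] ty(3) by simp
      then have "t \<in> gen B S" "of_nat m \<in> gen B S"
        using gen_superset[of S B] ty(1) by (auto simp: S_def)
      then show "x \<in> gen B S" using ty(2,3) ideal_onD(3,5)[OF G] by simp
    qed
    then show ?thesis using S gen_minimal[OF I S(2)] by blast
  qed
qed

text \<open>B/P is finite, so two powers of x agree modulo P. For x outside P this puts some x^k - 1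
  with k > 0 into P, and then x cannot lie in a prime containing P.\<close>

lemma prime_maximal:
  assumes P: "prime_on B P" "P \<noteq> {0}" and J: "prime_on B J" "P \<subseteq> J"
  shows "J = P"
proof (rule ccontr)
  assume "J \<noteq> P"
  then obtain x where x: "x \<in> J" "x \<notin> P" using J(2) by blast
  have xB: "x \<in> B" using prime_onD(3)[OF J(1)] x(1) by blast
  note s = subring_onD[OF subring_on_B]
  obtain y where "y \<in> P" "y \<noteq> 0" using P prime_onD(4)[OF P(1)] by blast
  then obtain m :: nat where m: "m \<noteq> 0" "of_nat m \<in> P"
    using ideal_contains_nat[OF prime_onD(1)[OF P(1)]] by blast
  obtain T where T: "finite T" "T \<subseteq> B" "\<forall>x\<in>B. \<exists>t\<in>T. \<exists>y\<in>B. x = t + of_nat m * y"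
    using residues[OF m(1)] by blast
  have "\<forall>i. \<exists>t\<in>T. \<exists>y\<in>B. x ^ i = t + of_nat m * y" using T(3) s(7)[OF xB] by blast
  then obtain t z where t: "\<And>i. t i \<in> T" "\<And>i. z i \<in> B" "\<And>i. x ^ i = t i + of_nat m * z i" by metis
  have "\<not> inj (t :: nat \<Rightarrow> 'k)" using T(1) t(1) finite_subset[of "range t" T] by (auto dest: finite_imageD)
  then obtain i j where ij: "i < j" "t i = t j" unfolding inj_def by (metis linorder_neqE_nat)
  have "x ^ j - x ^ i = of_nat m * (z j - z i)" using t(3)[of i] t(3)[of j] ij(2) by (simp add: algebra_simps)
  also have "\<dots> \<in> P" using prime_onD(7)[OF P(1) s(6)[OF t(2) t(2)] m(2)] .
  finally have "x ^ j - x ^ i \<in> P" .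
  moreover have "x ^ j - x ^ i = x ^ i * (x ^ (j - i) - 1)"
    using ij(1) by (simp add: right_diff_distrib power_add[symmetric])
  ultimately have "x ^ i * (x ^ (j - i) - 1) \<in> P" by simp
  then have "x ^ (j - i) - 1 \<in> P"
    using prime_onD(8)[OF P(1)] prime_on_power[OF subring_on_B P(1) xB x(2)] s(2,6) s(7)[OF xB] by blast
  then have 1: "x ^ (j - i) - 1 \<in> J" using J(2) by blast
  have "x ^ (j - i) \<in> J" using x(1) ij(1) by (simp add: prime_on_power_iff[OF subring_on_B J(1) xB])
  then have "x ^ (j - i) - (x ^ (j - i) - 1) \<in> J"
    using 1 by (rule ideal_on_diff[OF subring_on_B prime_onD(1)[OF J(1)]])
  then show False using prime_onD(2)[OF J(1)] by simp
qed

text \<open>A prime containing m is determined by the representatives of B/mB that it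
  contains.\<close>

lemma finite_primes_over:
  assumes "m \<noteq> 0"
  shows "finite {P. prime_on B P \<and> of_nat m \<in> P}"
proof -
  obtain T where T: "finite T" "T \<subseteq> B" "\<forall>x\<in>B. \<exists>t\<in>T. \<exists>y\<in>B. x = t + of_nat m * y"
    using residues[OF assms] by blast
  define g where "g U = {t + of_nat m * y |t y. t \<in> U \<and> y \<in> B}" for U
  have "P = g (T \<inter> P)" if P: "prime_on B P" "of_nat m \<in> P" for P
  proof
    note i = prime_onD[OF P(1)]
    show "g (T \<inter> P) \<subseteq> P" using i(5) i(7)[OF _ P(2)] by (auto simp: g_def)
    show "P \<subseteq> g (T \<inter> P)"
    proof
      fix x assume x: "x \<in> P"
      then obtain t y where ty: "t \<in> T" "y \<in> B" "x = t + of_nat m * y" using T(3) i(3) by blast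
      have "of_nat m * y \<in> P" using i(7)[OF ty(2) P(2)] .
      then have "x - of_nat m * y \<in> P" using ideal_on_diff[OF subring_on_B i(1) x] by blast
      then have "t \<in> P" using ty(3) by simp
      then show "x \<in> g (T \<inter> P)" using ty by (auto simp: g_def)
    qed
  qed
  then have "{P. prime_on B P \<and> of_nat m \<in> P} \<subseteq> g ` Pow T" by blast
  then show ?thesis using T(1) finite_subset by blast
qed

text \<open>The element \<open>b\<close> below satisfies \<open>b P \<subseteq> (a)\<close>, so \<open>t = b/a\<close> lies in \<open>P\<^sup>-\<^sup>1\<close> but not in \<open>B\<close>; if
  \<open>t P \<subseteq> P\<close>, then \<open>t\<close> would be integral.\<close>

lemma prime_invertible:
  assumes P: "prime_on B P" "P \<noteq> {0}"
  shows "\<exists>t\<in>inverse_ideal B P. \<exists>p\<in>P. t * p \<in> B - P"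
proof -
  note s = subring_onD[OF subring_on_B]
  note i = prime_onD[OF P(1)]
  obtain a where a: "a \<in> P" "a \<noteq> 0" using P i(4) by blast
  have aB: "a \<in> B" using a i(3) by blast
  define A where "A = gen B {a}"
  have A: "ideal_on B A" unfolding A_def using aB by (intro gen_ideal[OF subring_on_B]) simp
  have A_eq: "A = {r * a |r. r \<in> B}" unfolding A_def by (rule gen_singleton[OF subring_on_B aB])
  have AP: "A \<subseteq> P" unfolding A_eq using i(6) a(1) by blast
  \<comment> \<open>Colon ideal of (a) by x in the localization at P. A maximal proper one is prime,
    contains a and lies in P, so it equals P because nonzero primes are maximal.\<close>
  define J where "J x = {y \<in> B. \<exists>v\<in>B - P. v * x * y \<in> A}" for x
  define F where "F = {J x |x. x \<in> B \<and> 1 \<notin> J x}"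
  have J: "ideal_on B (J x)" if x: "x \<in> B" for x
    unfolding J_def by (rule local_colon_ideal[OF subring_on_B P(1) A x])
  have "1 \<notin> J 1"
  proof
    assume "1 \<in> J 1"
    then show False using AP by (auto simp: J_def)
  qed
  then have "F \<noteq> {}" using s(2) by (auto simp: F_def)
  moreover have "\<And>I. I \<in> F \<Longrightarrow> ideal_on B I" using J by (auto simp: F_def)
  ultimately have "\<exists>M\<in>F. \<forall>Z\<in>F. M \<subseteq> Z \<longrightarrow> Z = M" by (rule noeth_maximal[OF subring_on_B noeth_B])
  then obtain M where M: "M \<in> F" "\<forall>Z\<in>F. M \<subseteq> Z \<longrightarrow> Z = M" by (elim bexE)
  obtain x where x: "x \<in> B" "1 \<notin> J x" "M = J x" using M(1) unfolding F_def by (elim CollectE exE conjE)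
  have max: "J x' = J x" if "x' \<in> B" "1 \<notin> J x'" "J x \<subseteq> J x'" for x'
  proof -
    have "J x' \<in> F" using that(1,2) unfolding F_def by (intro CollectI exI[of _ x']) simp
    then show ?thesis using M(2) that(3) x(3) by simp
  qed
  \<comment> \<open>For y outside \<open>J x\<close> the ideal \<open>J (x * y)\<close> is still
    proper and contains \<open>J x\<close>, so by maximality the two agree.\<close>
  have "z \<in> J x" if yz: "y \<in> B" "z \<in> B" "y * z \<in> J x" "y \<notin> J x" for y z
  proof -
    have xy: "x * y \<in> B" using x(1) yz(1) s(5) by blast
    have "1 \<notin> J (x * y)" using yz(1,4) s(2) by (auto simp: J_def mult.assoc)
    moreover have "J x \<subseteq> J (x * y)"
    proof
      fix w assume "w \<in> J x"
      then obtain u where u: "w \<in> B" "u \<in> B - P" "u * x * w \<in> A" by (auto simp: J_def)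
      have "u * (x * y) * w = y * (u * x * w)" by (simp add: algebra_simps)
      also have "\<dots> \<in> A" using u yz(1) ideal_onD(4)[OF A] by simp
      finally show "w \<in> J (x * y)" using u unfolding J_def by blast
    qed
    ultimately have "J (x * y) = J x" using max xy by simp
    moreover have "z \<in> J (x * y)" using yz(2,3) by (auto simp: J_def mult.assoc)
    ultimately show ?thesis by blast
  qed
  then have Jprime: "prime_on B (J x)" using J[OF x(1)] x(2) unfolding prime_on_def by blast
  have "a \<in> J x"
    using aB x(1) diff_prime_one[OF subring_on_B P(1)] by (auto simp: J_def A_eq intro!: bexI[of _ 1])
  then have "J x \<noteq> {0}" using a(2) by blast
  moreover have "J x \<subseteq> P"
  proof
    fix y assume y: "y \<in> J x"
    show "y \<in> P"
    proof (rule ccontr)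
      assume "y \<notin> P"
      obtain u where u: "y \<in> B" "u \<in> B - P" "u * x * y \<in> A" using y by (auto simp: J_def)
      have "(u * y) * x * 1 \<in> A" using u(3) by (simp add: algebra_simps)
      moreover have "u * y \<in> B - P" using diff_prime_mult[OF subring_on_B P(1) u(2)] u(1) \<open>y \<notin> P\<close> by blast
      ultimately have "1 \<in> J x" using s(2) unfolding J_def by blast
      then show False using x(2) by blast
    qed
  qed
  ultimately have JP: "J x = P" using prime_maximal[OF Jprime _ P(1)] by blast
  obtain W where W: "finite W" "W \<subseteq> P" "P = gen B W"
    using noeth_B i(1) unfolding noeth_def by blast
  \<comment> \<open>Membership in \<open>J x\<close> allows each element its own denominator; here
    one denominator serves all generators of P.\<close>
  have "\<exists>u\<in>B - P. \<forall>w\<in>W. u * x * w \<in> A"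
    using W(1,2)
  proof (induction W)
    case empty
    show ?case using diff_prime_one[OF subring_on_B P(1)] by blast
  next
    case (insert w W)
    then obtain u where u: "u \<in> B - P" "\<forall>w\<in>W. u * x * w \<in> A" by auto
    have "w \<in> J x" using insert.prems JP by blast
    then obtain v where v: "v \<in> B - P" "v * x * w \<in> A" by (auto simp: J_def)
    have "(u * v) * x * z \<in> A" if "z \<in> insert w W" for z
    proof (cases "z = w")
      case True
      then show ?thesis using ideal_onD(4)[OF A _ v(2), of u] u(1) by (simp add: algebra_simps)
    next
      case False
      then have "u * x * z \<in> A" using u(2) that by blast
      then show ?thesis using ideal_onD(4)[OF A, of v "u * x * z"] v(1) by (simp add: algebra_simps)
    qed
    then show ?case using diff_prime_mult[OF subring_on_B P(1) u(1) v(1)] by blast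
  qed
  then obtain u where u: "u \<in> B - P" "\<forall>w\<in>W. u * x * w \<in> A" by blast
  define b where "b = u * x"
  have bB: "b \<in> B" using u x(1) s(5) by (auto simp: b_def)
  have bA: "b \<notin> A"
  proof
    assume "b \<in> A"
    then have "1 \<in> J x" using u(1) s(2) by (auto simp: J_def b_def)
    then show False using x(2) by blast
  qed
  define t where "t = b / a"
  have tP: "t * p \<in> B" if p: "p \<in> P" for p
  proof -
    have WB: "W \<subseteq> B" using W(2) i(3) by blast
    obtain r where r: "\<forall>w\<in>W. r w \<in> B" "p = (\<Sum>w\<in>W. r w * w)"
      using p gen_finite[OF subring_on_B W(1) WB] W(3) by blast
    have "b * p = (\<Sum>w\<in>W. r w * (u * x * w))"
      by (simp add: r(2) b_def sum_distrib_left algebra_simps)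
    also have "\<dots> \<in> A" using r(1) u(2) by (intro ideal_on_sum[OF A]) (blast intro: ideal_onD(4)[OF A])
    finally obtain c where "c \<in> B" "b * p = c * a" unfolding A_eq by blast
    then show ?thesis using a(2) by (simp add: t_def)
  qed
  have "t \<in> inverse_ideal B P" unfolding inverse_ideal_def using tP aB bB a(2) t_def by blast
  moreover have "\<exists>p\<in>P. t * p \<notin> P"
  proof (rule ccontr)
    assume "\<not> ?thesis"
    then have tPP: "\<And>p. p \<in> P \<Longrightarrow> t * p \<in> P" by blast
    have WB: "W \<subseteq> B" using W(2) i(3) by blast
    have "algebraic_int t"
    proof (rule algebraic_int_module)
      have "\<exists>w\<in>W. w \<noteq> 0"
      proof (rule ccontr)
        assume "\<not> ?thesis"
        then have "W \<subseteq> {0}" by blast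
        then have "gen B W \<subseteq> {0}"
          using prime_onD(1)[OF prime_zero[OF subring_on_B]] by (intro gen_minimal)
        then show False using W(3) a by blast
      qed
      then show "(SOME w. w \<in> W \<and> w \<noteq> 0) \<in> W" "(SOME w. w \<in> W \<and> w \<noteq> 0) \<noteq> 0"
        by (metis (mono_tags, lifting) someI_ex)+
      show "finite W" by (rule W(1))
      fix w assume w: "w \<in> W"
      then have "t * w \<in> gen B W" using tPP W(2,3) by blast
      then obtain r where "\<forall>w\<in>W. r w \<in> B" "t * w = (\<Sum>w\<in>W. r w * w)"
        using gen_finite[OF subring_on_B W(1) WB] by blast
      then show "\<exists>r. (\<forall>w'\<in>W. algebraic_int (r w')) \<and> t * w = (\<Sum>w'\<in>W. r w' * w')"
        by (intro exI[of _ r]) (auto simp: B_def)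
    qed
    moreover have "t \<in> K" unfolding t_def using number_fieldD(2)[OF number_field] aB bB by (simp add: B_def)
    ultimately have "t \<in> B" by (simp add: B_def)
    then have "b \<in> A" unfolding A_eq t_def using a(2) by (intro CollectI exI[of _ "b / a"]) auto
    then show False using bA by blast
  qed
  ultimately show ?thesis using tP by blast
qed

end

section \<open>Primes of the polynomial ring in two variables\<close>

subsection \<open>Exchanging the two variables\<close>

definition swp :: "'c::comm_ring_1 poly poly \<Rightarrow> 'c poly poly" where
  "swp p = (\<Sum>i\<le>degree p. \<Sum>j\<le>degree (Polynomial.coeff p i).
     Polynomial.monom (Polynomial.monom (Polynomial.coeff (Polynomial.coeff p i) j) i) j)"

lemma coeff_swp: "Polynomial.coeff (Polynomial.coeff (swp p) j) i = Polynomial.coeff (Polynomial.coeff p i) j"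
proof -
  have 1: "(\<Sum>j'\<le>degree (Polynomial.coeff p i').
      Polynomial.coeff (Polynomial.coeff (Polynomial.monom (Polynomial.monom (Polynomial.coeff (Polynomial.coeff p i') j') i') j') j) i)
    = (if i' = i then Polynomial.coeff (Polynomial.coeff p i) j else 0)" for i'
  proof -
    have "(\<Sum>j'\<le>degree (Polynomial.coeff p i').
      Polynomial.coeff (Polynomial.coeff (Polynomial.monom (Polynomial.monom (Polynomial.coeff (Polynomial.coeff p i') j') i') j') j) i)
      = (\<Sum>j'\<le>degree (Polynomial.coeff p i'). if j' = j then (if i' = i then Polynomial.coeff (Polynomial.coeff p i') j else 0) else 0)"
      by (intro sum.cong) auto
    also have "\<dots> = (if i' = i then Polynomial.coeff (Polynomial.coeff p i) j else 0)"
      by (auto simp: sum.delta' not_le coeff_eq_0)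
    finally show ?thesis .
  qed
  have "Polynomial.coeff (Polynomial.coeff (swp p) j) i
    = (\<Sum>i'\<le>degree p. if i' = i then Polynomial.coeff (Polynomial.coeff p i) j else 0)"
    unfolding swp_def coeff_sum 1 ..
  also have "\<dots> = Polynomial.coeff (Polynomial.coeff p i) j"
    by (auto simp: not_le coeff_eq_0)
  finally show ?thesis .
qed

lemma poly_poly_eqI:
  "(\<And>i j. Polynomial.coeff (Polynomial.coeff p i) j = Polynomial.coeff (Polynomial.coeff q i) j) \<Longrightarrow> p = q"
  by (simp add: poly_eq_iff)

lemma swp_swp [simp]: "swp (swp p) = p"
  by (rule poly_poly_eqI) (simp add: coeff_swp)

lemma swp_add: "swp (p + q) = swp p + swp q"
  by (rule poly_poly_eqI) (simp add: coeff_swp)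

lemma swp_mult: "swp (p * q) = swp p * swp q"
proof (rule poly_poly_eqI)
  fix i j
  show "Polynomial.coeff (Polynomial.coeff (swp (p * q)) i) j = Polynomial.coeff (Polynomial.coeff (swp p * swp q) i) j"
    unfolding coeff_swp coeff_mult coeff_sum by (rule sum.swap)
qed

lemma swp_0 [simp]: "swp 0 = 0" and swp_1 [simp]: "swp 1 = 1"
  by (rule poly_poly_eqI; simp add: coeff_swp Polynomial.coeff_1)+

lemma swp_mem: "swp p \<in> pol (pol C) \<longleftrightarrow> p \<in> pol (pol C)"
  by (auto simp: pol_def coeff_swp)

lemma swp_image_iff: "p \<in> swp ` Q \<longleftrightarrow> swp p \<in> Q"
  by (metis image_iff swp_swp)

lemma swp_prime:
  assumes "prime_on (pol (pol C)) Q"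
  shows "prime_on (pol (pol C)) (swp ` Q)"
  using prime_onD[OF assms] unfolding prime_on_def ideal_on_def swp_image_iff subset_iff
  by (auto simp: swp_image_iff swp_add swp_mult swp_mem)

lemma swp_image_strict: "Q \<subset> Q' \<Longrightarrow> swp ` Q \<subset> swp ` Q'"
  unfolding psubset_eq subset_iff set_eq_iff swp_image_iff by (metis swp_swp)

subsection \<open>Prime ideals of \<open>B[X,Y]\<close>\<close>

definition conic_poly :: "'c::comm_ring_1 \<Rightarrow> 'c \<Rightarrow> 'c \<Rightarrow> 'c poly poly" where
  "conic_poly a b c = [:[:- 1, 0, a:], [:0, b:], [:c:]:]"

lemma swp_conic_poly: "swp (conic_poly a b c) = conic_poly c b a"
  by (rule poly_poly_eqI)
    (simp add: coeff_swp conic_poly_def coeff_pCons split: nat.split)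

lemma conic_poly_nonzero: "conic_poly a b c \<noteq> 0"
  by (simp add: conic_poly_def)

lemma conic_poly_mem_pol: "0 \<in> C \<Longrightarrow> conic_poly a b c \<in> pol (pol C) \<longleftrightarrow> - 1 \<in> C \<and> a \<in> C \<and> b \<in> C \<and> c \<in> C"
  by (auto simp: conic_poly_def pCons_mem_pol pol_iff[of 0])

text \<open>The constant term -1 lies in no prime.\<close>

lemma conic_poly_not_mem_pol:
  assumes "subring_on C" "prime_on C P"
  shows "conic_poly a b c \<notin> pol (pol P)"
  using prime_onD(2,4)[OF assms(2)] ideal_on_minus[OF assms(1) prime_onD(1)[OF assms(2)], of "- 1"]
  by (auto simp: conic_poly_mem_pol)

lemma gen_insert_ideal:
  assumes C: "subring_on C" and J: "ideal_on C J" and f: "f \<in> C"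
  shows "gen C (insert f J) = {w * f + t |w t. w \<in> C \<and> t \<in> J}"
proof -
  have "gen C J = J" using gen_minimal[OF J, of J] gen_superset[of J C] by blast
  then show ?thesis using gen_insert[OF C f ideal_onD(1)[OF J]] by simp
qed

lemma lbasis_singleton:
  fixes q :: "'c::idom set"
  assumes C: "subring_on C" and q: "prime_on C q" "q \<noteq> {0}" and V: "lbasis C q V" "card V = 1"
  shows "\<exists>g\<in>q. g \<noteq> 0 \<and> lgen C q {g}"
proof -
  obtain g where g: "V = {g}" using V(2) card_1_singletonE by blast
  have gq: "g \<in> q" "lgen C q {g}" using V(1) g by (auto simp: lbasis_def)
  have "g \<noteq> 0"
  proof
    assume "g = 0"
    obtain x where x: "x \<in> q" "x \<noteq> 0" using q prime_onD(4)[OF q(1)] by blast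
    obtain u where "u \<in> C - q" "u * x \<in> gen C {0}" using gq(2) x(1) \<open>g = 0\<close> by (auto simp: lgen_def)
    then have "u = 0" using gen_singleton[OF C subring_onD(1)[OF C]] x(2) by auto
    then show False using \<open>u \<in> C - q\<close> prime_onD(4)[OF q(1)] by blast
  qed
  then show ?thesis using gq by blast
qed

lemma pol_zero: "pol {0} = {0}"
  by (auto simp: pol_def poly_eq_iff)

text \<open>The heights of primes of \<open>B[X]\<close> and \<open>B[X,Y]\<close>, read off the tower.\<close>

definition ht1 :: "'c::comm_ring_1 poly set \<Rightarrow> nat" where
  "ht1 q = of_bool (contr q \<noteq> {0}) + of_bool (eps q)"

definition ht2 :: "'c::comm_ring_1 poly poly set \<Rightarrow> nat" where
  "ht2 Q = ht1 (contr Q) + of_bool (eps Q)"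

lemma ht2_eq_0:
  assumes C: "subring_on C" and Q: "prime_on (pol (pol C)) Q" "ht2 Q = 0"
  shows "Q = {0}"
proof -
  have C1: "subring_on (pol C)" by (rule subring_on_pol[OF C])
  have q: "prime_on (pol C) (contr Q)" by (rule contr_prime[OF C1 Q(1)])
  have e: "\<not> eps Q" "\<not> eps (contr Q)" "contr (contr Q) = {0}"
    using Q(2) by (auto simp: ht2_def ht1_def)
  have "contr Q = pol {0}" using not_eps[OF C prime_onD(1)[OF q] e(2)] e(3) by simp
  then have "Q = pol {0}" using not_eps[OF C1 prime_onD(1)[OF Q(1)] e(1)] by (simp add: pol_zero)
  then show ?thesis by (simp add: pol_zero)
qed

context algebraic_integers begin

abbreviation "R1 \<equiv> pol B"
abbreviation "R2 \<equiv> pol (pol B)"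

lemma subring_on_R1: "subring_on R1" and subring_on_R2: "subring_on R2"
  by (intro subring_on_pol subring_on_B)+

lemma noeth_R1: "noeth R1" and noeth_R2: "noeth R2"
  by (intro hilbert_basis subring_on_pol subring_on_B noeth_B)+

section \<open>Local bases in B, B[X] and B[X,Y]\<close>

text \<open>Since t p is a unit at P, every x in P is (t x) p / (t p), and t x lies in B. For
  independence, t maps P^2 into P but does not map p into P.\<close>

lemma lbasis_uniformizer:
  assumes P: "prime_on B P" and t: "t \<in> inverse_ideal B P" "p \<in> P" "t * p \<in> B - P"
  shows "lbasis B P {p}"
proof -
  note s = subring_onD[OF subring_on_B]
  have tB: "t * x \<in> B" if "x \<in> P" for x using t(1) that by (simp add: inverse_ideal_def)
  have pB: "p \<in> B" using t(2) prime_onD(3)[OF P] by blast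
  have "lgen B P {p}"
    unfolding lgen_def
  proof
    fix x assume x: "x \<in> P"
    have "(t * p) * x = (t * x) * p" by (simp add: algebra_simps)
    then have "(t * p) * x \<in> gen B {p}" using tB[OF x] gen_singleton[OF subring_on_B pB] by blast
    then show "\<exists>u\<in>B - P. u * x \<in> gen B {p}" using t(3) by blast
  qed
  moreover have "indep B P {p} (\<lambda>v. v)"
    unfolding indep_def
  proof (intro allI impI)
    fix a assume a: "\<forall>i\<in>{p}. a i \<in> B" "(\<Sum>i\<in>{p}. a i * i) \<in> lsq B P"
    show "\<forall>i\<in>{p}. a i \<in> P"
    proof (rule ccontr)
      assume "\<not> ?thesis"
      then have ap: "a p \<in> B - P" using a(1) by simp
      obtain u where u: "u \<in> B - P" "u * (a p * p) \<in> msq B P" using a(2) by (auto simp: lsq_def)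
      \<comment> \<open>An ideal of B that contains all products of two elements of P, because t
        times the first factor is in B.\<close>
      define J where "J = {x \<in> B. t * x \<in> P}"
      have "ideal_on B J"
        unfolding ideal_on_def
      proof (intro conjI ballI)
        show "J \<subseteq> B" "0 \<in> J" using s(1) prime_onD(4)[OF P] by (auto simp: J_def)
        show "x + y \<in> J" if "x \<in> J" "y \<in> J" for x y
          using that prime_onD(5)[OF P] s(3) by (simp add: J_def ring_distribs)
        show "r * x \<in> J" if "r \<in> B" "x \<in> J" for r x
        proof -
          have "r * (t * x) \<in> P" using that prime_onD(6)[OF P] by (simp add: J_def)
          then have "t * (r * x) \<in> P" by (simp add: algebra_simps)
          then show ?thesis using that s(5) by (simp add: J_def)
        qed
      qed
      moreover have "{x * y |x y. x \<in> P \<and> y \<in> P} \<subseteq> J"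
      proof clarify
        fix x y assume xy: "x \<in> P" "y \<in> P"
        have "(t * x) * y \<in> P" using tB[OF xy(1)] xy(2) by (rule prime_onD(6)[OF P])
        then show "x * y \<in> J" using xy prime_onD(3)[OF P] s(5) by (auto simp: J_def mult.assoc)
      qed
      ultimately have "msq B P \<subseteq> J" unfolding msq_def by (rule gen_minimal)
      then have "t * (u * (a p * p)) \<in> P" using u(2) by (auto simp: J_def)
      then have "(u * a p) * (t * p) \<in> P" by (simp add: algebra_simps)
      moreover have "u * a p \<in> B - P" by (rule diff_prime_mult[OF subring_on_B P u(1) ap])
      ultimately show False using prime_onD(8)[OF P] t(3) by blast
    qed
  qed
  ultimately show ?thesis using t(2) by (simp add: lbasis_def)
qed

lemma lbasis_B:
  assumes P: "prime_on B P"
  shows "\<exists>V. lbasis B P V \<and> card V = of_bool (P \<noteq> {0})"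
proof (cases "P = {0}")
  case True
  have "lbasis B P {}"
    unfolding lbasis_def lgen_def indep_def gen_empty[OF subring_on_B] True
    using diff_prime_one[OF subring_on_B prime_zero[OF subring_on_B]] by auto
  then show ?thesis using True by (intro exI[of _ "{}"]) simp
next
  case False
  then obtain t p where "t \<in> inverse_ideal B P" "p \<in> P" "t * p \<in> B - P"
    using prime_invertible[OF P] by blast
  then have "lbasis B P {p}" by (rule lbasis_uniformizer[OF P])
  then show ?thesis using False by (intro exI[of _ "{p}"]) simp
qed

lemma lbasis_R1:
  assumes q: "prime_on R1 q"
  shows "\<exists>V. lbasis R1 q V \<and> card V = ht1 q"
proof -
  obtain V where V: "lbasis B (contr q) V" "card V = of_bool (contr q \<noteq> {0})"
    using lbasis_B[OF contr_prime[OF subring_on_B q]] by blast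
  obtain W where "lbasis R1 q W" "card W = card V + of_bool (eps q)"
    using lbasis_tower[OF subring_on_B q V(1)] by blast
  then show ?thesis using V(2) by (intro exI[of _ W] conjI) (simp_all only: ht1_def)
qed

lemma lbasis_R2:
  assumes Q: "prime_on R2 Q"
  shows "\<exists>V. lbasis R2 Q V \<and> card V = ht2 Q"
proof -
  obtain V where V: "lbasis R1 (contr Q) V" "card V = ht1 (contr Q)"
    using lbasis_R1[OF contr_prime[OF subring_on_R1 Q]] by blast
  obtain W where "lbasis R2 Q W" "card W = card V + of_bool (eps Q)"
    using lbasis_tower[OF subring_on_R1 Q V(1)] by blast
  then show ?thesis using V(2) by (intro exI[of _ W] conjI) (simp_all only: ht2_def)
qed

text \<open>The constant p is a member of a local basis of Q, so its coefficient in any relation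
  modulo the square lies in Q.\<close>

lemma uniformizer_mult_lsq:
  assumes Q: "prime_on R2 Q"
    and t: "t \<in> inverse_ideal B (contr (contr Q))" "p \<in> contr (contr Q)" "t * p \<in> B - contr (contr Q)"
    and h: "h \<in> R2" "const2 p * h \<in> lsq R2 Q"
  shows "h \<in> Q"
proof -
  note q = contr_prime[OF subring_on_R1 Q]
  have V0: "lbasis B (contr (contr Q)) {p}"
    by (rule lbasis_uniformizer[OF contr_prime[OF subring_on_B q] t])
  obtain V1 where V1: "lbasis R1 (contr Q) V1" "[:p:] \<in> V1"
    using lbasis_tower[OF subring_on_B q V0] by auto
  obtain V where V: "lbasis R2 Q V" "const2 p \<in> V"
    using lbasis_tower[OF subring_on_R1 Q V1(1)] V1(2) by auto
  have fV: "finite V" and iV: "indep R2 Q V (\<lambda>v. v)" using V(1) by (auto simp: lbasis_def)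
  define a where "a v = (if v = const2 p then h else 0)" for v
  have "(\<Sum>v\<in>V. a v * v) = (\<Sum>v\<in>V. if v = const2 p then const2 p * h else 0)"
    by (intro sum.cong) (auto simp: a_def mult.commute)
  also have "\<dots> = const2 p * h" using fV V(2) by simp
  finally have "(\<Sum>v\<in>V. a v * v) \<in> lsq R2 Q" using h(2) by simp
  moreover have "\<forall>v\<in>V. a v \<in> R2" using h(1) subring_onD(1)[OF subring_on_R2] by (simp add: a_def)
  ultimately have "a (const2 p) \<in> Q" using iV V(2) unfolding indep_def by blast
  then show ?thesis by (simp add: a_def)
qed

section \<open>Growth of the heights along chains\<close>

lemma primes_psubset:
  assumes "prime_on B P" "prime_on B P'" "P \<subset> P'"
  shows "P = {0}" "P' \<noteq> {0}"
  using prime_maximal[OF assms(1) _ assms(2)] assms prime_onD(4)[OF assms(1)] by blast+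

lemma contr_contr_prime: "prime_on R2 Q \<Longrightarrow> prime_on B (contr (contr Q))"
  using contr_prime[OF subring_on_B] contr_prime[OF subring_on_R1] by blast

lemma prime_principal:
  assumes "prime_on B P" "P \<noteq> {0}"
  shows "\<exists>g\<in>P. g \<noteq> 0 \<and> lgen B P {g}"
  using lbasis_B[OF assms(1)] assms lbasis_singleton[OF subring_on_B assms] by auto

text \<open>If the contractions differ, they are 0 and a nonzero prime. The height could then
  stagnate only if Q' is extended and Q is not; but inside the extension of a locally principal
  prime, a prime contracting to 0 is 0.\<close>

lemma ht1_strict:
  assumes Q: "prime_on R1 Q" and Q': "prime_on R1 Q'" and sub: "Q \<subset> Q'"
  shows "ht1 Q < ht1 Q'"
proof (cases "contr Q = contr Q'")
  case True
  then show ?thesis using eps_of_strict[OF subring_on_B Q Q' sub] by (simp add: ht1_def)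
next
  case False
  note q = contr_prime[OF subring_on_B Q] and q' = contr_prime[OF subring_on_B Q']
  have "contr Q \<subset> contr Q'" using contr_mono[of Q Q'] sub False by blast
  note c = primes_psubset[OF q q' this]
  have "eps Q'" if e: "eps Q"
  proof (rule ccontr)
    assume "\<not> eps Q'"
    then have "Q' = pol (contr Q')" by (rule not_eps[OF subring_on_B prime_onD(1)[OF Q']])
    then have sub': "Q \<subseteq> pol (contr Q')" using sub by blast
    obtain g where g: "g \<in> contr Q'" "g \<noteq> 0" "lgen B (contr Q') {g}" using prime_principal[OF q' c(2)] by blast
    have "Q = {0}" by (rule contr_zero_below_principal[OF subring_on_B noeth_B Q c(1) q' sub' g])
    then show False using e by (auto simp: eps_def pol_def contr_def)
  qed
  then show ?thesis using c by (auto simp: ht1_def)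
qed

text \<open>The extension \<open>q[Y]\<close> of a prime \<open>q\<close> of \<open>B[X]\<close> containing a nonconstant polynomial modulo
  \<open>q \<inter> B \<noteq> 0\<close>. Only at such primes may \<open>ht2\<close> fail to increase strictly.\<close>

definition bad :: "'k poly poly set \<Rightarrow> bool" where
  "bad Q \<longleftrightarrow> \<not> eps Q \<and> eps (contr Q) \<and> contr (contr Q) \<noteq> {0}"

text \<open>Stagnation with different contractions requires that Q' is extended, Q is not, and the
  heights of the contractions differ by one. Unless Q' is bad, its contraction has height 1, so it
  is locally principal and Q contracts to 0; then Q = 0, which is extended after all.\<close>

lemma ht2_strict:
  assumes Q: "prime_on R2 Q" and Q': "prime_on R2 Q'" and sub: "Q \<subset> Q'"
  shows "ht2 Q < ht2 Q' \<or> bad Q'"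
proof (cases "contr Q = contr Q'")
  case True
  then show ?thesis using eps_of_strict[OF subring_on_R1 Q Q' sub] by (simp add: ht2_def)
next
  case False
  note q = contr_prime[OF subring_on_R1 Q] and q' = contr_prime[OF subring_on_R1 Q']
  have "contr Q \<subset> contr Q'" using contr_mono[of Q Q'] sub False by blast
  then have h: "ht1 (contr Q) < ht1 (contr Q')" by (rule ht1_strict[OF q q'])
  show ?thesis
  proof (rule ccontr)
    assume neg: "\<not> ?thesis"
    then have e: "eps Q" "\<not> eps Q'" "ht1 (contr Q') = ht1 (contr Q) + 1"
      using h by (auto simp: ht2_def split: if_splits) (auto simp: of_bool_def split: if_splits)
    have b: "\<not> bad Q'" using neg by blast
    then have "ht1 (contr Q') < 2" using e(2) by (auto simp: bad_def ht1_def)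
    then have h1: "ht1 (contr Q') = 1" "ht1 (contr Q) = 0" using e(3) by auto
    then have "contr (contr Q) = {0}" "\<not> eps (contr Q)" by (auto simp: ht1_def)
    then have c0: "contr Q = {0}" using not_eps[OF subring_on_B prime_onD(1)[OF q]] by (simp add: pol_zero)
    have "contr Q' \<noteq> {0}" using False c0 by simp
    then obtain g where g: "g \<in> contr Q'" "g \<noteq> 0" "lgen R1 (contr Q') {g}"
      using lbasis_R1[OF q'] h1(1) lbasis_singleton[OF subring_on_R1 q'] by metis
    have "Q \<subseteq> pol (contr Q')" using sub not_eps[OF subring_on_R1 prime_onD(1)[OF Q'] e(2)] by blast
    then have "Q = {0}" using contr_zero_below_principal[OF subring_on_R1 noeth_R1 Q c0 q' _ g] by blast
    then show False using e(1) by (auto simp: eps_def pol_def contr_def)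
  qed
qed

text \<open>After the exchange of X and Y, the image S' of a bad Q' lies over P[Y]. If S lies over
  P[Y] too, it is P[X,Y], which does not contain the conic. Otherwise S contracts to 0, as P is
  locally principal, so S0 also contracts to 0 and, being the smaller prime in that fibre,
  vanishes.\<close>

lemma not_bad_above_chain:
  assumes f: "f = conic_poly a b c" "a \<in> B" "b \<in> B" "c \<in> B"
    and Q0: "prime_on R2 Q0" "f \<in> Q0" and Q: "prime_on R2 Q" "Q0 \<subset> Q" and Q': "prime_on R2 Q'" "Q \<subset> Q'"
  shows "\<not> bad Q'"
proof
  assume bad: "bad Q'"
  define P where "P = contr (contr Q')"
  have P: "prime_on B P" "P \<noteq> {0}" using contr_contr_prime[OF Q'(1)] bad by (auto simp: P_def bad_def)
  note q' = contr_prime[OF subring_on_R1 Q'(1)]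
  have Q'_eq: "Q' = pol (contr Q')"
    using not_eps[OF subring_on_R1 prime_onD(1)[OF Q'(1)]] bad by (auto simp: bad_def)
  define S0 S S' where "S0 = swp ` Q0" and "S = swp ` Q" and "S' = swp ` Q'"
  have S: "prime_on R2 S0" "prime_on R2 S" "prime_on R2 S'" "S0 \<subset> S" "S \<subset> S'"
    unfolding S0_def S_def S'_def
    by (intro swp_prime swp_image_strict Q0(1) Q Q')+
  have f': "conic_poly c b a \<in> S0" unfolding S0_def swp_image_iff swp_conic_poly using Q0(2) f(1) by simp
  \<comment> \<open>Q' is extended from a prime m of B[X] over P. A polynomial in Y alone lies in it
    iff its coefficients, as constants of B[X], lie in m, which means in P.\<close>
  have cS': "contr S' = pol P"
  proof (rule Set.set_eqI)
    fix h
    have "h \<in> contr S' \<longleftrightarrow> swp [:h:] \<in> pol (contr Q')"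
      unfolding contr_iff[of h] S'_def swp_image_iff using Q'_eq by simp
    also have "\<dots> \<longleftrightarrow> (\<forall>i. [:Polynomial.coeff h i:] \<in> contr Q')"
    proof -
      have "Polynomial.coeff (swp [:h:]) i = [:Polynomial.coeff h i:]" for i
        by (rule poly_eqI) (simp add: coeff_swp coeff_pCons split: nat.split)
      then show ?thesis by (simp add: pol_iff)
    qed
    also have "\<dots> \<longleftrightarrow> h \<in> pol P" by (simp add: pol_iff P_def contr_iff)
    finally show "h \<in> contr S' \<longleftrightarrow> h \<in> pol P" .
  qed
  note s = contr_prime[OF subring_on_R1 S(2)]
  have sub: "contr S \<subseteq> pol P" using contr_mono[of S S'] S(5) cS' by blast
  show False
  proof (cases "contr S = pol P")
    case True
    then have "\<not> eps S" using eps_of_strict(2)[OF subring_on_R1 S(2,3,5)] cS' by simp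
    then have "S = pol (pol P)" using not_eps[OF subring_on_R1 prime_onD(1)[OF S(2)]] True by simp
    then show False using f' S(4) conic_poly_not_mem_pol[OF subring_on_B P(1)] by blast
  next
    case False
    have "contr (contr S) \<subseteq> P"
      using contr_mono[OF sub] prime_onD(4)[OF P(1)] by (simp add: contr_pol)
    moreover have "contr (contr S) \<noteq> P"
      using pol_contr_subset[OF subring_on_B prime_onD(1)[OF s]] False sub by blast
    ultimately have "contr (contr S) = {0}"
      using primes_psubset(1)[OF contr_contr_prime[OF S(2)] P(1)] by blast
    moreover obtain g where g: "g \<in> P" "g \<noteq> 0" "lgen B P {g}" using prime_principal[OF P] by blast
    ultimately have cS: "contr S = {0}"
      using contr_zero_below_principal[OF subring_on_B noeth_B s _ P(1) sub g] by blast
    then have cS0: "contr S0 = {0}"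
      using contr_mono[of S0 S] S(4) prime_onD(4)[OF contr_prime[OF subring_on_R1 S(1)]] by blast
    then have "\<not> eps S0" using eps_of_strict(2)[OF subring_on_R1 S(1,2,4)] cS by simp
    then have "S0 = {0}" using not_eps[OF subring_on_R1 prime_onD(1)[OF S(1)]] cS0 by (simp add: pol_zero)
    then show False using f' conic_poly_nonzero by blast
  qed
qed

text \<open>The height can stagnate only on reaching a bad prime. By the previous lemma this happens
  at index 1 at the latest, where the bad prime has height 2 anyway.\<close>

lemma ht2_chain:
  assumes f: "f = conic_poly a b c" "a \<in> B" "b \<in> B" "c \<in> B"
    and p: "\<forall>i\<le>r. prime_on R2 (p i)" "\<forall>i<r. p i \<subset> p (Suc i)" "f \<in> p 0"
  shows "i \<le> r \<Longrightarrow> ht2 (p i) \<ge> Suc i"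
proof (induction i)
  case 0
  have "p 0 \<noteq> {0}" using p(3) f(1) conic_poly_nonzero by blast
  then have "ht2 (p 0) \<noteq> 0" using ht2_eq_0[OF subring_on_B] p(1) by blast
  then show ?case by simp
next
  case (Suc i)
  then have IH: "Suc i \<le> ht2 (p i)" by simp
  have pr: "prime_on R2 (p i)" "prime_on R2 (p (Suc i))" "p i \<subset> p (Suc i)" using p Suc.prems by auto
  show ?case
  proof (cases "bad (p (Suc i))")
    case False
    then show ?thesis using ht2_strict[OF pr] IH by simp
  next
    case True
    have "i = 0"
    proof (rule ccontr)
      assume "i \<noteq> 0"
      then obtain j where j: "i = Suc j" using not0_implies_Suc by blast
      have mono: "p 0 \<subseteq> p k" if "k \<le> r" for k
        using that
      proof (induction k)
        case (Suc k)
        then show ?case using p(2) by (metis Suc_le_lessD Suc_leD psubset_eq subset_trans)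
      qed simp
      have "f \<in> p j" using mono[of j] p(3) Suc.prems j by auto
      moreover have "prime_on R2 (p j)" "p j \<subset> p i" using p Suc.prems j by auto
      ultimately show False using not_bad_above_chain[OF f _ _ pr(1) _ pr(2,3)] True by blast
    qed
    then show ?thesis using True by (simp add: bad_def ht2_def ht1_def)
  qed
qed

subsection \<open>Existence of smaller primes\<close>

text \<open>In the fibre over p, a polynomial ring in two variables over a field, M has height two.
  If f lies in q[Y], then q[Y] serves. Otherwise a prime over p[X] is sought, that is, one
  containing f and p[X,Y] but no polynomial in X outside p[X].\<close>

lemma prime_below_fibre:
  assumes f: "f \<in> M" and M: "prime_on R2 M" "eps M" "eps (contr M)"
    and nf: "f \<notin> pol (pol (contr (contr M)))"
  shows "\<exists>Q. prime_on R2 Q \<and> f \<in> Q \<and> Q \<subset> M \<and> contr (contr Q) = contr (contr M)"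
proof (cases "f \<in> pol (contr M)")
  case True
  have q: "prime_on R1 (contr M)" by (rule contr_prime[OF subring_on_R1 M(1)])
  have "pol (contr M) \<subset> M" using M(2) pol_contr_subset[OF subring_on_R1 prime_onD(1)[OF M(1)]]
    by (auto simp: eps_def)
  then show ?thesis
    using True pol_prime[OF subring_on_R1 q] contr_pol[OF prime_onD(4)[OF q]] by (intro exI[of _ "pol (contr M)"]) simp
next
  case False
  define q p where "q = contr M" and "p = contr q"
  have q: "prime_on R1 q" unfolding q_def by (rule contr_prime[OF subring_on_R1 M(1)])
  have p: "prime_on B p" unfolding p_def by (rule contr_prime[OF subring_on_B q])
  have pp: "prime_on R1 (pol p)" by (rule pol_prime[OF subring_on_B p])
  define PP where "PP = pol (pol p)"
  have PP: "prime_on R2 PP" unfolding PP_def by (rule pol_prime[OF subring_on_R1 pp])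
  have pq: "prime_on R2 (pol q)" by (rule pol_prime[OF subring_on_R1 q])
  have ppq: "pol p \<subseteq> q" unfolding p_def by (rule pol_contr_subset[OF subring_on_B prime_onD(1)[OF q]])
  have PPq: "PP \<subseteq> pol q" unfolding PP_def using ppq by (rule pol_mono)
  have pqM: "pol q \<subseteq> M" unfolding q_def by (rule pol_contr_subset[OF subring_on_R1 prime_onD(1)[OF M(1)]])
  have fR: "f \<in> R2" using f prime_onD(3)[OF M(1)] by blast
  obtain g where g: "min_poly_elt q g"
    using ex_min_poly_elt[OF subring_on_B q] M(3) unfolding q_def by blast
  define l where "l = lead_coeff g"
  have gq: "g \<in> q" "l \<notin> p" using g by (auto simp: min_poly_elt_def l_def p_def)
  have gR: "g \<in> R1" using gq(1) prime_onD(3)[OF q] by blast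
  have l: "l \<in> B" using gR by (simp add: l_def pol_def)
  have gp: "g \<notin> pol p" using gq(2) by (auto simp: pol_def l_def)
  have gdeg: "degree g > 0"
  proof (rule ccontr)
    assume "\<not> degree g > 0"
    then obtain x where x: "g = [:x:]" by (auto elim: degree_eq_zeroE)
    then show False using gq by (simp add: p_def contr_iff l_def)
  qed
  note s2 = subring_onD[OF subring_on_R2]
  note s1 = subring_onD[OF subring_on_R1]
  define I where "I = {w * f + t |w t. w \<in> R2 \<and> t \<in> PP}"
  have I_gen: "I = gen R2 (insert f PP)"
    unfolding I_def by (rule gen_insert_ideal[OF subring_on_R2 prime_onD(1)[OF PP] fR, symmetric])
  have I: "ideal_on R2 I"
    unfolding I_gen using fR prime_onD(3)[OF PP] by (intro gen_ideal[OF subring_on_R2]) blast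
  have fI: "f \<in> I" "PP \<subseteq> I" unfolding I_gen using gen_superset[of "insert f PP" R2] by blast+
  have IM: "I \<subseteq> M" unfolding I_gen using f PPq pqM by (intro gen_minimal[OF prime_onD(1)[OF M(1)]]) blast
  \<comment> \<open>Descent on the degree of s. From u s in I follows s in q, so s is s' g modulo
    p[X] up to a factor; since f is outside q[Y], the multiplier of f is divisible by g too, and
    cancelling g leaves such a relation for s'.\<close>
  have disj: "u * [:s:] \<notin> I" if "s \<in> R1" "s \<notin> pol p" "u \<in> R2 - M" for s u
    using that
  proof (induction "degree s" arbitrary: s u rule: less_induct)
    case less
    show ?case
    proof
      assume uI: "u * [:s:] \<in> I"
      have sR: "[:s:] \<in> R2" using less.prems(1) s1(1) by simp
      have "[:s:] \<in> M"
        using uI IM prime_onD(8)[OF M(1) _ _ sR] less.prems(3) by blast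
      then have sq: "s \<in> q" by (simp add: q_def contr_iff)
      \<comment> \<open>The instance n = \<open>degree s\<close>, together with the positive degree
        of g, bounds the degree of s' below that of s.\<close>
      obtain j s' r where 1: "s' \<in> R1" "r \<in> pol p" "smult (l ^ j) s = s' * g + r"
        "\<forall>i\<ge>degree s. degree s + degree g > degree s \<longrightarrow> Polynomial.coeff s' i = 0"
        using min_poly_elt_division[OF subring_on_B q g sq, of "degree s"] unfolding l_def p_def by (elim exE conjE)
      have lj: "l ^ j \<in> B - p"
        using subring_onD(7)[OF subring_on_B l] prime_on_power[OF subring_on_B p l gq(2)] by blast
      have ljq: "[:l ^ j:] \<in> R1 - q"
        using lj unfolding p_def by (rule const_not_mem[OF subring_on_B])
      then have ljM: "[:[:l ^ j:]:] \<in> R2 - M"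
        unfolding q_def by (rule const_not_mem[OF subring_on_R1])
      have s'p: "s' \<notin> pol p"
      proof
        assume "s' \<in> pol p"
        then have "s' * g + r \<in> pol p"
          using prime_onD(5)[OF pp] prime_onD(7)[OF pp gR] 1(2) by blast
        then have "[:l ^ j:] * s \<in> pol p" using 1(3) by simp
        then have "[:l ^ j:] \<in> pol p"
          using prime_onD(8)[OF pp _ _ less.prems(1)] less.prems(2) ljq by blast
        then show False using ljq ppq by blast
      qed
      have "s' \<noteq> 0" using s'p prime_onD(4)[OF pp] by blast
      have deg: "degree s' < degree s"
      proof (rule ccontr)
        assume "\<not> degree s' < degree s"
        then have "lead_coeff s' = 0" using 1(4) gdeg by simp
        then show False using \<open>s' \<noteq> 0\<close> by simp
      qed
      obtain w t where wt: "w \<in> R2" "t \<in> PP" "u * [:s:] = w * f + t" using uI by (auto simp: I_def)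
      define k where "k = [:[:l ^ j:]:]"
      have kM: "k \<in> R2 - M" using ljM by (simp add: k_def)
      have uR: "u \<in> R2" using less.prems(3) by blast
      have rPP: "[:r:] \<in> PP" using 1(2) prime_onD(4)[OF pp] by (simp add: PP_def)
      have "k * [:s:] = [:s' * g + r:]" by (simp add: k_def 1(3)[symmetric])
      then have ks: "k * [:s:] = [:s':] * [:g:] + [:r:]" by (simp add: mult.commute)
      have e: "u * [:s':] * [:g:] - (k * w) * f = k * t - u * [:r:]"
      proof -
        have "k * (w * f + t) = u * ([:s':] * [:g:] + [:r:])"
          unfolding ks[symmetric] wt(3)[symmetric] by (simp only: mult.left_commute)
        then show ?thesis by (simp only: algebra_simps)
      qed
      have "k * t - u * [:r:] \<in> PP"
        using prime_onD(6)[OF PP _ wt(2)] prime_onD(6)[OF PP uR rPP] kM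
        by (intro ideal_on_diff[OF subring_on_R2 prime_onD(1)[OF PP]]) auto
      then have ePP: "u * [:s':] * [:g:] - (k * w) * f \<in> PP" using e by simp
      have gR2: "[:g:] \<in> R2" using gR s1(1) by simp
      have s'R2: "[:s':] \<in> R2" using 1(1) s1(1) by simp
      have gpq: "[:g:] \<in> pol q" using gq(1) prime_onD(4)[OF q] by simp
      have us'R: "u * [:s':] \<in> R2" by (rule s2(5)[OF uR s'R2])
      have kwR: "k * w \<in> R2" using s2(5) kM wt(1) by blast
      have "u * [:s':] * [:g:] \<in> pol q" by (rule prime_onD(6)[OF pq us'R gpq])
      then have "(k * w) * f \<in> pol q"
        using ePP PPq ideal_on_add_iff(4)[OF subring_on_R2 prime_onD(1)[OF pq]] by blast
      then have kwq: "k * w \<in> pol q" using False prime_onD(8)[OF pq _ kwR fR] unfolding q_def by blast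
      \<comment> \<open>Locally q is generated by g and p[X]. Hence k * w, which lies in q[Y],
        becomes a multiple of g modulo p[X,Y].\<close>
      define J where "J = gen R1 (insert g (pol p))"
      have gpR: "insert g (pol p) \<subseteq> R1" using gR prime_onD(3)[OF pp] by blast
      have J: "ideal_on R1 J" unfolding J_def by (rule gen_ideal[OF subring_on_R1 gpR])
      have Jsup: "g \<in> J" "pol p \<subseteq> J" unfolding J_def using gen_superset[of "insert g (pol p)" R1] by blast+
      have "\<exists>v\<in>R1 - q. v * x \<in> J" if x: "x \<in> q" for x
      proof -
        obtain i y z where y: "y \<in> R1" "z \<in> pol p" "smult (l ^ i) x = y * g + z"
          using min_poly_elt_reduce[OF subring_on_B q g x] unfolding l_def p_def by (elim exE conjE)
        have "y * g + z \<in> J" using ideal_onD(3)[OF J] ideal_onD(4)[OF J y(1) Jsup(1)] y(2) Jsup(2) by blast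
        then have "[:l ^ i:] * x \<in> J" using y(3) by simp
        moreover have "l ^ i \<in> B - contr q"
          using subring_onD(7)[OF subring_on_B l] prime_on_power[OF subring_on_B p l gq(2)] unfolding p_def by blast
        then have "[:l ^ i:] \<in> R1 - q" by (rule const_not_mem[OF subring_on_B])
        ultimately show ?thesis by blast
      qed
      then obtain v where v: "v \<in> R1 - q" "smult v (k * w) \<in> pol J"
        using pol_common_denom[OF subring_on_R1 q J prime_onD(3)[OF q] prime_onD(4)[OF q] _ kwq] by blast
      have "pol J \<subseteq> {y * [:g:] + t |y t. y \<in> R2 \<and> t \<in> PP}"
      proof -
        have "(\<lambda>x. [:x:]) ` insert g (pol p) \<subseteq> insert [:g:] PP"
          using prime_onD(4)[OF pp] by (auto simp: PP_def)
        then have "(\<lambda>x. [:x:]) ` insert g (pol p) \<subseteq> gen R2 (insert [:g:] PP)"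
          using gen_superset[of "insert [:g:] PP" R2] by blast
        moreover have "ideal_on R2 (gen R2 (insert [:g:] PP))"
          using gR2 prime_onD(3)[OF PP] by (intro gen_ideal[OF subring_on_R2]) blast
        ultimately have "gen R2 ((\<lambda>x. [:x:]) ` insert g (pol p)) \<subseteq> gen R2 (insert [:g:] PP)"
          by (intro gen_minimal)
        then show ?thesis
          using pol_gen_subset[OF subring_on_R1 gpR]
          unfolding J_def gen_insert_ideal[OF subring_on_R2 prime_onD(1)[OF PP] gR2] by blast
      qed
      then obtain y t' where y: "y \<in> R2" "t' \<in> PP" "smult v (k * w) = y * [:g:] + t'" using v(2) by blast
      have vR: "[:v:] \<in> R2 - M" using v(1) unfolding q_def by (rule const_not_mem[OF subring_on_R1])
      have "[:v:] * (u * [:s':] * [:g:] - (k * w) * f) \<in> PP"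
        using prime_onD(6)[OF PP _ ePP] vR by blast
      moreover have "[:v:] * (u * [:s':] * [:g:] - (k * w) * f) = ([:v:] * (u * [:s':]) - y * f) * [:g:] - t' * f"
      proof -
        have "[:v:] * (k * w) = y * [:g:] + t'" using y(3) by simp
        then have "[:v:] * ((k * w) * f) = (y * [:g:] + t') * f" by (metis mult.assoc)
        then show ?thesis by (simp only: algebra_simps)
      qed
      ultimately have "([:v:] * (u * [:s':]) - y * f) * [:g:] - t' * f \<in> PP" by simp
      then have "([:v:] * (u * [:s':]) - y * f) * [:g:] \<in> PP"
        using ideal_on_add_iff(3)[OF subring_on_R2 prime_onD(1)[OF PP] prime_onD(7)[OF PP fR y(2)]] by blast
      moreover have "[:g:] \<notin> PP" using gp prime_onD(4)[OF pp] by (simp add: PP_def)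
      moreover have "[:v:] * (u * [:s':]) - y * f \<in> R2"
        using s2(6)[OF s2(5)[OF _ us'R] s2(5)[OF y(1) fR]] vR by blast
      ultimately have "[:v:] * (u * [:s':]) - y * f \<in> PP" using prime_onD(8)[OF PP _ _ gR2] by blast
      then have "([:v:] * (u * [:s':]) - y * f) + y * f \<in> I"
        using fI(2) ideal_onD(3)[OF I] ideal_onD(4)[OF I y(1) fI(1)] by blast
      then have "([:v:] * u) * [:s':] \<in> I" by (simp add: mult.assoc)
      moreover have "[:v:] * u \<in> R2 - M"
        by (rule diff_prime_mult[OF subring_on_R2 M(1) vR less.prems(3)])
      ultimately show False using less.hyps[OF deg 1(1) s'p] by blast
    qed
  qed
  \<comment> \<open>A prime that misses S and contains I lies in M and contracts to p[X], whereas M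
    contracts to the larger q.\<close>
  define S where "S = {u * [:s:] |u s. u \<in> R2 - M \<and> s \<in> R1 - pol p}"
  have "S \<subseteq> R2" using s1(1) by (auto simp: S_def simp del: mult_pCons_right intro!: s2(5))
  moreover have "1 \<in> S"
    unfolding S_def using diff_prime_one[OF subring_on_R2 M(1)] diff_prime_one[OF subring_on_R1 pp]
    by (intro CollectI exI[of _ 1]) (auto simp: one_pCons)
  moreover have "x * y \<in> S" if xy: "x \<in> S" "y \<in> S" for x y
  proof -
    obtain u s u' s' where "u \<in> R2 - M" "s \<in> R1 - pol p" "x = u * [:s:]"
      "u' \<in> R2 - M" "s' \<in> R1 - pol p" "y = u' * [:s':]" using xy by (auto simp: S_def)
    moreover from this have "x * y = (u * u') * [:s * s':]" by (simp add: mult.commute mult.left_commute)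
    ultimately show ?thesis
      using diff_prime_mult[OF subring_on_R2 M(1)] diff_prime_mult[OF subring_on_R1 pp] unfolding S_def by blast
  qed
  moreover have "I \<inter> S = {}" using disj by (auto simp: S_def)
  ultimately obtain Q where Q: "prime_on R2 Q" "I \<subseteq> Q" "Q \<inter> S = {}"
    using prime_avoiding[OF subring_on_R2 noeth_R2 I] by blast
  have "Q \<subseteq> M"
  proof
    fix x assume x: "x \<in> Q"
    show "x \<in> M"
    proof (rule ccontr)
      assume "x \<notin> M"
      then have "x \<in> R2 - M" using x prime_onD(3)[OF Q(1)] by blast
      then have "x * [:1:] \<in> S" using diff_prime_one[OF subring_on_R1 pp] unfolding S_def by blast
      then show False using Q(3) x by (auto simp: one_pCons[symmetric])
    qed
  qed
  have "contr Q \<subseteq> pol p"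
  proof
    fix x assume x: "x \<in> contr Q"
    show "x \<in> pol p"
    proof (rule ccontr)
      assume "x \<notin> pol p"
      moreover have "x \<in> R1" using x prime_onD(3)[OF contr_prime[OF subring_on_R1 Q(1)]] by blast
      ultimately have "1 * [:x:] \<in> S" using diff_prime_one[OF subring_on_R2 M(1)] unfolding S_def by blast
      then show False using Q(3) x by (auto simp: contr_iff)
    qed
  qed
  moreover have "pol p \<subseteq> contr Q"
  proof
    fix x assume "x \<in> pol p"
    then have "[:x:] \<in> PP" using prime_onD(4)[OF pp] by (simp add: PP_def)
    then show "x \<in> contr Q" using fI(2) Q(2) by (auto simp: contr_iff)
  qed
  ultimately have cQ: "contr Q = pol p" by blast
  moreover have "q \<noteq> pol p" using gp gq(1) by blast
  ultimately have "Q \<noteq> M" unfolding q_def by blast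
  then have "Q \<subset> M" using \<open>Q \<subseteq> M\<close> by blast
  moreover have "contr (contr Q) = contr (contr M)"
    unfolding cQ using contr_pol[OF prime_onD(4)[OF p]] by (simp add: p_def q_def)
  ultimately show ?thesis using Q(1,2) fI(1) by blast
qed

text \<open>The prime must avoid the nonzero constants. If u x = w f with u outside M and x such a
  constant, then x lies in P and w in P[X,Y], because f is outside P[X,Y]. Multiplying by t gives
  the same relation for t x, so x could be divided by the uniformizer forever.\<close>

lemma prime_below_generic:
  assumes f: "f \<in> M" and M: "prime_on R2 M" "contr (contr M) \<noteq> {0}"
    and nf: "f \<notin> pol (pol (contr (contr M)))"
  shows "\<exists>Q. prime_on R2 Q \<and> f \<in> Q \<and> Q \<subset> M \<and> contr (contr Q) = {0}"
proof -
  define P where "P = contr (contr M)"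
  have P: "prime_on B P" "P \<noteq> {0}" using contr_contr_prime[OF M(1)] M(2) by (auto simp: P_def)
  have PP: "prime_on R2 (pol (pol P))"
    by (intro pol_prime subring_on_R1 subring_on_B P(1))
  obtain t p where t: "t \<in> inverse_ideal B P" "p \<in> P" "t * p \<in> B - P"
    using prime_invertible[OF P] by blast
  have tB: "t * x \<in> B" if "x \<in> P" for x using t(1) that by (simp add: inverse_ideal_def)
  have "t \<noteq> 0" using t(3) prime_onD(4)[OF P(1)] by auto
  have fR: "f \<in> R2" using f prime_onD(3)[OF M(1)] by blast
  note sB = subring_onD[OF subring_on_B]
  note s2 = subring_onD[OF subring_on_R2]
  have c2: "const2 x \<in> R2 \<longleftrightarrow> x \<in> B" for x
    using sB(1) subring_onD(1)[OF subring_on_R1] by simp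
  define L where "L = {x \<in> B - {0}. \<exists>u\<in>R2 - M. \<exists>w\<in>R2. u * const2 x = w * f}"
  have "L = {}"
  proof (rule no_infinite_division[OF subring_on_B noeth_B P(1) t(2)])
    show "L \<subseteq> B - {0}" by (auto simp: L_def)
    fix x assume x: "x \<in> L"
    then obtain u w where xB: "x \<in> B" "x \<noteq> 0" and u: "u \<in> R2 - M" and w: "w \<in> R2" "u * const2 x = w * f"
      by (auto simp: L_def)
    have "w * f \<in> M" using prime_onD(6)[OF M(1) w(1) f] .
    then have "const2 x \<in> M" using w(2) prime_onD(8)[OF M(1), of u "const2 x"] u c2 xB(1) by auto
    then have xP: "x \<in> P" by (simp add: P_def contr_iff)
    then have "const2 x \<in> pol (pol P)"
      using prime_onD(4)[OF P(1)] by (simp add: pCons_mem_pol pol_iff[of 0])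
    then have "w * f \<in> pol (pol P)" using w(2) u prime_onD(6)[OF PP, of u "const2 x"] by auto
    then have wP: "w \<in> pol (pol P)" using nf prime_onD(8)[OF PP _ w(1) fR] unfolding P_def by blast
    define w' where "w' = const2 t * w"
    have "w' \<in> R2" using wP tB by (simp add: w'_def pol_def)
    moreover have "u * const2 (t * x) = w' * f"
    proof -
      have "u * const2 (t * x) = const2 t * (u * const2 x)" by simp
      then show ?thesis unfolding w(2) w'_def by (simp only: mult.assoc)
    qed
    ultimately have "t * x \<in> L" using u tB[OF xP] xB(2) \<open>t \<noteq> 0\<close> unfolding L_def by auto
    moreover have "(t * p) * x = p * (t * x)" by (simp add: algebra_simps)
    ultimately show "\<exists>u\<in>B - P. \<exists>l'\<in>L. u * x = p * l'" using t(3) by blast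
  qed
  define I where "I = gen R2 {f}"
  have I_eq: "I = {w * f |w. w \<in> R2}" unfolding I_def by (rule gen_singleton[OF subring_on_R2 fR])
  have I: "ideal_on R2 I" unfolding I_def using fR by (intro gen_ideal[OF subring_on_R2]) simp
  define S where "S = {u * const2 x |u x. u \<in> R2 - M \<and> x \<in> B - {0}}"
  have "S \<subseteq> R2" using s2(5) c2 unfolding S_def by blast
  moreover have "1 \<in> S"
    unfolding S_def using diff_prime_one[OF subring_on_R2 M(1)] sB(2)
    by (intro CollectI exI[of _ 1]) (auto simp: one_pCons)
  moreover have "x * y \<in> S" if xy: "x \<in> S" "y \<in> S" for x y
  proof -
    obtain u s u' s' where "u \<in> R2 - M" "s \<in> B - {0}" "x = u * const2 s"
      "u' \<in> R2 - M" "s' \<in> B - {0}" "y = u' * const2 s'" using xy by (auto simp: S_def)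
    moreover from this have "x * y = (u * u') * const2 (s * s')"
      by (simp add: mult.commute mult.left_commute)
    moreover have "s * s' \<in> B - {0}" using sB(5) calculation by auto
    ultimately show ?thesis
      using diff_prime_mult[OF subring_on_R2 M(1)] unfolding S_def by blast
  qed
  moreover have "I \<inter> S = {}"
  proof (rule ccontr)
    assume "I \<inter> S \<noteq> {}"
    then obtain z where "z \<in> I" "z \<in> S" by blast
    then obtain w u x where *: "w \<in> R2" "z = w * f" "u \<in> R2 - M" "x \<in> B - {0}" "z = u * const2 x"
      unfolding I_eq S_def by (elim CollectE exE conjE)
    have "u * const2 x = w * f" using *(2,5) by simp
    then have "\<exists>u\<in>R2 - M. \<exists>w\<in>R2. u * const2 x = w * f" using *(1,3) by blast
    then have "x \<in> L" unfolding L_def using *(4) by (intro CollectI conjI)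
    then show False using \<open>L = {}\<close> by blast
  qed
  ultimately obtain Q where Q: "prime_on R2 Q" "I \<subseteq> Q" "Q \<inter> S = {}"
    using prime_avoiding[OF subring_on_R2 noeth_R2 I] by blast
  have "Q \<subseteq> M"
  proof
    fix x assume x: "x \<in> Q"
    show "x \<in> M"
    proof (rule ccontr)
      assume "x \<notin> M"
      then have "x \<in> R2 - M" using x prime_onD(3)[OF Q(1)] by blast
      moreover have "1 \<in> B - {0}" using sB(2) by simp
      ultimately have "x * const2 1 \<in> S" unfolding S_def by blast
      then show False using Q(3) x by (auto simp: one_pCons[symmetric])
    qed
  qed
  have cQ: "contr (contr Q) = {0}"
  proof
    show "{0} \<subseteq> contr (contr Q)" using prime_onD(4)[OF contr_contr_prime[OF Q(1)]] by blast
    show "contr (contr Q) \<subseteq> {0}"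
    proof
      fix x assume x: "x \<in> contr (contr Q)"
      then have "x \<in> B" using prime_onD(3)[OF contr_contr_prime[OF Q(1)]] by blast
      moreover have "1 * const2 x \<notin> S" using x Q(3) by (auto simp: contr_iff)
      ultimately show "x \<in> {0}" using diff_prime_one[OF subring_on_R2 M(1)] unfolding S_def by blast
    qed
  qed
  then have "Q \<noteq> M" using M(2) by blast
  moreover have "f \<in> Q" using Q(2) gen_superset[of "{f}" R2] by (auto simp: I_def)
  ultimately show ?thesis using Q(1) cQ \<open>Q \<subseteq> M\<close> by blast
qed

section \<open>Chains of primes through the conic\<close>

definition fchain :: "'k poly poly \<Rightarrow> 'k poly poly set \<Rightarrow> nat \<Rightarrow> (nat \<Rightarrow> 'k poly poly set) \<Rightarrow> bool" where
  "fchain f M r p \<longleftrightarrow> (\<forall>i\<le>r. prime_on R2 (p i) \<and> f \<in> p i \<and> p i \<subseteq> M) \<and> (\<forall>i<r. p i \<subset> p (Suc i))"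

lemma fchain_bound:
  assumes f: "f = conic_poly a b c" "a \<in> B" "b \<in> B" "c \<in> B"
    and M: "prime_on R2 M" and p: "fchain f M r p"
  shows "Suc r \<le> ht2 M"
proof (cases "p r = M")
  case True
  then show ?thesis using ht2_chain[OF f, of r p r] p by (simp add: fchain_def)
next
  case False
  \<comment> \<open>A chain that ends strictly below M is prolonged by M.\<close>
  define p' where "p' = p(Suc r := M)"
  have "\<forall>i\<le>Suc r. prime_on R2 (p' i)" "\<forall>i<Suc r. p' i \<subset> p' (Suc i)" "f \<in> p' 0"
    using p M False by (auto simp: fchain_def p'_def le_Suc_eq less_Suc_eq)
  from ht2_chain[OF f this, of "Suc r"] show ?thesis by (simp add: p'_def)
qed

text \<open>M is not P[X,Y], so at least one step of the tower contributes to its height. If both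
  do, a prime in the same fibre is inserted below M; if P is nonzero, one over 0 below that.\<close>

lemma ex_fchain:
  assumes f: "f = conic_poly a b c" "a \<in> B" "b \<in> B" "c \<in> B"
    and M: "prime_on R2 M" "f \<in> M"
  shows "\<exists>p. fchain f M (ht2 M - 1) p"
proof -
  have nf: "f \<notin> pol (pol (contr (contr M)))"
    unfolding f(1) by (rule conic_poly_not_mem_pol[OF subring_on_B contr_contr_prime[OF M(1)]])
  have q: "prime_on R1 (contr M)" by (rule contr_prime[OF subring_on_R1 M(1)])
  have eps: "eps M \<or> eps (contr M)"
    using not_eps[OF subring_on_R1 prime_onD(1)[OF M(1)]] not_eps[OF subring_on_B prime_onD(1)[OF q]] nf M(2)
    by metis
  have 0: "fchain f M 0 (\<lambda>_. M)" using M by (simp add: fchain_def)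
  have 1: "fchain f M 1 ((\<lambda>_. M)(0 := Q))" if "prime_on R2 Q" "f \<in> Q" "Q \<subset> M" for Q
    using M that by (auto simp: fchain_def)
  have 2: "fchain f M 2 ((\<lambda>_. M)(0 := Q, 1 := Q'))"
    if "prime_on R2 Q" "f \<in> Q" "Q \<subset> Q'" "prime_on R2 Q'" "f \<in> Q'" "Q' \<subset> M" for Q Q'
    using M that by (auto simp: fchain_def less_Suc_eq numeral_2_eq_2)
  show ?thesis
  proof (cases "contr (contr M) = {0}")
    case True
    show ?thesis
    proof (cases "eps M \<and> eps (contr M)")
      case T: True
      then have "ht2 M - 1 = 1" using True by (simp add: ht2_def ht1_def)
      moreover obtain Q where "prime_on R2 Q" "f \<in> Q" "Q \<subset> M"
        using prime_below_fibre[OF M(2,1) _ _ nf] T by blast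
      ultimately show ?thesis using 1 by metis
    next
      case False
      then have "ht2 M - 1 = 0" using True by (auto simp: ht2_def ht1_def)
      then show ?thesis using 0 by metis
    qed
  next
    case nz: False
    show ?thesis
    proof (cases "eps M \<and> eps (contr M)")
      case T: True
      then have h: "ht2 M - 1 = 2" using nz by (simp add: ht2_def ht1_def)
      obtain Q where Q: "prime_on R2 Q" "f \<in> Q" "Q \<subset> M" "contr (contr Q) = contr (contr M)"
        using prime_below_fibre[OF M(2,1) _ _ nf] T by blast
      then obtain Q' where "prime_on R2 Q'" "f \<in> Q'" "Q' \<subset> Q"
        using prime_below_generic[OF Q(2,1)] nf nz by auto
      then show ?thesis using 2[of Q' Q] Q h by metis
    next
      case False
      then have "ht2 M - 1 = 1" using nz eps by (auto simp: ht2_def ht1_def)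
      moreover obtain Q where "prime_on R2 Q" "f \<in> Q" "Q \<subset> M"
        using prime_below_generic[OF M(2,1) nz nf] by blast
      ultimately show ?thesis using 1 by metis
    qed
  qed
qed

end

section \<open>Localization\<close>

subsection \<open>Rings of fractions\<close>

locale mult_set = cring A for A (structure) +
  fixes S :: "'a set"
  assumes S_sub: "S \<subseteq> carrier A" and S_one: "\<one> \<in> S"
    and S_mult: "s \<in> S \<Longrightarrow> t \<in> S \<Longrightarrow> s \<otimes> t \<in> S"
begin

abbreviation "fr \<equiv> loc_frac A S"
abbreviation "L \<equiv> localization A S"

lemma S_carrier [simp]: "s \<in> S \<Longrightarrow> s \<in> carrier A"
  using S_sub by blast

lemmas S_simps [simp] = S_one S_mult

lemma loc_rel_iff:
  "((r, s), (r', s')) \<in> loc_rel A S \<longleftrightarrow> r \<in> carrier A \<and> s \<in> S \<and> r' \<in> carrier A \<and> s' \<in> S \<and>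
     (\<exists>u\<in>S. u \<otimes> (r \<otimes> s') = u \<otimes> (r' \<otimes> s))"
  by (simp add: loc_rel_def)

lemma loc_rel_trans:
  assumes "((r, s), (r', s')) \<in> loc_rel A S" "((r', s'), (r'', s'')) \<in> loc_rel A S"
  shows "((r, s), (r'', s'')) \<in> loc_rel A S"
proof -
  obtain u v where uv: "u \<in> S" "u \<otimes> (r \<otimes> s') = u \<otimes> (r' \<otimes> s)" "v \<in> S" "v \<otimes> (r' \<otimes> s'') = v \<otimes> (r'' \<otimes> s')"
    and c: "r \<in> carrier A" "s \<in> S" "r' \<in> carrier A" "s' \<in> S" "r'' \<in> carrier A" "s'' \<in> S"
    using assms by (auto simp: loc_rel_iff)
  have "(u \<otimes> v \<otimes> s') \<otimes> (r \<otimes> s'') = (v \<otimes> s'') \<otimes> (u \<otimes> (r \<otimes> s'))"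
    using uv(1,3) c by (simp add: m_ac)
  also have "\<dots> = (u \<otimes> s) \<otimes> (v \<otimes> (r' \<otimes> s''))"
    unfolding uv(2) using uv(1,3) c by (simp add: m_ac)
  also have "\<dots> = (u \<otimes> v \<otimes> s') \<otimes> (r'' \<otimes> s)"
    unfolding uv(4) using uv(1,3) c by (simp add: m_ac)
  finally have "(u \<otimes> v \<otimes> s') \<otimes> (r \<otimes> s'') = (u \<otimes> v \<otimes> s') \<otimes> (r'' \<otimes> s)" .
  moreover have "u \<otimes> v \<otimes> s' \<in> S" using uv c by simp
  ultimately show ?thesis using c unfolding loc_rel_iff by blast
qed

lemma loc_rel_equiv: "equiv (carrier A \<times> S) (loc_rel A S)"
proof (rule equivI)
  show "loc_rel A S \<subseteq> (carrier A \<times> S) \<times> (carrier A \<times> S)" by (auto simp: loc_rel_def)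
  show "refl_on (carrier A \<times> S) (loc_rel A S)"
    using S_one by (auto simp: refl_on_def loc_rel_def)
  show "sym (loc_rel A S)" by (auto simp: sym_def loc_rel_def) metis
  show "trans (loc_rel A S)"
    unfolding trans_def using loc_rel_trans by (auto simp: split_paired_all)
qed

lemma frac_eq_iff:
  assumes "r \<in> carrier A" "s \<in> S" "r' \<in> carrier A" "s' \<in> S"
  shows "fr r s = fr r' s' \<longleftrightarrow> (\<exists>u\<in>S. u \<otimes> (r \<otimes> s') = u \<otimes> (r' \<otimes> s))"
  unfolding loc_frac_def
  using eq_equiv_class_iff[OF loc_rel_equiv, of "(r, s)" "(r', s')"] assms by (simp add: loc_rel_iff)

lemma frac_eqI:
  assumes "r \<in> carrier A" "s \<in> S" "r' \<in> carrier A" "s' \<in> S" "r \<otimes> s' = r' \<otimes> s"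
  shows "fr r s = fr r' s'"
  unfolding frac_eq_iff[OF assms(1-4)] using assms(5) S_one by (intro bexI[of _ \<one>]) simp_all

lemma frac_mem: "(a, b) \<in> fr r s \<longleftrightarrow> ((r, s), (a, b)) \<in> loc_rel A S"
  by (simp add: loc_frac_def)

lemma frac_self: "r \<in> carrier A \<Longrightarrow> s \<in> S \<Longrightarrow> (r, s) \<in> fr r s"
  using S_one by (auto simp: frac_mem loc_rel_iff)

lemma carrier_L: "x \<in> carrier L \<longleftrightarrow> (\<exists>r\<in>carrier A. \<exists>s\<in>S. x = fr r s)"
  by (auto simp: localization_def quotient_def loc_frac_def)

lemma frac_carrier [simp]: "r \<in> carrier A \<Longrightarrow> s \<in> S \<Longrightarrow> fr r s \<in> carrier L"
  using carrier_L by blast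

lemma mult_frac:
  assumes c: "r \<in> carrier A" "s \<in> S" "r' \<in> carrier A" "s' \<in> S"
  shows "fr r s \<otimes>\<^bsub>L\<^esub> fr r' s' = fr (r \<otimes> r') (s \<otimes> s')"
proof -
  have e: "fr (a \<otimes> a') (b \<otimes> b') = fr (r \<otimes> r') (s \<otimes> s')"
    if ab: "(a, b) \<in> fr r s" "(a', b') \<in> fr r' s'" for a b a' b'
  proof -
    obtain u v where u: "a \<in> carrier A" "b \<in> S" "u \<in> S" "u \<otimes> (r \<otimes> b) = u \<otimes> (a \<otimes> s)"
      and v: "a' \<in> carrier A" "b' \<in> S" "v \<in> S" "v \<otimes> (r' \<otimes> b') = v \<otimes> (a' \<otimes> s')"
      using ab by (auto simp: frac_mem loc_rel_iff)
    have "(u \<otimes> v) \<otimes> ((r \<otimes> r') \<otimes> (b \<otimes> b')) = (u \<otimes> (r \<otimes> b)) \<otimes> (v \<otimes> (r' \<otimes> b'))"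
      using u(1-3) v(1-3) c by (simp add: m_ac)
    also have "\<dots> = (u \<otimes> v) \<otimes> ((a \<otimes> a') \<otimes> (s \<otimes> s'))"
      unfolding u(4) v(4) using u(1-3) v(1-3) c by (simp add: m_ac)
    finally have "(u \<otimes> v) \<otimes> ((a \<otimes> a') \<otimes> (s \<otimes> s')) = (u \<otimes> v) \<otimes> ((r \<otimes> r') \<otimes> (b \<otimes> b'))" ..
    then show ?thesis using u(1-3) v(1-3) c by (subst frac_eq_iff) (auto intro!: bexI[of _ "u \<otimes> v"])
  qed
  have "fr r s \<otimes>\<^bsub>L\<^esub> fr r' s' = (\<Union>x\<in>fr r s. \<Union>y\<in>fr r' s'. fr (fst x \<otimes> fst y) (snd x \<otimes> snd y))"
    by (simp add: localization_def case_prod_beta)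
  also have "\<dots> = fr (r \<otimes> r') (s \<otimes> s')"
  proof (rule UN_constant_eq[OF frac_self[OF c(1,2)]], rule ballI, rule UN_constant_eq[OF frac_self[OF c(3,4)]], rule ballI)
    fix x y assume "x \<in> fr r s" "y \<in> fr r' s'"
    then show "fr (fst x \<otimes> fst y) (snd x \<otimes> snd y) = fr (r \<otimes> r') (s \<otimes> s')"
      using e[of "fst x" "snd x" "fst y" "snd y"] by simp
  qed
  finally show ?thesis .
qed

lemma add_frac:
  assumes c: "r \<in> carrier A" "s \<in> S" "r' \<in> carrier A" "s' \<in> S"
  shows "fr r s \<oplus>\<^bsub>L\<^esub> fr r' s' = fr (r \<otimes> s' \<oplus> r' \<otimes> s) (s \<otimes> s')"
proof -
  have e: "fr (a \<otimes> b' \<oplus> a' \<otimes> b) (b \<otimes> b') = fr (r \<otimes> s' \<oplus> r' \<otimes> s) (s \<otimes> s')"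
    if ab: "(a, b) \<in> fr r s" "(a', b') \<in> fr r' s'" for a b a' b'
  proof -
    obtain u v where u: "a \<in> carrier A" "b \<in> S" "u \<in> S" "u \<otimes> (r \<otimes> b) = u \<otimes> (a \<otimes> s)"
      and v: "a' \<in> carrier A" "b' \<in> S" "v \<in> S" "v \<otimes> (r' \<otimes> b') = v \<otimes> (a' \<otimes> s')"
      using ab by (auto simp: frac_mem loc_rel_iff)
    have "(u \<otimes> v) \<otimes> ((r \<otimes> s' \<oplus> r' \<otimes> s) \<otimes> (b \<otimes> b'))
      = (u \<otimes> (r \<otimes> b)) \<otimes> (v \<otimes> s' \<otimes> b') \<oplus> (v \<otimes> (r' \<otimes> b')) \<otimes> (u \<otimes> s \<otimes> b)"
      using u(1-3) v(1-3) c by (simp add: m_ac r_distr l_distr)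
    also have "\<dots> = (u \<otimes> v) \<otimes> ((a \<otimes> b' \<oplus> a' \<otimes> b) \<otimes> (s \<otimes> s'))"
      unfolding u(4) v(4) using u(1-3) v(1-3) c by (simp add: m_ac r_distr l_distr)
    finally have "(u \<otimes> v) \<otimes> ((a \<otimes> b' \<oplus> a' \<otimes> b) \<otimes> (s \<otimes> s')) = (u \<otimes> v) \<otimes> ((r \<otimes> s' \<oplus> r' \<otimes> s) \<otimes> (b \<otimes> b'))" ..
    then show ?thesis using u(1-3) v(1-3) c by (subst frac_eq_iff) (auto intro!: bexI[of _ "u \<otimes> v"])
  qed
  have "fr r s \<oplus>\<^bsub>L\<^esub> fr r' s'
      = (\<Union>x\<in>fr r s. \<Union>y\<in>fr r' s'. fr (fst x \<otimes> snd y \<oplus> fst y \<otimes> snd x) (snd x \<otimes> snd y))"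
    by (simp add: localization_def case_prod_beta)
  also have "\<dots> = fr (r \<otimes> s' \<oplus> r' \<otimes> s) (s \<otimes> s')"
  proof (rule UN_constant_eq[OF frac_self[OF c(1,2)]], rule ballI, rule UN_constant_eq[OF frac_self[OF c(3,4)]], rule ballI)
    fix x y assume "x \<in> fr r s" "y \<in> fr r' s'"
    then show "fr (fst x \<otimes> snd y \<oplus> fst y \<otimes> snd x) (snd x \<otimes> snd y) = fr (r \<otimes> s' \<oplus> r' \<otimes> s) (s \<otimes> s')"
      using e[of "fst x" "snd x" "fst y" "snd y"] by simp
  qed
  finally show ?thesis .
qed

lemma one_L: "\<one>\<^bsub>L\<^esub> = fr \<one> \<one>" and zero_L: "\<zero>\<^bsub>L\<^esub> = fr \<zero> \<one>"
  by (simp_all add: localization_def)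

lemma cring_L: "cring L"
proof (intro cringI abelian_groupI comm_monoidI)
  fix x y assume "x \<in> carrier L" "y \<in> carrier L"
  then obtain r s r' s' where c: "r \<in> carrier A" "s \<in> S" "r' \<in> carrier A" "s' \<in> S"
    and x: "x = fr r s" "y = fr r' s'" unfolding carrier_L by blast
  show "x \<oplus>\<^bsub>L\<^esub> y \<in> carrier L" "x \<otimes>\<^bsub>L\<^esub> y \<in> carrier L"
    using c by (simp_all add: x add_frac mult_frac)
  show "x \<oplus>\<^bsub>L\<^esub> y = y \<oplus>\<^bsub>L\<^esub> x" "x \<otimes>\<^bsub>L\<^esub> y = y \<otimes>\<^bsub>L\<^esub> x"
    using c by (simp_all add: x add_frac mult_frac m_ac a_ac)
next
  fix x y z assume "x \<in> carrier L" "y \<in> carrier L" "z \<in> carrier L"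
  then obtain r s r' s' r'' s'' where c: "r \<in> carrier A" "s \<in> S" "r' \<in> carrier A" "s' \<in> S"
      "r'' \<in> carrier A" "s'' \<in> S"
    and x: "x = fr r s" "y = fr r' s'" "z = fr r'' s''" unfolding carrier_L by blast
  show "(x \<oplus>\<^bsub>L\<^esub> y) \<oplus>\<^bsub>L\<^esub> z = x \<oplus>\<^bsub>L\<^esub> (y \<oplus>\<^bsub>L\<^esub> z)"
    using c by (simp add: x add_frac mult_frac m_ac a_ac r_distr l_distr)
  show "(x \<otimes>\<^bsub>L\<^esub> y) \<otimes>\<^bsub>L\<^esub> z = x \<otimes>\<^bsub>L\<^esub> (y \<otimes>\<^bsub>L\<^esub> z)"
    using c by (simp add: x mult_frac m_ac)
  show "(x \<oplus>\<^bsub>L\<^esub> y) \<otimes>\<^bsub>L\<^esub> z = (x \<otimes>\<^bsub>L\<^esub> z) \<oplus>\<^bsub>L\<^esub> (y \<otimes>\<^bsub>L\<^esub> z)"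
  proof -
    have "(x \<oplus>\<^bsub>L\<^esub> y) \<otimes>\<^bsub>L\<^esub> z = fr ((r \<otimes> s' \<oplus> r' \<otimes> s) \<otimes> r'') (s \<otimes> s' \<otimes> s'')"
      using c by (simp add: x add_frac mult_frac)
    also have "\<dots> = fr ((r \<otimes> r'') \<otimes> (s' \<otimes> s'') \<oplus> (r' \<otimes> r'') \<otimes> (s \<otimes> s'')) ((s \<otimes> s'') \<otimes> (s' \<otimes> s''))"
      by (rule frac_eqI) (use c in \<open>simp_all add: m_ac r_distr l_distr\<close>)
    also have "\<dots> = (x \<otimes>\<^bsub>L\<^esub> z) \<oplus>\<^bsub>L\<^esub> (y \<otimes>\<^bsub>L\<^esub> z)"
      using c by (simp add: x add_frac mult_frac)
    finally show ?thesis .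
  qed
next
  fix x assume "x \<in> carrier L"
  then obtain r s where c: "r \<in> carrier A" "s \<in> S" and x: "x = fr r s" unfolding carrier_L by blast
  show "\<one>\<^bsub>L\<^esub> \<otimes>\<^bsub>L\<^esub> x = x" using c by (simp add: x one_L mult_frac)
  show "\<zero>\<^bsub>L\<^esub> \<oplus>\<^bsub>L\<^esub> x = x" using c by (simp add: x zero_L add_frac)
  have "fr (\<ominus> r) s \<oplus>\<^bsub>L\<^esub> x = fr \<zero> (s \<otimes> s)"
    using c by (simp add: x add_frac l_minus l_neg)
  also have "\<dots> = \<zero>\<^bsub>L\<^esub>" unfolding zero_L by (rule frac_eqI) (use c in simp_all)
  finally have "fr (\<ominus> r) s \<oplus>\<^bsub>L\<^esub> x = \<zero>\<^bsub>L\<^esub>" .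
  then show "\<exists>y\<in>carrier L. y \<oplus>\<^bsub>L\<^esub> x = \<zero>\<^bsub>L\<^esub>" using c by (intro bexI[of _ "fr (\<ominus> r) s"]) simp_all
qed (simp_all add: one_L zero_L)

end

subsection \<open>Local rings presented by fractions\<close>

text \<open>\<open>L\<close> is the localization of \<open>R/I\<close> at \<open>M/I\<close>, and \<open>\<theta>\<close> is the canonical map \<open>R \<rightarrow> L\<close>.\<close>

locale local_presentation = L: cring L for L (structure) +
  fixes R I M :: "'r::comm_ring_1 set" and \<theta> :: "'r \<Rightarrow> 'a"
  assumes R: "subring_on R" and M: "prime_on R M" and I: "ideal_on R I" "I \<subseteq> M"
    and \<theta>_carrier: "p \<in> R \<Longrightarrow> \<theta> p \<in> carrier L"
    and \<theta>_add: "p \<in> R \<Longrightarrow> q \<in> R \<Longrightarrow> \<theta> (p + q) = \<theta> p \<oplus> \<theta> q"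
    and \<theta>_mult: "p \<in> R \<Longrightarrow> q \<in> R \<Longrightarrow> \<theta> (p * q) = \<theta> p \<otimes> \<theta> q"
    and \<theta>_one: "\<theta> 1 = \<one>"
    and \<theta>_surj: "x \<in> carrier L \<Longrightarrow> \<exists>p\<in>R. \<exists>u\<in>R - M. x \<otimes> \<theta> u = \<theta> p"
    and \<theta>_unit: "u \<in> R - M \<Longrightarrow> \<theta> u \<in> Units L"
    and \<theta>_zero: "p \<in> R \<Longrightarrow> \<theta> p = \<zero> \<longleftrightarrow> (\<exists>u\<in>R - M. u * p \<in> I)"
begin

definition pre :: "'a set \<Rightarrow> 'r set" where
  "pre J = {p \<in> R. \<theta> p \<in> J}"

definition ext :: "'r set \<Rightarrow> 'a set" where
  "ext G = {x \<in> carrier L. \<exists>p\<in>G. \<exists>u\<in>R - M. x \<otimes> \<theta> u = \<theta> p}"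

lemmas R_simps = subring_onD[OF R]

lemma \<theta>_null: "\<theta> 0 = \<zero>"
  using \<theta>_zero[of 0] R_simps(1) ideal_onD(2)[OF I(1)] diff_prime_one[OF R M] by (auto intro!: bexI[of _ 1])

lemma \<theta>_minus: "p \<in> R \<Longrightarrow> \<theta> (- p) = \<ominus> \<theta> p"
  using \<theta>_add[of "- p" p] R_simps(4) \<theta>_null \<theta>_carrier by (intro L.minus_equality[symmetric]) auto

lemma \<theta>_eq:
  assumes "p \<in> R" "q \<in> R" "\<theta> p = \<theta> q"
  shows "\<exists>u\<in>R - M. u * (p - q) \<in> I"
proof -
  have "\<theta> (p - q) = \<theta> p \<oplus> \<ominus> \<theta> q"
    using \<theta>_add[of p "- q"] \<theta>_minus[of q] assms R_simps(4) by simp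
  then have "\<theta> (p - q) = \<zero>" using assms \<theta>_carrier by (simp add: L.r_neg)
  then show ?thesis using \<theta>_zero R_simps(6) assms by blast
qed

lemma unit_cancel:
  assumes J: "ideal J L" and u: "u \<in> R - M" and x: "x \<in> carrier L" "x \<otimes> \<theta> u \<in> J"
  shows "x \<in> J"
proof -
  have U: "\<theta> u \<in> Units L" by (rule \<theta>_unit[OF u])
  have "(x \<otimes> \<theta> u) \<otimes> inv \<theta> u \<in> J"
    using ideal.I_r_closed[OF J x(2)] U by blast
  moreover have "(x \<otimes> \<theta> u) \<otimes> inv \<theta> u = x"
    using U x(1) by (simp add: L.m_assoc L.Units_closed)
  ultimately show ?thesis by simp
qed

lemma pre_ideal:
  assumes J: "ideal J L"
  shows "ideal_on R (pre J)" "I \<subseteq> pre J"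
proof -
  interpret J: ideal J L by (rule J)
  show "ideal_on R (pre J)"
    unfolding ideal_on_def pre_def
    using R_simps \<theta>_null \<theta>_add \<theta>_mult \<theta>_carrier J.I_l_closed by auto
  show "I \<subseteq> pre J"
  proof
    fix p assume p: "p \<in> I"
    then have "p \<in> R" using ideal_onD(1)[OF I(1)] by blast
    moreover from this have "\<theta> p = \<zero>"
      using \<theta>_zero p diff_prime_one[OF R M] by (auto intro!: bexI[of _ 1])
    ultimately show "p \<in> pre J" by (simp add: pre_def)
  qed
qed

lemma ext_ideal:
  assumes G: "ideal_on R G"
  shows "ideal (ext G) L"
proof (rule idealI)
  show "ring L" by (rule L.ring_axioms)
  have GR: "G \<subseteq> R" by (rule ideal_onD(1)[OF G])
  have smult: "a \<otimes> x \<in> ext G" if a: "a \<in> carrier L" and x: "x \<in> ext G" for a x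
  proof -
    obtain p u where x: "x \<in> carrier L" "p \<in> G" "u \<in> R - M" "x \<otimes> \<theta> u = \<theta> p" using x by (auto simp: ext_def)
    obtain q v where q: "q \<in> R" "v \<in> R - M" "a \<otimes> \<theta> v = \<theta> q" using \<theta>_surj[OF a] by blast
    have uv: "v * u \<in> R - M" by (rule diff_prime_mult[OF R M q(2) x(3)])
    have "(a \<otimes> x) \<otimes> \<theta> (v * u) = (a \<otimes> \<theta> v) \<otimes> (x \<otimes> \<theta> u)"
      using a x(1,3) q(2) by (simp add: \<theta>_mult \<theta>_carrier L.m_ac)
    also have "\<dots> = \<theta> (q * p)" unfolding q(3) x(4) using q(1) x(2) GR by (simp add: \<theta>_mult subset_iff)
    finally show ?thesis using a x(1) uv ideal_onD(4)[OF G q(1) x(2)] unfolding ext_def by blast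
  qed
  show "subgroup (ext G) (add_monoid L)"
  proof (rule L.add.subgroupI)
    show "ext G \<subseteq> carrier L" by (auto simp: ext_def)
    have "\<zero> \<in> ext G"
      unfolding ext_def using ideal_onD(2)[OF G] diff_prime_one[OF R M] \<theta>_null \<theta>_carrier
      by (intro CollectI conjI bexI[of _ 0] bexI[of _ 1]) auto
    then show "ext G \<noteq> {}" by blast
  next
    fix x assume x: "x \<in> ext G"
    then have xL: "x \<in> carrier L" by (simp add: ext_def)
    have "\<ominus> x = (\<ominus> \<one>) \<otimes> x" using xL by (simp add: L.l_minus)
    then show "\<ominus> x \<in> ext G" using smult[OF _ x, of "\<ominus> \<one>"] by simp
  next
    fix x y assume "x \<in> ext G" "y \<in> ext G"
    then obtain p u q v where x: "x \<in> carrier L" "p \<in> G" "u \<in> R - M" "x \<otimes> \<theta> u = \<theta> p"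
      and y: "y \<in> carrier L" "q \<in> G" "v \<in> R - M" "y \<otimes> \<theta> v = \<theta> q" by (auto simp: ext_def)
    have uv: "u * v \<in> R - M" by (rule diff_prime_mult[OF R M x(3) y(3)])
    have "(x \<oplus> y) \<otimes> \<theta> (u * v) = (x \<otimes> \<theta> u) \<otimes> \<theta> v \<oplus> (y \<otimes> \<theta> v) \<otimes> \<theta> u"
      using x(1,3) y(1,3) by (simp add: \<theta>_mult \<theta>_carrier L.m_ac L.l_distr L.r_distr)
    also have "\<dots> = \<theta> (p * v + q * u)"
      unfolding x(4) y(4) using x(2,3) y(2,3) GR R_simps(5) by (simp add: \<theta>_mult \<theta>_add subset_iff)
    finally have "(x \<oplus> y) \<otimes> \<theta> (u * v) = \<theta> (p * v + q * u)" .
    moreover have "p * v + q * u \<in> G" using x(2,3) y(2,3) ideal_onD(3,5)[OF G] by simp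
    ultimately show "x \<oplus> y \<in> ext G" using uv x(1) y(1) unfolding ext_def by blast
  qed
  show "a \<otimes> x \<in> ext G" "x \<otimes> a \<in> ext G" if "x \<in> ext G" "a \<in> carrier L" for a x
  proof -
    show 1: "a \<otimes> x \<in> ext G" by (rule smult[OF that(2,1)])
    have "x \<in> carrier L" using that(1) by (simp add: ext_def)
    then show "x \<otimes> a \<in> ext G" using 1 that(2) by (simp add: L.m_comm)
  qed
qed

lemma \<theta>_in_ext: "G \<subseteq> R \<Longrightarrow> p \<in> G \<Longrightarrow> \<theta> p \<in> ext G"
  using \<theta>_carrier[of p] \<theta>_one diff_prime_one[OF R M] unfolding ext_def
  by (intro CollectI conjI bexI[of _ p] bexI[of _ 1]) auto

lemma \<theta>_mem_ext:
  assumes G: "ideal_on R G" "I \<subseteq> G" and p: "p \<in> R"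
  shows "\<theta> p \<in> ext G \<longleftrightarrow> (\<exists>u\<in>R - M. u * p \<in> G)"
proof
  have GR: "G \<subseteq> R" by (rule ideal_onD(1)[OF G(1)])
  assume "\<theta> p \<in> ext G"
  then obtain q u where q: "q \<in> G" "u \<in> R - M" "\<theta> p \<otimes> \<theta> u = \<theta> q" by (auto simp: ext_def)
  then have "\<theta> (p * u) = \<theta> q" using p by (simp add: \<theta>_mult)
  then obtain v where v: "v \<in> R - M" "v * (p * u - q) \<in> I"
    using \<theta>_eq[of "p * u" q] p q GR R_simps(5) by blast
  have "v * (p * u - q) + v * q \<in> G"
    using v G q ideal_onD(3,4)[OF G(1)] by blast
  moreover have "v * (p * u - q) + v * q = (v * u) * p" by (simp add: algebra_simps)
  ultimately show "\<exists>u\<in>R - M. u * p \<in> G" using diff_prime_mult[OF R M v(1) q(2)] by metis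
next
  assume "\<exists>u\<in>R - M. u * p \<in> G"
  then obtain u where u: "u \<in> R - M" "u * p \<in> G" by blast
  have "\<theta> p \<otimes> \<theta> u = \<theta> (u * p)" using u p by (simp add: \<theta>_mult \<theta>_carrier L.m_comm)
  then show "\<theta> p \<in> ext G" using u \<theta>_carrier[OF p] unfolding ext_def by blast
qed

lemma ext_pre:
  assumes J: "ideal J L"
  shows "ext (pre J) = J"
proof
  have JL: "J \<subseteq> carrier L" by (rule ideal.Icarr[OF J, THEN subsetI])
  show "ext (pre J) \<subseteq> J" using unit_cancel[OF J] by (auto simp: ext_def pre_def)
  show "J \<subseteq> ext (pre J)"
  proof
    fix x assume x: "x \<in> J"
    then obtain p u where pu: "p \<in> R" "u \<in> R - M" "x \<otimes> \<theta> u = \<theta> p" using \<theta>_surj JL by blast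
    then have "\<theta> p \<in> J" using ideal.I_r_closed[OF J x, of "\<theta> u"] \<theta>_carrier by simp
    then show "x \<in> ext (pre J)" using x JL pu unfolding ext_def pre_def by blast
  qed
qed

text \<open>Members of J are fractions with numerators in \<open>pre J\<close>, and I maps to 0.
  Generating the numerators modulo I and up to denominators is therefore enough.\<close>

lemma genideal_local:
  assumes J: "ideal J L" and T: "T \<subseteq> R" and g: "\<And>p. p \<in> pre J \<Longrightarrow> \<exists>u\<in>R - M. u * p \<in> gen R (T \<union> I)" "\<theta> ` T \<subseteq> J"
  shows "J = Idl (\<theta> ` T)"
proof
  have TL: "\<theta> ` T \<subseteq> carrier L" using T \<theta>_carrier by blast
  have K: "ideal (Idl (\<theta> ` T)) L" by (rule L.genideal_ideal[OF TL])
  show "Idl (\<theta> ` T) \<subseteq> J" by (rule L.genideal_minimal[OF J g(2)])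
  have "T \<subseteq> pre (Idl (\<theta> ` T))" using L.genideal_self[OF TL] T by (auto simp: pre_def)
  then have sub: "gen R (T \<union> I) \<subseteq> pre (Idl (\<theta> ` T))"
    using pre_ideal[OF K] by (intro gen_minimal) auto
  have TI: "ideal_on R (gen R (T \<union> I))" "I \<subseteq> gen R (T \<union> I)"
    using T ideal_onD(1)[OF I(1)] gen_superset[of "T \<union> I" R] by (auto intro!: gen_ideal[OF R])
  show "J \<subseteq> Idl (\<theta> ` T)"
  proof
    fix x assume "x \<in> J"
    then have "x \<in> ext (pre J)" using ext_pre[OF J] by simp
    then obtain p u where p: "x \<in> carrier L" "p \<in> pre J" "u \<in> R - M" "x \<otimes> \<theta> u = \<theta> p" by (auto simp: ext_def)
    obtain v where v: "v \<in> R - M" "v * p \<in> gen R (T \<union> I)" using g(1)[OF p(2)] by blast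
    have pR: "p \<in> R" using p(2) by (simp add: pre_def)
    have "\<theta> p \<otimes> \<theta> v \<in> Idl (\<theta> ` T)"
      using v sub pR by (auto simp: pre_def \<theta>_mult \<theta>_carrier L.m_comm)
    then have "\<theta> p \<in> Idl (\<theta> ` T)" by (rule unit_cancel[OF K v(1) \<theta>_carrier[OF pR]])
    then show "x \<in> Idl (\<theta> ` T)" using unit_cancel[OF K p(3,1)] p(4) by simp
  qed
qed

lemma noetherian_local:
  assumes "noeth R"
  shows "noetherian_ring L"
proof (rule L.noetherian_ringI)
  fix J assume J: "ideal J L"
  obtain T where T: "finite T" "T \<subseteq> pre J" "pre J = gen R T"
    using assms pre_ideal(1)[OF J] unfolding noeth_def by blast
  have "J = Idl (\<theta> ` T)"
  proof (rule genideal_local[OF J])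
    show "T \<subseteq> R" "\<theta> ` T \<subseteq> J" using T(2) by (auto simp: pre_def)
    fix p assume "p \<in> pre J"
    then have "p \<in> gen R (T \<union> I)" using T(3) by (auto simp: gen_def)
    then show "\<exists>u\<in>R - M. u * p \<in> gen R (T \<union> I)" using diff_prime_one[OF R M] by (intro bexI[of _ 1]) auto
  qed
  moreover have "\<theta> ` T \<subseteq> carrier L" using T(2) \<theta>_carrier by (auto simp: pre_def)
  ultimately show "\<exists>A\<subseteq>carrier L. finite A \<and> J = Idl A" using T(1) by blast
qed

lemma ideal_subset_ext:
  assumes J: "ideal J L" "\<one> \<notin> J"
  shows "J \<subseteq> ext M" "pre J \<subseteq> M"
proof -
  show "pre J \<subseteq> M"
  proof
    fix p assume p: "p \<in> pre J"
    show "p \<in> M"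
    proof (rule ccontr)
      assume "p \<notin> M"
      then have "p \<in> R - M" using p by (simp add: pre_def)
      moreover have "\<one> \<otimes> \<theta> p \<in> J" using p \<theta>_carrier by (simp add: pre_def)
      ultimately show False using unit_cancel[OF J(1) _ L.one_closed] J(2) by blast
    qed
  qed
  then have "ext (pre J) \<subseteq> ext M" by (auto simp: ext_def)
  then show "J \<subseteq> ext M" using ext_pre[OF J(1)] by simp
qed

lemma pre_ext:
  assumes Q: "prime_on R Q" "I \<subseteq> Q" "Q \<subseteq> M"
  shows "pre (ext Q) = Q"
proof
  show "Q \<subseteq> pre (ext Q)"
    using prime_onD(3)[OF Q(1)] \<theta>_in_ext by (auto simp: pre_def)
  show "pre (ext Q) \<subseteq> Q"
  proof
    fix p assume "p \<in> pre (ext Q)"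
    then obtain u where "p \<in> R" "u \<in> R - M" "u * p \<in> Q"
      using \<theta>_mem_ext[OF prime_onD(1)[OF Q(1)] Q(2)] by (auto simp: pre_def)
    then show "p \<in> Q" using prime_onD(8)[OF Q(1)] Q(3) by blast
  qed
qed

lemma ext_prime:
  assumes Q: "prime_on R Q" "I \<subseteq> Q" "Q \<subseteq> M"
  shows "primeideal (ext Q) L"
proof (rule primeidealI)
  show id: "ideal (ext Q) L" by (rule ext_ideal[OF prime_onD(1)[OF Q(1)]])
  show "cring L" by (rule L.cring_axioms)
  have "\<theta> 1 \<notin> ext Q"
    using pre_ext[OF Q] prime_onD(2)[OF Q(1)] R_simps(2) by (auto simp: pre_def)
  then show "carrier L \<noteq> ext Q" using \<theta>_one by auto
  fix x y assume xy: "x \<in> carrier L" "y \<in> carrier L" "x \<otimes> y \<in> ext Q"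
  obtain p u where p: "p \<in> R" "u \<in> R - M" "x \<otimes> \<theta> u = \<theta> p" using \<theta>_surj[OF xy(1)] by blast
  obtain q v where q: "q \<in> R" "v \<in> R - M" "y \<otimes> \<theta> v = \<theta> q" using \<theta>_surj[OF xy(2)] by blast
  have "\<theta> (p * q) = (x \<otimes> \<theta> u) \<otimes> (y \<otimes> \<theta> v)" using p q by (simp add: \<theta>_mult)
  also have "\<dots> = (x \<otimes> y) \<otimes> (\<theta> u \<otimes> \<theta> v)" using xy p(2) q(2) \<theta>_carrier by (simp add: L.m_ac)
  also have "\<dots> \<in> ext Q" using ideal.I_r_closed[OF id xy(3)] p(2) q(2) \<theta>_carrier by simp
  finally have "p * q \<in> pre (ext Q)" using p q R_simps(5) by (simp add: pre_def)
  then have "p \<in> pre (ext Q) \<or> q \<in> pre (ext Q)" using pre_ext[OF Q] prime_onD(8)[OF Q(1)] p(1) q(1) by simp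
  then show "x \<in> ext Q \<or> y \<in> ext Q"
    using unit_cancel[OF id p(2) xy(1)] unit_cancel[OF id q(2) xy(2)] p(3) q(3) by (auto simp: pre_def)
qed

lemma pre_prime:
  assumes J: "primeideal J L"
  shows "prime_on R (pre J)" "I \<subseteq> pre J" "pre J \<subseteq> M"
proof -
  interpret J: primeideal J L by (rule J)
  have one: "\<one> \<notin> J" using J.one_imp_carrier J.I_notcarr by blast
  show "I \<subseteq> pre J" by (rule pre_ideal(2)[OF J.ideal_axioms])
  show "pre J \<subseteq> M" by (rule ideal_subset_ext(2)[OF J.ideal_axioms one])
  show "prime_on R (pre J)"
    unfolding prime_on_def
  proof (intro conjI ballI impI)
    show "ideal_on R (pre J)" by (rule pre_ideal(1)[OF J.ideal_axioms])
    show "1 \<notin> pre J" using one \<theta>_one by (simp add: pre_def)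
    show "x \<in> pre J \<or> y \<in> pre J" if "x \<in> R" "y \<in> R" "x * y \<in> pre J" for x y
      using that J.I_prime[of "\<theta> x" "\<theta> y"] \<theta>_carrier by (auto simp: pre_def \<theta>_mult)
  qed
qed

lemma maximal_ext_M: "maximalideal J L \<longleftrightarrow> J = ext M"
proof -
  have P: "primeideal (ext M) L" by (rule ext_prime[OF M I(2) subset_refl])
  interpret P: primeideal "ext M" L by (rule P)
  have one: "\<one> \<notin> ext M" using P.one_imp_carrier P.I_notcarr by blast
  show ?thesis
  proof
    assume "maximalideal J L"
    then interpret J: maximalideal J L .
    have "\<one> \<notin> J" using J.one_imp_carrier J.I_notcarr by blast
    then have "J \<subseteq> ext M" by (rule ideal_subset_ext(1)[OF J.ideal_axioms])
    then show "J = ext M" using J.I_maximal[OF P.ideal_axioms] P.I_notcarr P.Icarr by blast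
  next
    assume J: "J = ext M"
    show "maximalideal J L"
      unfolding J
    proof (rule maximalidealI)
      show "ideal (ext M) L" by (rule P.ideal_axioms)
      show "carrier L \<noteq> ext M" using P.I_notcarr by blast
      fix K assume K: "ideal K L" "ext M \<subseteq> K" "K \<subseteq> carrier L"
      show "K = ext M \<or> K = carrier L"
      proof (cases "\<one> \<in> K")
        case True
        then show ?thesis using ideal.one_imp_carrier[OF K(1)] by blast
      next
        case False
        then show ?thesis using ideal_subset_ext(1)[OF K(1)] K(2) by blast
      qed
    qed
  qed
qed

text \<open>\<open>pre\<close> and \<open>ext\<close> are mutually inverse between the primes of L
  and the primes of R between I and M, and they preserve strict inclusion, so chains
  correspond.\<close>

lemma krull_dim_eq:
  assumes bound: "\<And>r p. (\<forall>i\<le>r. prime_on R (p i) \<and> I \<subseteq> p i \<and> p i \<subseteq> M) \<Longrightarrow> (\<forall>i<r. p i \<subset> p (Suc i)) \<Longrightarrow> r \<le> n"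
    and ex: "\<exists>p. (\<forall>i\<le>n. prime_on R (p i) \<and> I \<subseteq> p i \<and> p i \<subseteq> M) \<and> (\<forall>i<n. p i \<subset> p (Suc i))"
  shows "krull_dim L = enat n"
  unfolding krull_dim_def
proof (rule antisym)
  let ?N = "{n. \<exists>p :: nat \<Rightarrow> 'a set. (\<forall>i\<le>n. primeideal (p i) L) \<and> (\<forall>i<n. p i \<subset> p (Suc i))}"
  show "(SUP n\<in>?N. enat n) \<le> enat n"
  proof (rule SUP_least)
    fix r assume "r \<in> ?N"
    then obtain p where p: "\<forall>i\<le>r. primeideal (p i) L" "\<forall>i<r. p i \<subset> p (Suc i)" by blast
    have 1: "\<forall>i\<le>r. prime_on R (pre (p i)) \<and> I \<subseteq> pre (p i) \<and> pre (p i) \<subseteq> M" using p(1) pre_prime by blast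
    have 2: "\<forall>i<r. pre (p i) \<subset> pre (p (Suc i))"
    proof (intro allI impI)
      fix i assume i: "i < r"
      have e: "ext (pre (p i)) = p i" "ext (pre (p (Suc i))) = p (Suc i)"
        using p(1) i by (simp_all add: ext_pre primeideal.axioms(1))
      have "pre (p i) \<subseteq> pre (p (Suc i))" using p(2) i by (auto simp: pre_def)
      moreover have "pre (p i) \<noteq> pre (p (Suc i))" using e p(2) i by (metis psubsetE subset_refl)
      ultimately show "pre (p i) \<subset> pre (p (Suc i))" by blast
    qed
    show "enat r \<le> enat n" using bound[OF 1 2] by simp
  qed
  obtain p where p: "\<forall>i\<le>n. prime_on R (p i) \<and> I \<subseteq> p i \<and> p i \<subseteq> M" "\<forall>i<n. p i \<subset> p (Suc i)" using ex by blast
  have 1: "\<forall>i\<le>n. primeideal (ext (p i)) L" using p(1) ext_prime by blast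
  have 2: "\<forall>i<n. ext (p i) \<subset> ext (p (Suc i))"
  proof (intro allI impI)
    fix i assume i: "i < n"
    have e: "pre (ext (p i)) = p i" "pre (ext (p (Suc i))) = p (Suc i)"
      using p(1) i by (simp_all add: pre_ext)
    have "ext (p i) \<subseteq> ext (p (Suc i))" using p(2) i by (auto simp: ext_def)
    moreover have "ext (p i) \<noteq> ext (p (Suc i))" using e p(2) i by (metis psubsetE subset_refl)
    ultimately show "ext (p i) \<subset> ext (p (Suc i))" by blast
  qed
  have "n \<in> ?N" using 1 2 by (intro CollectI exI[of _ "\<lambda>i. ext (p i)"] conjI)
  then show "enat n \<le> (SUP n\<in>?N. enat n)" by (rule SUP_upper)
qed

lemma regular_iff:
  assumes "noeth R" "krull_dim L = enat n"
  shows "regular_local_ring L \<longleftrightarrow> (\<exists>S. finite S \<and> S \<subseteq> carrier L \<and> Idl S = ext M \<and> card S = n)"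
proof -
  have "\<exists>!m. maximalideal m L" unfolding maximal_ext_M by blast
  then show ?thesis
    unfolding regular_local_ring_def maximal_ext_M assms(2) enat.inject
    using L.cring_axioms noetherian_local[OF assms(1)] by auto
qed

text \<open>Denominators are units, so generators of the maximal ideal can be replaced by their
  numerators.\<close>

lemma ext_M_generators:
  assumes S: "finite S" "S \<subseteq> carrier L" "Idl S = ext M"
  shows "\<exists>T. finite T \<and> T \<subseteq> M \<and> card T \<le> card S \<and> (\<forall>x\<in>M. \<exists>u\<in>R - M. u * x \<in> gen R (T \<union> I))"
proof -
  have "\<forall>s\<in>S. \<exists>p. \<exists>u. p \<in> M \<and> u \<in> R - M \<and> s \<otimes> \<theta> u = \<theta> p"
  proof
    fix s assume "s \<in> S"
    then have "s \<in> ext M" using L.genideal_self[OF S(2)] S(3) by blast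
    then show "\<exists>p. \<exists>u. p \<in> M \<and> u \<in> R - M \<and> s \<otimes> \<theta> u = \<theta> p" unfolding ext_def by blast
  qed
  then obtain p u where pu: "\<And>s. s \<in> S \<Longrightarrow> p s \<in> M \<and> u s \<in> R - M \<and> s \<otimes> \<theta> (u s) = \<theta> (p s)" by metis
  define T where "T = p ` S"
  have TM: "T \<subseteq> M" using pu by (auto simp: T_def)
  have TR: "T \<union> I \<subseteq> R" using TM prime_onD(3)[OF M] ideal_onD(1)[OF I(1)] by blast
  have G: "ideal_on R (gen R (T \<union> I))" by (rule gen_ideal[OF R TR])
  have sup: "T \<union> I \<subseteq> gen R (T \<union> I)" by (rule gen_superset)
  have "S \<subseteq> ext (gen R (T \<union> I))"
  proof
    fix s assume s: "s \<in> S"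
    have "p s \<in> gen R (T \<union> I)" using sup s by (auto simp: T_def)
    then show "s \<in> ext (gen R (T \<union> I))" using pu[OF s] s S(2) unfolding ext_def by blast
  qed
  then have sub: "ext M \<subseteq> ext (gen R (T \<union> I))" unfolding S(3)[symmetric] by (rule L.genideal_minimal[OF ext_ideal[OF G]])
  have "\<exists>u\<in>R - M. u * x \<in> gen R (T \<union> I)" if x: "x \<in> M" for x
  proof -
    have xR: "x \<in> R" using x prime_onD(3)[OF M] by blast
    have "\<theta> x \<in> ext M"
      by (rule \<theta>_in_ext[OF prime_onD(3)[OF M] x])
    then have "\<theta> x \<in> ext (gen R (T \<union> I))" using sub by blast
    then show ?thesis using \<theta>_mem_ext[OF G _ xR] sup by blast
  qed
  moreover have "finite T" "card T \<le> card S" using S(1) by (auto simp: T_def card_image_le)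
  ultimately show ?thesis using TM by blast
qed

text \<open>A generating set with too few elements is padded to one with exactly \<open>n\<close> elements.\<close>

lemma ext_M_generated:
  assumes T: "finite T" "T \<subseteq> M" "card T \<le> n" and g: "\<And>x. x \<in> M \<Longrightarrow> \<exists>u\<in>R - M. u * x \<in> gen R (T \<union> I)"
    and large: "n \<ge> 1 \<Longrightarrow> ext M \<noteq> {\<zero>}" "n \<le> 2"
  shows "\<exists>S. finite S \<and> S \<subseteq> carrier L \<and> Idl S = ext M \<and> card S = n"
proof -
  have P: "ideal (ext M) L" by (rule ext_ideal[OF prime_onD(1)[OF M]])
  have mL: "ext M \<subseteq> carrier L" by (auto simp: ext_def)
  have TR: "T \<subseteq> R" using T(2) prime_onD(3)[OF M] by blast
  have TM: "\<theta> ` T \<subseteq> ext M"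
    using \<theta>_in_ext[OF prime_onD(3)[OF M]] T(2) by blast
  have "ext M = Idl (\<theta> ` T)"
    using g pre_ext[OF M I(2) subset_refl] by (intro genideal_local[OF P TR _ TM]) simp
  have "\<exists>S. \<theta> ` T \<subseteq> S \<and> S \<subseteq> ext M \<and> finite S \<and> card S = n"
  proof (cases "finite (ext M)")
    case True
    \<comment> \<open>A finite maximal ideal might be too small for padding; with n \<le> 2, zero
      and one nonzero element suffice.\<close>
    have "n \<le> card (ext M)"
    proof (cases "n = 0")
      case False
      then obtain x where "x \<in> ext M" "x \<noteq> \<zero>" using large(1) additive_subgroup.zero_closed[OF ideal.axioms(1)[OF P]] by auto
      then have "card {x, \<zero>} \<le> card (ext M)"
        using True additive_subgroup.zero_closed[OF ideal.axioms(1)[OF P]] by (intro card_mono) auto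
      then show ?thesis using \<open>x \<noteq> \<zero>\<close> large(2) by simp
    qed simp
    moreover have "card (\<theta> ` T) \<le> n" using T card_image_le[of T \<theta>] by simp
    ultimately show ?thesis
      using exists_subset_between[OF _ _ TM True] finite_subset[OF _ True] by metis
  next
    case False
    have c: "card (\<theta> ` T) \<le> n" using T card_image_le[of T \<theta>] by simp
    have fT: "finite (\<theta> ` T)" using T(1) by simp
    have "infinite (ext M - \<theta> ` T)" using False fT by simp
    from infinite_arbitrarily_large[OF this, of "n - card (\<theta> ` T)"]
    obtain Z where Z: "finite Z" "card Z = n - card (\<theta> ` T)" "Z \<subseteq> ext M - \<theta> ` T"
      by (elim exE conjE)
    have "\<theta> ` T \<inter> Z = {}" using Z(3) by blast
    then have "card (\<theta> ` T \<union> Z) = n" using c fT Z by (simp add: card_Un_disjoint)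
    then show ?thesis using Z(1,3) fT TM by (intro exI[of _ "\<theta> ` T \<union> Z"]) blast
  qed
  then obtain S where S: "\<theta> ` T \<subseteq> S" "S \<subseteq> ext M" "finite S" "card S = n" by blast
  have "Idl S = ext M"
  proof
    show "Idl S \<subseteq> ext M" by (rule L.genideal_minimal[OF P S(2)])
    have SL: "S \<subseteq> carrier L" using S(2) mL by blast
    have "Idl (\<theta> ` T) \<subseteq> Idl S"
      using L.genideal_self[OF SL] S(1) by (intro L.genideal_minimal L.genideal_ideal SL) blast
    then show "ext M \<subseteq> Idl S" using \<open>ext M = Idl (\<theta> ` T)\<close> by simp
  qed
  then show ?thesis using S(3,4) subset_trans[OF S(2) mL] by (intro exI[of _ S] conjI)
qed

end

section \<open>The conic\<close>

subsection \<open>The singular primes of the conic\<close>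

text \<open>Opaque copies of the abbreviations: the simplifier does not evaluate them as coefficient
  lists, so polynomial identities can be left to \<open>algebra_simps\<close>.\<close>

definition cst :: "'c::comm_ring_1 \<Rightarrow> 'c poly poly" where "cst r = const2 r"
definition vX :: "'c::comm_ring_1 poly poly" where "vX = varX"
definition vY :: "'c::comm_ring_1 poly poly" where "vY = varY"

lemma cst_hom: "cst (r + s) = cst r + cst s" "cst (r - s) = cst r - cst s" "cst (r * s) = cst r * cst s"
  "cst (- r) = - cst r" "cst 1 = 1" "cst (r ^ n) = cst r ^ n" "cst 2 = 2"
proof -
  show *: "cst (r + s) = cst r + cst s" "cst (r - s) = cst r - cst s" "cst (r * s) = cst r * cst s"
    "cst (- r) = - cst r" "cst 1 = 1" for r s
    by (simp_all add: cst_def mult.commute one_pCons)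
  show "cst (r ^ n) = cst r ^ n" by (induction n) (simp_all add: *)
  show "cst 2 = 2" using *(1)[of 1 1] by (simp add: *(5))
qed

lemma conic_poly_eq: "conic_poly a b c = cst a * vX\<^sup>2 + cst b * vX * vY + cst c * vY\<^sup>2 - 1"
  by (simp add: conic_poly_def cst_def vX_def vY_def power2_eq_square one_pCons)

lemma pderiv_conic_poly: "pderiv (conic_poly a b c) = cst b * vX + 2 * cst c * vY"
proof -
  have "pderiv (conic_poly a b c) = cst b * vX + cst (2 * c) * vY"
    by (simp add: conic_poly_def cst_def vX_def vY_def pderiv_pCons)
  then show ?thesis by (simp add: cst_hom)
qed

lemma swp_cst: "swp (cst r) = cst r" and swp_vX: "swp vX = vY" and swp_vY: "swp vY = vX"
  by (rule poly_poly_eqI; simp add: coeff_swp cst_def vX_def vY_def coeff_pCons one_pCons split: nat.split)+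

lemma swp_2: "swp 2 = 2"
  using swp_cst[of 2] by (simp add: cst_hom)

text \<open>By the Leibniz rule D maps Q^2 into Q. A denominator u does no harm, since D (u x) = u D
  x + x D u and x lies in Q.\<close>

lemma derivation_lsq:
  assumes C: "subring_on C" and Q: "prime_on C Q"
    and D: "\<And>x y. D (x + y) = D x + D y" "\<And>x y. D (x * y) = x * D y + y * D x" "\<And>x. x \<in> C \<Longrightarrow> D x \<in> C"
    and x: "x \<in> lsq C Q"
  shows "D x \<in> Q"
proof -
  note s = subring_onD[OF C]
  note q = prime_onD[OF Q]
  have D0: "D 0 = 0" using D(1)[of 0 0] by simp
  define J where "J = {z \<in> Q. D z \<in> Q}"
  have "ideal_on C J"
    unfolding ideal_on_def
  proof (intro conjI ballI)
    show "J \<subseteq> C" "0 \<in> J" using q(3,4) D0 by (auto simp: J_def)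
    show "y + z \<in> J" if "y \<in> J" "z \<in> J" for y z
      using that q(5) by (simp add: J_def D(1))
    show "r * z \<in> J" if "r \<in> C" "z \<in> J" for r z
      using that q(5) q(6)[of r z] q(6)[of r "D z"] q(7)[of "D r" z] D(3)[of r] by (simp add: J_def D(2))
  qed
  moreover have "{y * z |y z. y \<in> Q \<and> z \<in> Q} \<subseteq> J"
  proof clarify
    fix y z assume yz: "y \<in> Q" "z \<in> Q"
    then have "y \<in> C" "z \<in> C" "D y \<in> C" "D z \<in> C" using q(3) D(3) by blast+
    then show "y * z \<in> J" using yz q(5) q(6,7) by (simp add: J_def D(2))
  qed
  ultimately have "msq C Q \<subseteq> J" unfolding msq_def by (rule gen_minimal)
  moreover obtain u where u: "x \<in> C" "u \<in> C - Q" "u * x \<in> msq C Q" using x by (auto simp: lsq_def)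
  ultimately have "D (u * x) \<in> Q" by (auto simp: J_def)
  then have "u * D x + x * D u \<in> Q" by (simp add: D(2))
  moreover have "x * D u \<in> Q"
    using lsq_props(2)[OF C Q] x D(3)[of u] u(2) q(7) by blast
  ultimately have "u * D x \<in> Q" using ideal_on_add_iff(2)[OF C q(1)] by blast
  then show ?thesis using q(8)[of u "D x"] u(1,2) D(3)[of x] by blast
qed

text \<open>With L = d x + e y - 1, multiplying by d^2 and replacing d x by L + 1 - e y eliminates
  x. The terms beyond F_P carry a factor 2 or L, and their coefficients
  \<open>2 * a * e - b * d\<close>, 2, b and a - d^2 are sent into B by P^-1.\<close>

lemma conic_identity1:
  fixes a b c d e x y :: "'r::comm_ring_1"
  defines "g \<equiv> a * x\<^sup>2 + b * x * y + c * y\<^sup>2 - 1 - (d * x + e * y - 1)\<^sup>2"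
  shows "d\<^sup>2 * g = (a * e\<^sup>2 - b * d * e + c * d\<^sup>2) * y\<^sup>2 + (2 * a * e - b * d) * y + (a - d\<^sup>2)
    - (2 * a * e - b * d) * y * 2 + (d * x + e * y - 1) * (2 * a * (1 - e * y) + b * d * y)
    + (a - d\<^sup>2) * (d * x + e * y - 1)\<^sup>2"
  unfolding g_def by (simp add: algebra_simps power2_eq_square)

text \<open>The analogous elimination of y by L = e y - 1, for the case that a lies in P.\<close>

lemma conic_identity2:
  fixes a b c e x y :: "'r::comm_ring_1"
  defines "g \<equiv> a * x\<^sup>2 + b * x * y + c * y\<^sup>2 - 1 - (e * y - 1)\<^sup>2"
  shows "e\<^sup>2 * g = a * e\<^sup>2 * x\<^sup>2 - b * e * x + (c - e\<^sup>2)
    + b * e * x * 2 + (e * y - 1) * (b * e * x + 2 * c)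
    + (c - e\<^sup>2) * (e * y - 1)\<^sup>2"
  unfolding g_def by (simp add: algebra_simps power2_eq_square)

context algebraic_integers begin

lemma cst_mem: "r \<in> B \<Longrightarrow> cst r \<in> R2"
  using subring_onD(1)[OF subring_on_B] subring_onD(1)[OF subring_on_R1] by (simp add: cst_def)

lemma vX_mem: "vX \<in> R2" and vY_mem: "vY \<in> R2"
  using subring_onD(1,2)[OF subring_on_B]
  by (simp_all add: vX_def vY_def pCons_mem_pol pol_iff[of 0] one_pCons)

lemma conic_poly_mem: "a \<in> B \<Longrightarrow> b \<in> B \<Longrightarrow> c \<in> B \<Longrightarrow> conic_poly a b c \<in> R2"
  using subring_onD[OF subring_on_B] by (simp add: conic_poly_mem_pol)

lemma cst_mem_iff: "cst r \<in> M \<longleftrightarrow> r \<in> contr (contr M)"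
  by (simp add: cst_def contr_iff)

lemma pol_pol_subset:
  assumes M: "prime_on R2 M" and "P = contr (contr M)"
  shows "pol (pol P) \<subseteq> M"
proof -
  have q: "prime_on R1 (contr M)" by (rule contr_prime[OF subring_on_R1 M])
  have "pol P \<subseteq> contr M" unfolding assms(2) by (rule pol_contr_subset[OF subring_on_B prime_onD(1)[OF q]])
  then have "pol (pol P) \<subseteq> pol (contr M)" by (rule pol_mono)
  also have "\<dots> \<subseteq> M" by (rule pol_contr_subset[OF subring_on_R1 prime_onD(1)[OF M]])
  finally show ?thesis .
qed

lemma cst_inverse_mult:
  assumes "t \<in> inverse_ideal B P" "g \<in> pol (pol P)"
  shows "cst t * g \<in> R2"
  using assms by (simp add: cst_def pol_def inverse_ideal_def)

end

locale conic = algebraic_integers K B for K B :: "'k::field_char_0 set" +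
  fixes a b c :: 'k
  assumes abc: "a \<in> B" "b \<in> B" "c \<in> B"
begin

abbreviation "f \<equiv> conic_poly a b c"
lemmas r2 = subring_onD[OF subring_on_R2]
lemmas sB = subring_onD[OF subring_on_B]

lemma f_mem: "f \<in> R2"
  using abc by (rule conic_poly_mem)

lemma two_mem: "2 \<in> B"
  using subring_on_numeral[OF subring_on_B] .

lemma Gamma_iff:
  "P \<in> Gamma B a b c \<longleftrightarrow> prime_on B P \<and> 2 \<in> P \<and> b \<in> P \<and> \<not> (a \<in> P \<and> c \<in> P)"
proof -
  have g: "gen B T \<subseteq> P \<longleftrightarrow> T \<subseteq> P" if "prime_on B P" for T
    using gen_minimal[OF prime_onD(1)[OF that], of T] gen_superset[of T B] by blast
  show ?thesis
    unfolding Gamma_def Spec_def mem_Collect_eq primeideal_ring_on[OF subring_on_B] genideal_ring_on[OF subring_on_B]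
    by (cases "prime_on B P") (simp_all add: g)
qed

lemma Gamma_nonzero: "P \<in> Gamma B a b c \<Longrightarrow> P \<noteq> {0}"
  by (auto simp: Gamma_iff)

lemma finite_Gamma: "finite (Gamma B a b c)"
  using finite_primes_over[of 2] by (rule finite_subset[rotated]) (auto simp: Gamma_iff)

lemma Gamma_of_lsq:
  assumes M: "prime_on R2 M" and f: "f \<in> lsq R2 M"
  shows "contr (contr M) \<in> Gamma B a b c"
proof -
  note m = prime_onD[OF M]
  define P where "P = contr (contr M)"
  have P: "prime_on B P" unfolding P_def by (rule contr_contr_prime[OF M])
  have fM: "f \<in> M" using lsq_props(2)[OF subring_on_R2 M] f by blast
  have pd: "pderiv p \<in> R2" if "p \<in> R2" for p
    using that sB(5) subring_on_of_nat[OF subring_on_B]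
    by (auto simp: pol_def coeff_pderiv of_nat_poly simp del: of_nat_Suc)
  have "pderiv f \<in> M"
    using derivation_lsq[OF subring_on_R2 M, of pderiv] pd f by (simp add: pderiv_add pderiv_mult)
  then have fy: "cst b * vX + 2 * cst c * vY \<in> M" by (simp add: pderiv_conic_poly)
  have "swp (pderiv (swp f)) \<in> M"
    using derivation_lsq[OF subring_on_R2 M, of "\<lambda>p. swp (pderiv (swp p))"] pd f
    by (simp add: pderiv_add pderiv_mult swp_add swp_mult swp_mem)
  then have fx: "cst b * vY + 2 * cst a * vX \<in> M"
    by (simp add: swp_conic_poly pderiv_conic_poly swp_add swp_mult swp_cst swp_vX swp_vY swp_2)
  \<comment> \<open>Since f is a quadratic form minus 1, Euler's relation leaves the constant
    2.\<close>
  have "vX * (cst b * vY + 2 * cst a * vX) + vY * (cst b * vX + 2 * cst c * vY) - 2 * f = cst 2"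
    by (simp add: conic_poly_eq cst_hom algebra_simps power2_eq_square)
  moreover have "2 * f \<in> M" using m(6)[OF cst_mem[OF two_mem] fM] by (simp add: cst_hom)
  ultimately have 2: "cst 2 \<in> M"
    using ideal_on_diff[OF subring_on_R2 m(1) m(5)[OF m(6)[OF vX_mem fx] m(6)[OF vY_mem fy]]] by metis
  have two: "2 * p \<in> M" if "p \<in> R2" for p using m(7)[OF that 2] by (simp add: cst_hom)
  have ca: "cst a \<in> R2" "cst b \<in> R2" "cst c \<in> R2" using abc cst_mem by blast+
  have "2 * (cst c * vY) \<in> M" by (intro two r2(5) ca vY_mem)
  then have bX: "cst b * vX \<in> M"
    using fy ideal_on_add_iff(2)[OF subring_on_R2 m(1)] by (simp only: mult.assoc)
  have "2 * (cst a * vX) \<in> M" by (intro two r2(5) ca vX_mem)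
  then have bY: "cst b * vY \<in> M"
    using fx ideal_on_add_iff(2)[OF subring_on_R2 m(1)] by (simp only: mult.assoc)
  \<comment> \<open>The quadratic form is f + 1, so it cannot lie in M together with f.\<close>
  have one: False if q: "cst a * vX\<^sup>2 + cst b * vX * vY + cst c * vY\<^sup>2 \<in> M"
  proof -
    have "(cst a * vX\<^sup>2 + cst b * vX * vY + cst c * vY\<^sup>2) - f \<in> M"
      by (rule ideal_on_diff[OF subring_on_R2 m(1) q fM])
    then show False using m(2) by (simp add: conic_poly_eq)
  qed
  have bM: "cst b \<in> M"
  proof (rule ccontr)
    assume "cst b \<notin> M"
    then have XY: "vX \<in> M" "vY \<in> M"
      using bX bY m(8)[of "cst b"] ca vX_mem vY_mem by blast+
    have "cst a * vX\<^sup>2 \<in> M" "cst b * vX * vY \<in> M" "cst c * vY\<^sup>2 \<in> M"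
      using m(6)[OF r2(5)[OF ca(1) vX_mem] XY(1)] m(6)[OF r2(5)[OF ca(2) vX_mem] XY(2)]
        m(6)[OF r2(5)[OF ca(3) vY_mem] XY(2)] by (simp_all add: power2_eq_square mult.assoc)
    then show False using one m(5) by blast
  qed
  have "\<not> (a \<in> P \<and> c \<in> P)"
  proof
    assume "a \<in> P \<and> c \<in> P"
    then have ac: "cst a \<in> M" "cst c \<in> M" by (simp_all add: cst_mem_iff P_def)
    have "cst a * vX\<^sup>2 \<in> M" "cst b * vX * vY \<in> M" "cst c * vY\<^sup>2 \<in> M"
      using m(7)[OF r2(7)[OF vX_mem] ac(1)] m(7)[OF vY_mem bX] m(7)[OF r2(7)[OF vY_mem] ac(2)] by blast+
    then show False using one m(5) by blast
  qed
  then show ?thesis using P 2 bM by (simp add: Gamma_iff cst_mem_iff P_def)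
qed

text \<open>An affine form whose square is f modulo P, where 1 = -1. For a in P also d is in P, and
  omitting d X makes the elimination of Y yield exactly the second form of F_P.\<close>

definition line :: "'k set \<Rightarrow> 'k \<Rightarrow> 'k \<Rightarrow> 'k poly poly" where
  "line P d e = (if a \<notin> P then cst d * vX + cst e * vY - 1 else cst e * vY - 1)"

context
  fixes P d e assumes P: "P \<in> Gamma B a b c"
    and de: "d \<in> B" "e \<in> B" "d\<^sup>2 - a \<in> P" "e\<^sup>2 - c \<in> P"
begin

lemma Gamma_props: "prime_on B P" "2 \<in> P" "b \<in> P"
  using P by (auto simp: Gamma_iff)

lemmas pp = prime_onD[OF Gamma_props(1)]

lemma squares: "a - d\<^sup>2 \<in> P" "c - e\<^sup>2 \<in> P"
  using ideal_on_minus[OF subring_on_B pp(1) de(3)] ideal_on_minus[OF subring_on_B pp(1) de(4)] by simp_all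

lemma d_notin: "a \<notin> P \<Longrightarrow> d \<notin> P"
proof
  assume a: "a \<notin> P" and d: "d \<in> P"
  have "(a - d\<^sup>2) + d * d \<in> P" by (intro pp(5) squares pp(6) de(1) d)
  then show False using a by (simp add: power2_eq_square)
qed

lemma e_notin: "a \<in> P \<Longrightarrow> e \<notin> P"
proof
  assume a: "a \<in> P" and e: "e \<in> P"
  have "(c - e\<^sup>2) + e * e \<in> P" by (intro pp(5) squares pp(6) de(2) e)
  then show False using a P by (simp add: power2_eq_square Gamma_iff)
qed

lemma line_mem: "line P d e \<in> R2"
  unfolding line_def using de by (auto intro!: r2(2,3,5,6) cst_mem vX_mem vY_mem)

lemma mul_two: "x \<in> B \<Longrightarrow> 2 * x \<in> P"
  using pp(7)[OF _ Gamma_props(2)] by simp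

lemma cst_pol: "x \<in> P \<Longrightarrow> cst x \<in> pol (pol P)"
  using pp(4) by (simp add: cst_def pCons_mem_pol pol_iff[of 0])

lemma pol_P: "prime_on R2 (pol (pol P))"
  by (intro pol_prime subring_on_R1 subring_on_B Gamma_props(1))

text \<open>The coefficients of the difference are a - d^2, b - 2 d e, c - e^2, 2 d, 2 e and -2,
  with a and b unchanged and no 2 d when d X is omitted.\<close>

lemma conic_minus_square_mem: "f - (line P d e)\<^sup>2 \<in> pol (pol P)"
proof -
  note i = prime_onD[OF pol_P]
  note cp = i(7)[OF _ cst_pol]
  have X2: "vX\<^sup>2 \<in> R2" "vX * vY \<in> R2" "vY\<^sup>2 \<in> R2" using r2(5,7) vX_mem vY_mem by blast+
  have bde: "b - 2 * (d * e) \<in> P"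
    by (intro ideal_on_diff[OF subring_on_B pp(1)] Gamma_props mul_two sB(5) de)
  show ?thesis
  proof (cases "a \<in> P")
    case False
    have "f - (line P d e)\<^sup>2 = cst (a - d\<^sup>2) * vX\<^sup>2 + cst (b - 2 * (d * e)) * (vX * vY) + cst (c - e\<^sup>2) * vY\<^sup>2
        + cst (2 * d) * vX + cst (2 * e) * vY - cst (2 * 1)"
      using False by (simp add: line_def conic_poly_eq cst_hom algebra_simps power2_eq_square)
    also have "\<dots> \<in> pol (pol P)"
      by (intro ideal_on_diff[OF subring_on_R2 i(1)] i(5) cp X2 vX_mem vY_mem squares bde mul_two de sB(2) cst_pol)
    finally show ?thesis .
  next
    case True
    have "f - (line P d e)\<^sup>2 = cst a * vX\<^sup>2 + cst b * (vX * vY) + cst (c - e\<^sup>2) * vY\<^sup>2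
        + cst (2 * e) * vY - cst (2 * 1)"
      using True by (simp add: line_def conic_poly_eq cst_hom algebra_simps power2_eq_square)
    also have "\<dots> \<in> pol (pol P)"
      by (intro ideal_on_diff[OF subring_on_R2 i(1)] i(5) cp X2 vX_mem vY_mem squares True Gamma_props(3) mul_two de sB(2) cst_pol)
    finally show ?thesis .
  qed
qed

lemma F_poly_eq:
  "F_poly a b c d e P = (if a \<notin> P then
     (cst a * cst e ^ 2 - cst b * cst d * cst e + cst c * cst d ^ 2) * vY\<^sup>2
       + (2 * cst a * cst e - cst b * cst d) * vY + (cst a - cst d ^ 2)
   else cst a * cst e ^ 2 * vX\<^sup>2 - cst b * cst e * vX + (cst c - cst e ^ 2))"
proof -
  have "F_poly a b c d e P = (if a \<notin> P then
     cst (a * e\<^sup>2 - b * d * e + c * d\<^sup>2) * vY\<^sup>2 + cst (2 * a * e - b * d) * vY + cst (a - d\<^sup>2)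
   else cst (a * e\<^sup>2) * vX\<^sup>2 - cst (b * e) * vX + cst (c - e\<^sup>2))"
    unfolding F_poly_def cst_def vX_def vY_def ..
  then show ?thesis by (simp add: cst_hom)
qed

lemma F_poly_mem: "F_poly a b c d e P \<in> pol (pol P)"
proof -
  note i = prime_onD[OF pol_P]
  note cp = i(7)[OF _ cst_pol]
  have X2: "vX\<^sup>2 \<in> R2" "vY\<^sup>2 \<in> R2" using r2(7) vX_mem vY_mem by blast+
  show ?thesis
  proof (cases "a \<in> P")
    case False
    \<comment> \<open>Modulo P, a and c are d^2 and e^2, so a e^2 + c d^2 becomes 2 d^2 e^2.\<close>
    have "a * e\<^sup>2 - b * d * e + c * d\<^sup>2
        = (a - d\<^sup>2) * e\<^sup>2 + (c - e\<^sup>2) * d\<^sup>2 + 2 * (d\<^sup>2 * e\<^sup>2) - b * (d * e)"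
      by (simp add: algebra_simps)
    also have "\<dots> \<in> P"
      by (intro ideal_on_diff[OF subring_on_B pp(1)] pp(5) pp(7) squares mul_two sB(5,7) de Gamma_props(3))
    finally have 1: "a * e\<^sup>2 - b * d * e + c * d\<^sup>2 \<in> P" .
    have "2 * (a * e) - b * d \<in> P"
      by (intro ideal_on_diff[OF subring_on_B pp(1)] pp(7) mul_two sB(5) de abc Gamma_props(3))
    then have 2: "2 * a * e - b * d \<in> P" by (simp add: mult.assoc)
    have "F_poly a b c d e P = cst (a * e\<^sup>2 - b * d * e + c * d\<^sup>2) * vY\<^sup>2 + cst (2 * a * e - b * d) * vY + cst (a - d\<^sup>2)"
      using False by (simp add: F_poly_eq cst_hom)
    also have "\<dots> \<in> pol (pol P)" by (intro i(5) cp X2 vY_mem 1 2 squares cst_pol)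
    finally show ?thesis .
  next
    case True
    have "F_poly a b c d e P = cst (a * e\<^sup>2) * vX\<^sup>2 - cst (b * e) * vX + cst (c - e\<^sup>2)"
      using True by (simp add: F_poly_eq cst_hom)
    also have "\<dots> \<in> pol (pol P)"
      by (intro i(5) ideal_on_diff[OF subring_on_R2 i(1)] cp X2 vX_mem squares cst_pol pp(7) sB(7) de True Gamma_props(3))
    finally show ?thesis .
  qed
qed

context
  fixes M assumes M: "prime_on R2 M" and fM: "f \<in> M" and PM: "P = contr (contr M)"
begin

lemma line_mem_M: "line P d e \<in> M"
proof -
  have "f - (line P d e)\<^sup>2 \<in> M" using conic_minus_square_mem pol_pol_subset[OF M PM] by blast
  then have "f - (f - (line P d e)\<^sup>2) \<in> M" by (rule ideal_on_diff[OF subring_on_R2 prime_onD(1)[OF M] fM])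
  then have "(line P d e)\<^sup>2 \<in> M" by simp
  then show ?thesis using prime_on_power_iff[OF subring_on_R2 M line_mem, of 2] by simp
qed

text \<open>The elimination identities say that w^2 t (f - L^2) and t F_P differ by an element of M,
  where w is d or e and lies outside P = M \<inter> B.\<close>

lemma F_poly_iff:
  assumes t: "t \<in> inverse_ideal B P"
  shows "cst t * F_poly a b c d e P \<in> M \<longleftrightarrow> cst t * (f - (line P d e)\<^sup>2) \<in> M"
proof -
  note m = prime_onD[OF M]
  have tP: "t * x \<in> B" if "x \<in> P" for x using t that by (simp add: inverse_ideal_def)
  have 2: "cst 2 \<in> M" using Gamma_props(2) unfolding PM by (simp add: cst_mem_iff)
  define l where "l = line P d e"
  have l: "l \<in> M" "l \<in> R2" unfolding l_def using line_mem_M line_mem by blast+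
  have gR: "cst t * (f - l\<^sup>2) \<in> R2" unfolding l_def by (rule cst_inverse_mult[OF t conic_minus_square_mem])
  have t2: "t * 2 \<in> B" "t * b \<in> B" using tP Gamma_props by blast+
  define w where "w = (if a \<notin> P then d else e)"
  have w: "w \<in> B" "w \<notin> P" using de d_notin e_notin by (auto simp: w_def)
  have "\<exists>z\<in>M. cst w ^ 2 * (cst t * (f - l\<^sup>2)) = cst t * F_poly a b c d e P + z"
  proof (cases "a \<in> P")
    case False
    define z where "z = cst (t * (a - d\<^sup>2)) * l * l + (cst (t * 2) * cst a * (1 - cst e * vY) + cst (t * b) * cst d * vY) * l
      - (cst (t * 2) * cst a * cst e - cst (t * b) * cst d) * vY * cst 2"
    have "z \<in> M"
      unfolding z_def
      by (intro ideal_on_diff[OF subring_on_R2 m(1)] m(5) m(6) l 2 r2(2,3,5,6) cst_mem vY_mem de abc t2 tP squares)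
    moreover have "cst w ^ 2 * (cst t * (f - l\<^sup>2)) = cst t * F_poly a b c d e P + z"
    proof -
      have "cst w ^ 2 * (cst t * (f - l\<^sup>2)) = cst t * (cst d ^ 2 * (cst a * vX\<^sup>2 + cst b * vX * vY + cst c * vY\<^sup>2 - 1
          - (cst d * vX + cst e * vY - 1)\<^sup>2))"
        using False by (simp add: w_def l_def line_def conic_poly_eq mult.left_commute)
      also have "\<dots> = cst t * F_poly a b c d e P + z"
        unfolding conic_identity1 F_poly_eq z_def using False
        by (simp add: cst_hom l_def line_def algebra_simps power2_eq_square)
      finally show ?thesis .
    qed
    ultimately show ?thesis by blast
  next
    case True
    define z where "z = cst (t * (c - e\<^sup>2)) * l * l + (cst (t * b) * cst e * vX + cst (t * 2) * cst c) * l
      + cst (t * b) * cst e * vX * cst 2"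
    have "z \<in> M"
      unfolding z_def
      by (intro m(5) m(6) l 2 r2(2,3,5,6) cst_mem vX_mem de abc t2 tP squares)
    moreover have "cst w ^ 2 * (cst t * (f - l\<^sup>2)) = cst t * F_poly a b c d e P + z"
    proof -
      have "cst w ^ 2 * (cst t * (f - l\<^sup>2)) = cst t * (cst e ^ 2 * (cst a * vX\<^sup>2 + cst b * vX * vY + cst c * vY\<^sup>2 - 1
          - (cst e * vY - 1)\<^sup>2))"
        using True by (simp add: w_def l_def line_def conic_poly_eq mult.left_commute)
      also have "\<dots> = cst t * F_poly a b c d e P + z"
        unfolding conic_identity2 F_poly_eq z_def using True
        by (simp add: cst_hom l_def line_def algebra_simps power2_eq_square)
      finally show ?thesis .
    qed
    ultimately show ?thesis by blast
  qed
  then obtain z where z: "z \<in> M" "cst w ^ 2 * (cst t * (f - l\<^sup>2)) = cst t * F_poly a b c d e P + z" by blast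
  have wM: "cst w ^ 2 \<notin> M"
    using w prime_on_power[OF subring_on_R2 M cst_mem[OF w(1)]] unfolding PM by (simp add: cst_mem_iff)
  have "cst t * F_poly a b c d e P \<in> M \<longleftrightarrow> cst w ^ 2 * (cst t * (f - l\<^sup>2)) \<in> M"
    unfolding z(2) using ideal_on_add_iff(2)[OF subring_on_R2 m(1) z(1)] by blast
  also have "\<dots> \<longleftrightarrow> cst t * (f - l\<^sup>2) \<in> M"
    using prime_on_mult_iff[OF M r2(7)[OF cst_mem[OF w(1)]] gR] wM by blast
  finally show ?thesis unfolding l_def .
qed

text \<open>L lies in M, so f may be replaced by g = f - L^2, which has coefficients in P. Then (t
  p) g = p (t g) with t p a unit at M, so g is in the local square iff t g is in M. Every other s in
  P^-1 is locally a multiple of t: (t p) s = (s p) t.\<close>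

lemma lsq_iff: "f \<in> lsq R2 M \<longleftrightarrow> (\<forall>t\<in>inverse_ideal B P. cst t * F_poly a b c d e P \<in> M)"
proof -
  note m = prime_onD[OF M]
  note lq = lsq_props[OF subring_on_R2 M]
  define g where "g = f - (line P d e)\<^sup>2"
  have gP: "g \<in> pol (pol P)" unfolding g_def by (rule conic_minus_square_mem)
  have gR: "g \<in> R2" using gP prime_onD(3)[OF pol_P] by blast
  have L2: "(line P d e)\<^sup>2 \<in> lsq R2 M"
    using lq(3)[OF line_mem_M line_mem_M] by (simp add: power2_eq_square)
  have fg: "f \<in> lsq R2 M \<longleftrightarrow> g \<in> lsq R2 M"
    unfolding g_def using ideal_on_add_iff(3)[OF subring_on_R2 lq(1) L2, of f] by blast
  obtain t p where t: "t \<in> inverse_ideal B P" "p \<in> P" "t * p \<in> B - P"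
    using prime_invertible[OF Gamma_props(1) Gamma_nonzero[OF P]] by blast
  have tgR: "cst s * g \<in> R2" if "s \<in> inverse_ideal B P" for s by (rule cst_inverse_mult[OF that gP])
  have tpM: "cst (t * p) \<in> R2 - M" using t(3) cst_mem unfolding PM by (auto simp: cst_mem_iff)
  have pM: "cst p \<in> M" using t(2) unfolding PM by (simp add: cst_mem_iff)
  have e: "cst (t * p) * g = cst p * (cst t * g)" by (simp add: cst_hom)
  have "g \<in> lsq R2 M \<longleftrightarrow> (\<forall>s\<in>inverse_ideal B P. cst s * g \<in> M)"
  proof
    assume "g \<in> lsq R2 M"
    moreover have "cst (t * p) \<in> R2" using tpM by blast
    ultimately have "cst p * (cst t * g) \<in> lsq R2 M"
      unfolding e[symmetric] by (intro ideal_onD(4)[OF lq(1)])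
    then have tg: "cst t * g \<in> M"
      by (rule uniformizer_mult_lsq[OF M, folded PM cst_def, OF t tgR[OF t(1)]])
    show "\<forall>s\<in>inverse_ideal B P. cst s * g \<in> M"
    proof
      fix s assume s: "s \<in> inverse_ideal B P"
      have sp: "s * p \<in> B" using s t(2) by (simp add: inverse_ideal_def)
      have "cst (t * p) * (cst s * g) = cst (s * p) * (cst t * g)" by (simp add: cst_hom algebra_simps)
      also have "\<dots> \<in> M" by (rule m(6)[OF cst_mem[OF sp] tg])
      finally show "cst s * g \<in> M" using m(8)[OF _ _ tgR[OF s], of "cst (t * p)"] tpM by blast
    qed
  next
    assume "\<forall>s\<in>inverse_ideal B P. cst s * g \<in> M"
    then have "cst t * g \<in> M" using t(1) by blast
    then have "cst (t * p) * g \<in> lsq R2 M" unfolding e using lq(3)[OF pM] by blast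
    then show "g \<in> lsq R2 M" by (rule lsq_cancel[OF subring_on_R2 M tpM gR])
  qed
  then show ?thesis unfolding fg using F_poly_iff unfolding g_def by blast
qed

end

end

text \<open>A P in Gamma whose elements lie in M must be the contraction of M, as nonzero primes of
  B are maximal.\<close>

lemma lsq_iff_Gamma:
  assumes M: "prime_on R2 M" "f \<in> M" and de: "sqrt_choice B a b c d e"
  shows "f \<in> lsq R2 M \<longleftrightarrow> (\<exists>P\<in>Gamma B a b c. cst ` P \<subseteq> M \<and>
    (\<forall>t\<in>inverse_ideal B P. cst t * F_poly a b c (d P) (e P) P \<in> M))"
proof -
  have de': "d P \<in> B" "e P \<in> B" "(d P)\<^sup>2 - a \<in> P" "(e P)\<^sup>2 - c \<in> P" if "P \<in> Gamma B a b c" for P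
    using de that by (auto simp: sqrt_choice_def)
  show ?thesis
  proof
    assume f: "f \<in> lsq R2 M"
    define P where "P = contr (contr M)"
    have P: "P \<in> Gamma B a b c" unfolding P_def by (rule Gamma_of_lsq[OF M(1) f])
    have "cst ` P \<subseteq> M" by (auto simp: P_def cst_mem_iff)
    moreover have "\<forall>t\<in>inverse_ideal B P. cst t * F_poly a b c (d P) (e P) P \<in> M"
      using lsq_iff[OF P de'[OF P] M P_def] f by (rule iffD1)
    ultimately show "\<exists>P\<in>Gamma B a b c. cst ` P \<subseteq> M \<and> (\<forall>t\<in>inverse_ideal B P. cst t * F_poly a b c (d P) (e P) P \<in> M)"
      using P by (intro bexI[of _ P] conjI)
  next
    assume "\<exists>P\<in>Gamma B a b c. cst ` P \<subseteq> M \<and> (\<forall>t\<in>inverse_ideal B P. cst t * F_poly a b c (d P) (e P) P \<in> M)"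
    then obtain P where P: "P \<in> Gamma B a b c" "cst ` P \<subseteq> M"
      "\<forall>t\<in>inverse_ideal B P. cst t * F_poly a b c (d P) (e P) P \<in> M" by (elim bexE conjE)
    have "P \<subseteq> contr (contr M)" using P(2) by (auto simp: cst_mem_iff[symmetric])
    moreover have "prime_on B P" using P(1) by (simp add: Gamma_iff)
    ultimately have "P = contr (contr M)"
      using prime_maximal[OF _ Gamma_nonzero[OF P(1)] contr_contr_prime[OF M(1)]] by simp
    from lsq_iff[OF P(1) de'[OF P(1)] M this] P(3) show "f \<in> lsq R2 M" by (rule iffD2)
  qed
qed

subsection \<open>The coordinate ring and its local rings\<close>

abbreviation "I \<equiv> gen R2 {f}"
abbreviation "A \<equiv> conic_ring B a b c"
abbreviation "\<pi> \<equiv> to_conic_ring B a b c"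

lemma poly_ring2_eq: "poly_ring2 B = ring_on R2"
  by (simp add: poly_ring2_def pol_def)

lemma conic_ideal_eq: "conic_ideal B a b c = I"
  unfolding conic_ideal_def poly_ring2_eq genideal_ring_on[OF subring_on_R2] conic_poly_eq cst_def vX_def vY_def ..

lemma I_ideal: "ideal_on R2 I"
  using f_mem by (intro gen_ideal[OF subring_on_R2]) simp

lemma I_subset_iff: "prime_on R2 Q \<Longrightarrow> I \<subseteq> Q \<longleftrightarrow> f \<in> Q"
  using gen_minimal[OF prime_onD(1), of R2 Q "{f}"] gen_superset[of "{f}" R2] by blast

lemma A_eq: "A = ring_on R2 Quot I"
  by (simp add: conic_ring_def poly_ring2_eq conic_ideal_eq)

lemma \<pi>_eq: "\<pi> p = I +>\<^bsub>ring_on R2\<^esub> p"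
  by (simp add: to_conic_ring_def poly_ring2_eq conic_ideal_eq)

lemma I_ring_ideal: "ideal I (ring_on R2)"
  using I_ideal by (simp add: ideal_ring_on[OF subring_on_R2])

lemma cring_A: "cring A"
  unfolding A_eq by (rule ideal.quotient_is_cring[OF I_ring_ideal cring_ring_on[OF subring_on_R2]])

lemma \<pi>_hom: "\<pi> \<in> Ring.ring_hom (ring_on R2) A"
  using ideal.rcos_ring_hom[OF I_ring_ideal] unfolding A_eq \<pi>_eq[abs_def] .

lemma \<pi>_add: "p \<in> R2 \<Longrightarrow> q \<in> R2 \<Longrightarrow> \<pi> (p + q) = \<pi> p \<oplus>\<^bsub>A\<^esub> \<pi> q"
  and \<pi>_mult: "p \<in> R2 \<Longrightarrow> q \<in> R2 \<Longrightarrow> \<pi> (p * q) = \<pi> p \<otimes>\<^bsub>A\<^esub> \<pi> q"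
  and \<pi>_one: "\<pi> 1 = \<one>\<^bsub>A\<^esub>"
  and \<pi>_carrier: "p \<in> R2 \<Longrightarrow> \<pi> p \<in> carrier A"
  using ring_hom_add[OF \<pi>_hom] ring_hom_mult[OF \<pi>_hom] ring_hom_one[OF \<pi>_hom] ring_hom_closed[OF \<pi>_hom]
  by simp_all

lemma carrier_A: "carrier A = \<pi> ` R2"
  unfolding A_eq by (auto simp: FactRing_def A_RCOSETS_defs \<pi>_eq a_r_coset_def)

lemma \<pi>_zero: 
  assumes p: "p \<in> R2"
  shows "\<pi> p = \<zero>\<^bsub>A\<^esub> \<longleftrightarrow> p \<in> I"
proof -
  interpret R: cring "ring_on R2" by (rule cring_ring_on[OF subring_on_R2])
  interpret I: ideal I "ring_on R2" by (rule I_ring_ideal)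
  have "\<zero>\<^bsub>A\<^esub> = I" by (simp add: A_eq FactRing_def)
  moreover have "\<pi> p = I \<longleftrightarrow> p \<in> I"
    unfolding \<pi>_eq using p I.a_rcos_const I.a_rcos_self by auto
  ultimately show ?thesis by simp
qed

section \<open>Primes of A, their local rings and the ideal H\<close>

definition lift :: "'k poly poly set set \<Rightarrow> 'k poly poly set" where
  "lift N = {p \<in> R2. \<pi> p \<in> N}"

context
  fixes N assumes N: "primeideal N A"
begin

lemma lift_prime: "prime_on R2 (lift N)" and f_lift: "f \<in> lift N"
proof -
  interpret A: cring A by (rule cring_A)
  interpret N: primeideal N A by (rule N)
  have one: "\<one>\<^bsub>A\<^esub> \<notin> N" using N.one_imp_carrier N.I_notcarr by blast
  have "\<pi> 0 = \<zero>\<^bsub>A\<^esub>" using \<pi>_zero r2(1) ideal_onD(2)[OF I_ideal] by blast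
  then show "prime_on R2 (lift N)"
    unfolding prime_on_def ideal_on_def lift_def
    using r2(1-5) \<pi>_add \<pi>_mult \<pi>_one \<pi>_carrier N.I_l_closed N.I_prime one by auto
  have "f \<in> I" using gen_superset[of "{f}" R2] by blast
  then have "\<pi> f = \<zero>\<^bsub>A\<^esub>" using \<pi>_zero f_mem by blast
  then show "f \<in> lift N" using f_mem by (simp add: lift_def)
qed

lemma S_eq: "carrier A - N = \<pi> ` (R2 - lift N)"
  by (auto simp: carrier_A lift_def)

lemma mult_set_A: "mult_set A (carrier A - N)"
proof -
  interpret A: cring A by (rule cring_A)
  interpret N: primeideal N A by (rule N)
  show ?thesis
    by unfold_locales (use N.one_imp_carrier N.I_notcarr N.I_prime in auto)
qed

abbreviation "Lc \<equiv> localization_at A N"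
abbreviation "\<theta> p \<equiv> loc_frac A (carrier A - N) (\<pi> p) \<one>\<^bsub>A\<^esub>"

lemma local_presentation_A: "local_presentation Lc R2 I (lift N) \<theta>"
proof -
  interpret S: mult_set A "carrier A - N" by (rule mult_set_A)
  have piS: "\<pi> u \<in> carrier A - N" if "u \<in> R2 - lift N" for u using that S_eq by blast
  show ?thesis
  proof (intro local_presentation.intro local_presentation_axioms.intro)
    show "cring Lc" by (rule S.cring_L)
    show "subring_on R2" by (rule subring_on_R2)
    show "prime_on R2 (lift N)" by (rule lift_prime)
    show "ideal_on R2 I" by (rule I_ideal)
    show "I \<subseteq> lift N" using I_subset_iff[OF lift_prime] f_lift by blast
  next
    fix p assume p: "p \<in> R2"
    then have pA: "\<pi> p \<in> carrier A" by (rule \<pi>_carrier)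
    show "\<theta> p \<in> carrier Lc" using pA S.S_one by (intro S.frac_carrier)
    fix q assume q: "q \<in> R2"
    then have qA: "\<pi> q \<in> carrier A" by (rule \<pi>_carrier)
    show "\<theta> (p + q) = \<theta> p \<oplus>\<^bsub>Lc\<^esub> \<theta> q"
      using pA qA by (simp add: S.add_frac[OF pA S.S_one qA S.S_one] \<pi>_add p q)
    show "\<theta> (p * q) = \<theta> p \<otimes>\<^bsub>Lc\<^esub> \<theta> q"
      using pA qA by (simp add: S.mult_frac[OF pA S.S_one qA S.S_one] \<pi>_mult p q)
  next
    show "\<theta> 1 = \<one>\<^bsub>Lc\<^esub>" by (simp add: \<pi>_one S.one_L)
  next
    fix x assume "x \<in> carrier Lc"
    then obtain r s where rs: "r \<in> carrier A" "s \<in> carrier A - N" "x = S.fr r s" unfolding S.carrier_L by blast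
    obtain p where p: "p \<in> R2" "r = \<pi> p" using rs(1) carrier_A by blast
    obtain u where u: "u \<in> R2 - lift N" "s = \<pi> u" using rs(2) S_eq by blast
    have sA: "s \<in> carrier A" using rs(2) by blast
    have "x \<otimes>\<^bsub>Lc\<^esub> \<theta> u = S.fr (r \<otimes>\<^bsub>A\<^esub> s) (s \<otimes>\<^bsub>A\<^esub> \<one>\<^bsub>A\<^esub>)"
      unfolding rs(3) u(2)[symmetric] by (rule S.mult_frac[OF rs(1,2) sA S.S_one])
    also have "\<dots> = S.fr r \<one>\<^bsub>A\<^esub>"
      using rs(1,2) sA S.S_one S.S_mult by (intro S.frac_eqI) simp_all
    finally show "\<exists>p\<in>R2. \<exists>u\<in>R2 - lift N. x \<otimes>\<^bsub>Lc\<^esub> \<theta> u = \<theta> p" using p u(1) by blast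
  next
    fix u assume u: "u \<in> R2 - lift N"
    have s: "\<pi> u \<in> carrier A - N" by (rule piS[OF u])
    then have sA: "\<pi> u \<in> carrier A" by blast
    have 1: "\<theta> u \<otimes>\<^bsub>Lc\<^esub> S.fr \<one>\<^bsub>A\<^esub> (\<pi> u) = \<one>\<^bsub>Lc\<^esub>"
      unfolding S.mult_frac[OF sA S.S_one S.one_closed s] S.one_L
      using s sA S.S_one by (intro S.frac_eqI) simp_all
    have c: "\<theta> u \<in> carrier Lc" "S.fr \<one>\<^bsub>A\<^esub> (\<pi> u) \<in> carrier Lc"
      using s sA S.S_one by (intro S.frac_carrier; simp)+
    interpret L: cring Lc by (rule S.cring_L)
    show "\<theta> u \<in> Units Lc"
      unfolding Units_def using 1 c L.m_comm[OF c] by auto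
  next
    fix p assume p: "p \<in> R2"
    then have pA: "\<pi> p \<in> carrier A" by (rule \<pi>_carrier)
    have "\<theta> p = \<zero>\<^bsub>Lc\<^esub> \<longleftrightarrow> (\<exists>s\<in>carrier A - N. s \<otimes>\<^bsub>A\<^esub> (\<pi> p \<otimes>\<^bsub>A\<^esub> \<one>\<^bsub>A\<^esub>) = s \<otimes>\<^bsub>A\<^esub> (\<zero>\<^bsub>A\<^esub> \<otimes>\<^bsub>A\<^esub> \<one>\<^bsub>A\<^esub>))"
      unfolding S.zero_L by (rule S.frac_eq_iff[OF pA S.S_one S.zero_closed S.S_one])
    also have "\<dots> \<longleftrightarrow> (\<exists>s\<in>carrier A - N. s \<otimes>\<^bsub>A\<^esub> \<pi> p = \<zero>\<^bsub>A\<^esub>)"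
      using pA by auto
    also have "\<dots> \<longleftrightarrow> (\<exists>u\<in>R2 - lift N. \<pi> u \<otimes>\<^bsub>A\<^esub> \<pi> p = \<zero>\<^bsub>A\<^esub>)"
      unfolding S_eq by blast
    also have "\<dots> \<longleftrightarrow> (\<exists>u\<in>R2 - lift N. u * p \<in> I)"
      using p r2(5) by (intro bex_cong refl) (simp add: \<pi>_mult[symmetric] \<pi>_zero)
    finally show "\<theta> p = \<zero>\<^bsub>Lc\<^esub> \<longleftrightarrow> (\<exists>u\<in>R2 - lift N. u * p \<in> I)" .
  qed
qed

text \<open>The dimension is n and the local basis V of M has n + 1 elements. If f is in the square,
  n generators modulo f would span the n + 1 independent members of V. Otherwise f replaces a member
  of V, and the remaining n generate the maximal ideal modulo f.\<close>

lemma regular_iff_not_lsq: "regular_local_ring Lc \<longleftrightarrow> f \<notin> lsq R2 (lift N)"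
proof -
  interpret L: local_presentation Lc R2 I "lift N" \<theta> by (rule local_presentation_A)
  define M where "M = lift N"
  have M: "prime_on R2 M" "f \<in> M" unfolding M_def by (rule lift_prime, rule f_lift)
  note lq = lsq_props[OF subring_on_R2 M(1)]
  define n where "n = ht2 M - 1"
  obtain p where p: "fchain f M n p" unfolding n_def using ex_fchain[OF refl abc M] by blast
  \<comment> \<open>The bound for a chain through f shows that the height is positive, so the
    subtraction in n is a genuine one.\<close>
  have ht: "Suc n = ht2 M"
    using fchain_bound[OF refl abc M(1) p] by (simp add: n_def)
  have "ht2 M \<le> 3" by (auto simp: ht2_def ht1_def of_bool_def)
  then have n2: "n \<le> 2" using ht by simp
  have dim: "krull_dim Lc = enat n"
  proof (rule L.krull_dim_eq)
    fix r p assume p: "\<forall>i\<le>r. prime_on R2 (p i) \<and> I \<subseteq> p i \<and> p i \<subseteq> lift N" "\<forall>i<r. p i \<subset> p (Suc i)"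
    then have "fchain f M r p" using I_subset_iff unfolding fchain_def M_def by blast
    then show "r \<le> n" using fchain_bound[OF refl abc M(1)] ht by fastforce
  next
    have "(\<forall>i\<le>n. prime_on R2 (p i) \<and> I \<subseteq> p i \<and> p i \<subseteq> lift N) \<and> (\<forall>i<n. p i \<subset> p (Suc i))"
      using p I_subset_iff unfolding fchain_def M_def by blast
    then show "\<exists>p. (\<forall>i\<le>n. prime_on R2 (p i) \<and> I \<subseteq> p i \<and> p i \<subseteq> lift N) \<and> (\<forall>i<n. p i \<subset> p (Suc i))" by blast
  qed
  obtain V where V: "lbasis R2 M V" "card V = ht2 M" using lbasis_R2[OF M(1)] by blast
  then have fV: "finite V" and VM: "V \<subseteq> M" and iV: "indep R2 M V (\<lambda>v. v)" by (auto simp: lbasis_def)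
  show ?thesis
    unfolding L.regular_iff[OF noeth_R2 dim]
  proof
    assume "\<exists>S. finite S \<and> S \<subseteq> carrier Lc \<and> Idl\<^bsub>Lc\<^esub> S = L.ext (lift N) \<and> card S = n"
    then obtain S where S: "finite S" "S \<subseteq> carrier Lc" "Idl\<^bsub>Lc\<^esub> S = L.ext (lift N)" "card S = n" by blast
    obtain T where T: "finite T" "T \<subseteq> M" "card T \<le> n" "\<forall>x\<in>M. \<exists>u\<in>R2 - M. u * x \<in> gen R2 (T \<union> I)"
      using L.ext_M_generators[OF S(1-3)] S(4) unfolding M_def by blast
    show "f \<notin> lsq R2 (lift N)"
    proof
      assume "f \<in> lsq R2 (lift N)"
      then have f: "f \<in> lsq R2 M" unfolding M_def .
      have IL: "I \<subseteq> lsq R2 M" using f by (intro gen_minimal[OF lq(1)]) simp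
      have TR: "T \<subseteq> R2" using T(2) prime_onD(3)[OF M(1)] by blast
      have II: "gen R2 I = I" using gen_minimal[OF I_ideal, of I] gen_superset[of I R2] by blast
      have g: "gen R2 (T \<union> I) = {x + y |x y. x \<in> gen R2 T \<and> y \<in> I}"
        using gen_Un[OF subring_on_R2 TR ideal_onD(1)[OF I_ideal]] unfolding II .
      have "\<exists>u\<in>R2 - M. \<exists>y\<in>gen R2 T. u * v - y \<in> lsq R2 M" if v: "v \<in> V" for v
      proof -
        obtain u where u: "u \<in> R2 - M" "u * v \<in> gen R2 (T \<union> I)" using T(4) VM v by blast
        then obtain y z where yz: "y \<in> gen R2 T" "z \<in> I" "u * v = y + z" unfolding g by blast
        then have "u * v - y \<in> lsq R2 M" using IL by auto
        then show ?thesis using u(1) yz(1) by blast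
      qed
      then have "card V \<le> card T"
        using indep_card_le[OF subring_on_R2 M(1) T(1,2) fV iV] VM by blast
      then show False using T(3) V(2) ht by simp
    qed
  next
    assume "f \<notin> lsq R2 (lift N)"
    then have "f \<notin> lsq R2 M" unfolding M_def .
    then obtain v where v: "v \<in> V" "lgen R2 M (insert f (V - {v}))"
      using lbasis_exchange[OF subring_on_R2 M(1) V(1) M(2)] by blast
    define T where "T = V - {v}"
    have T: "finite T" "T \<subseteq> lift N" "card T \<le> n" using fV VM v(1) V(2) ht by (auto simp: T_def M_def)
    have "\<exists>u\<in>R2 - lift N. u * x \<in> gen R2 (T \<union> I)" if x: "x \<in> lift N" for x
    proof -
      obtain u where u: "u \<in> R2 - M" "u * x \<in> gen R2 (insert f T)"
        using v(2) x unfolding lgen_def T_def M_def by blast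
      have "insert f T \<subseteq> gen R2 (T \<union> I)"
        using gen_superset[of "T \<union> I" R2] gen_superset[of "{f}" R2] by blast
      moreover have "ideal_on R2 (gen R2 (T \<union> I))"
        using T(2) prime_onD(3)[OF M(1)] ideal_onD(1)[OF I_ideal] unfolding M_def[symmetric]
        by (intro gen_ideal[OF subring_on_R2]) blast
      ultimately have "gen R2 (insert f T) \<subseteq> gen R2 (T \<union> I)" by (intro gen_minimal)
      then show ?thesis using u unfolding M_def by blast
    qed
    \<comment> \<open>For n \<ge> 1 there are two distinct primes between I and M; a zero maximal
      ideal would identify their extensions.\<close>
    moreover have "L.ext (lift N) \<noteq> {\<zero>\<^bsub>Lc\<^esub>}" if n1: "n \<ge> 1"
    proof
      assume z: "L.ext (lift N) = {\<zero>\<^bsub>Lc\<^esub>}"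
      have q: "prime_on R2 (p i)" "I \<subseteq> p i" "p i \<subseteq> lift N" if "i \<le> 1" for i
        using p that n1 I_subset_iff unfolding fchain_def M_def by auto
      have "L.ext (p i) = {\<zero>\<^bsub>Lc\<^esub>}" if i: "i \<le> 1" for i
      proof -
        have "L.ext (p i) \<subseteq> L.ext (lift N)" using q(3)[OF i] by (auto simp: L.ext_def)
        moreover have "\<zero>\<^bsub>Lc\<^esub> \<in> L.ext (p i)"
          using additive_subgroup.zero_closed[OF ideal.axioms(1)[OF L.ext_ideal[OF prime_onD(1)[OF q(1)[OF i]]]]] .
        ultimately show ?thesis using z by blast
      qed
      then have "L.ext (p 0) = L.ext (p 1)" by simp
      then have "p 0 = p 1" using L.pre_ext[OF q, of 0] L.pre_ext[OF q, of 1] by simp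
      then show False using p n1 unfolding fchain_def by (metis One_nat_def less_eq_Suc_le psubsetE subset_refl)
    qed
    ultimately show "\<exists>S. finite S \<and> S \<subseteq> carrier Lc \<and> Idl\<^bsub>Lc\<^esub> S = L.ext (lift N) \<and> card S = n"
      using L.ext_M_generated[OF T _ _ n2] by blast
  qed
qed

lemma genideal_subset_iff:
  assumes "T \<subseteq> R2"
  shows "Idl\<^bsub>A\<^esub> (\<pi> ` T) \<subseteq> N \<longleftrightarrow> T \<subseteq> lift N"
proof -
  interpret A: cring A by (rule cring_A)
  have "\<pi> ` T \<subseteq> carrier A" using assms carrier_A by blast
  then have "\<pi> ` T \<subseteq> Idl\<^bsub>A\<^esub> (\<pi> ` T)" by (rule A.genideal_self)
  moreover have "\<pi> ` T \<subseteq> N \<Longrightarrow> Idl\<^bsub>A\<^esub> (\<pi> ` T) \<subseteq> N" by (rule A.genideal_minimal[OF primeideal.axioms(1)[OF N]])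
  ultimately have "Idl\<^bsub>A\<^esub> (\<pi> ` T) \<subseteq> N \<longleftrightarrow> \<pi> ` T \<subseteq> N" by blast
  then show ?thesis using assms by (auto simp: lift_def)
qed

text \<open>A prime contains a product of two ideals iff it contains one of them. The empty product
  is all of A, which lies in no prime, in agreement with the empty disjunction.\<close>

lemma finprod_subset_iff:
  assumes "finite G" "\<And>P. P \<in> G \<Longrightarrow> ideal (J P) A"
  shows "finprod (ideals_set A) J G \<subseteq> N \<longleftrightarrow> (\<exists>P\<in>G. J P \<subseteq> N)"
proof -
  interpret A: cring A by (rule cring_A)
  interpret N: primeideal N A by (rule N)
  interpret IS: comm_monoid "ideals_set A" by (rule A.ideals_set_is_comm_monoid)
  show ?thesis
    using assms
  proof (induction G)
    case empty
    have "finprod (ideals_set A) J {} = carrier A"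
      using IS.finprod_empty by (simp add: ideals_set_def)
    then show ?case using N.I_notcarr N.Icarr by auto
  next
    case (insert P G)
    have c: "J \<in> G \<rightarrow> carrier (ideals_set A)" "J P \<in> carrier (ideals_set A)"
      using insert.prems by (auto simp: ideals_set_def)
    define K where "K = finprod (ideals_set A) J G"
    have K: "ideal K A" using IS.finprod_closed[OF c(1)] by (simp add: K_def ideals_set_def)
    have JP: "ideal (J P) A" using insert.prems by simp
    have "finprod (ideals_set A) J (insert P G) = ideal_prod A (J P) K"
      using IS.finprod_insert[OF insert.hyps c] by (simp add: K_def ideals_set_def)
    moreover have "ideal_prod A (J P) K \<subseteq> N \<longleftrightarrow> J P \<subseteq> N \<or> K \<subseteq> N"
    proof
      assume sub: "ideal_prod A (J P) K \<subseteq> N"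
      show "J P \<subseteq> N \<or> K \<subseteq> N"
      proof (rule ccontr)
        assume "\<not> ?thesis"
        then obtain i k where ik: "i \<in> J P" "i \<notin> N" "k \<in> K" "k \<notin> N" by blast
        have "i \<otimes>\<^bsub>A\<^esub> k \<in> N" by (rule subsetD[OF sub ideal_prod.prod[OF ik(1,3)]])
        then show False using N.I_prime ik ideal.Icarr[OF JP] ideal.Icarr[OF K] by blast
      qed
    next
      assume "J P \<subseteq> N \<or> K \<subseteq> N"
      then show "ideal_prod A (J P) K \<subseteq> N" using A.ideal_prod_inter[OF JP K] by blast
    qed
    ultimately show ?case using insert.IH insert.prems by (auto simp: K_def)
  qed
qed

lemma P_ideal_generators:
  assumes P: "P \<in> Gamma B a b c" and de: "sqrt_choice B a b c d e"
  defines "T \<equiv> cst ` P \<union> (\<lambda>t. cst t * F_poly a b c (d P) (e P) P) ` inverse_ideal B P"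
  shows "T \<subseteq> R2" "P_ideal B a b c (d P) (e P) P = Idl\<^bsub>A\<^esub> (\<pi> ` T)"
proof -
  have de': "d P \<in> B" "e P \<in> B" "(d P)\<^sup>2 - a \<in> P" "(e P)\<^sup>2 - c \<in> P"
    using de P by (auto simp: sqrt_choice_def)
  have "P \<subseteq> B" using P prime_onD(3) by (auto simp: Gamma_iff)
  then show "T \<subseteq> R2"
    unfolding T_def using cst_mem cst_inverse_mult[OF _ F_poly_mem[OF P de']] by blast
  show "P_ideal B a b c (d P) (e P) P = Idl\<^bsub>A\<^esub> (\<pi> ` T)"
    unfolding P_ideal_def T_def image_Un cst_def by (intro arg_cong2[where f = genideal] refl) blast
qed

lemma singular_iff:
  assumes de: "sqrt_choice B a b c d e"
  shows "\<not> regular_local_ring Lc \<longleftrightarrow> H_ideal B a b c d e \<subseteq> N"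
proof -
  interpret A: cring A by (rule cring_A)
  have id: "ideal (P_ideal B a b c (d P) (e P) P) A" if "P \<in> Gamma B a b c" for P
    unfolding P_ideal_generators(2)[OF that de]
    using P_ideal_generators(1)[OF that de] carrier_A by (intro A.genideal_ideal) blast
  have "\<not> regular_local_ring Lc \<longleftrightarrow> f \<in> lsq R2 (lift N)" using regular_iff_not_lsq by blast
  also have "\<dots> \<longleftrightarrow> (\<exists>P\<in>Gamma B a b c. cst ` P \<union> (\<lambda>t. cst t * F_poly a b c (d P) (e P) P) ` inverse_ideal B P \<subseteq> lift N)"
    unfolding lsq_iff_Gamma[OF lift_prime f_lift de] by (intro bex_cong refl) blast
  also have "\<dots> \<longleftrightarrow> (\<exists>P\<in>Gamma B a b c. P_ideal B a b c (d P) (e P) P \<subseteq> N)"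
    by (intro bex_cong refl) (simp only: P_ideal_generators(2)[OF _ de] genideal_subset_iff[OF P_ideal_generators(1)[OF _ de]])
  also have "\<dots> \<longleftrightarrow> H_ideal B a b c d e \<subseteq> N"
    unfolding H_ideal_def using finprod_subset_iff[OF finite_Gamma, of "\<lambda>P. P_ideal B a b c (d P) (e P) P"] id by blast
  finally show ?thesis .
qed

end

end

theorem theorem3p4:
  fixes B :: "'k::field_char_0 set" and a b c :: 'k and d e :: "'k set \<Rightarrow> 'k"
  assumes "ring_of_algebraic_integers B"
    and "a \<in> B" and "b \<in> B" and "c \<in> B"
    and "sqrt_choice B a b c d e"
  shows "finite (Gamma B a b c) \<and>
    singular_locus (conic_ring B a b c)
      = zero_locus (conic_ring B a b c) (H_ideal B a b c d e)"
proof -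
  obtain K where K: "number_field K" "B = {x \<in> K. algebraic_int x}"
    using assms(1) unfolding ring_of_algebraic_integers_def by blast
  interpret conic K B a b c
    by unfold_locales (use K assms(2-4) in auto)
  have "singular_locus (conic_ring B a b c) = zero_locus (conic_ring B a b c) (H_ideal B a b c d e)"
    unfolding singular_locus_def zero_locus_def Spec_def
    using singular_iff[OF _ assms(5)] by blast
  then show ?thesis using finite_Gamma by blast
qed

end
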